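(* Suppose $|y|\le M$ almost surely and $f^*=L^r u^*$ for some $0<r<\frac12$ and $u^*\in L^2_{\rho_{\mathcal X}}$. Let $0<\lambda\le1$. For any $0<\delta<1$, with probability at least $1-\delta$, $$\|f_{D',\lambda}^\sharp-f^*\|_{L^2_{\rho_{\mathcal X}}}\le\left(\frac{2M}{\kappa}+4\|u^*\|_{L^2_{\rho_{\mathcal X}}}\right)\left(\frac{\mathcal B_{|D'|,\lambda}}{\sqrt\lambda}+1\right)^3\left(\mathcal B_{|D|,\lambda}+\lambda^r\right)\left(\log\frac4\delta\right)^3 .$$ If in addition there are constants $C_0>0$ and $0<\beta\le1$ such that $\mathcal N(\lambda)\le C_0\lambda^{-\beta}$ for all $\lambda>0$, $r+\beta\ge\frac12$, $\lambda=|D|^{-\frac1{2r+\beta}}$ and $|D'|\ge|D|^{\frac{1+\beta}{2r+\beta}}$, then there is a constant $C'$ independent of $\delta$, $|D|$ and $|D'|$ such that for any $\delta\in(0,1)$, with probability at least $1-\delta$, $$\|f_{D',\lambda}^\sharp-f^*\|_{L^2_{\rho_{\mathcal X}}}\le C'|D|^{-\frac r{2r+\beta}}\left(\log\frac4\delta\right)^3 .$$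
   Context: Setting. $\mathcal X$ is a compact metric space, $\rho$ is a Borel probability measure on $\mathcal X\times\mathbb R$ with marginal $\rho_{\mathcal X}$ on $\mathcal X$, and $f^*(x)=\mathbf E[y\mid x]$ (i.e. $y=f^*(x)+\epsilon$ with zero-mean noise). $K:\mathcal X\times\mathcal X\to\mathbb R$ is a Mercer kernel (continuous, symmetric, positive semidefinite), $\mathcal H_K$ its reproducing kernel Hilbert space with norm $\|\cdot\|_K$, $K_x=K(x,\cdot)$, and $\kappa=\max\{1,\sup_{x}\sqrt{K(x,x)}\}$. The integral operator $Lf(x)=\int_{\mathcal X}K(x,t)f(t)\,d\rho_{\mathcal X}(t)$ is compact, self-adjoint and positive on $L^2_{\rho_{\mathcal X}}$; $L_K$ denotes its restriction to $\mathcal H_K$. Powers of operators are defined by spectral calculus. Semi-supervised sample. $D=\{(x_i,y_i)\}_{i=1}^{|D|}$ is drawn i.i.d. from $\rho$, and $x_{|D|+1},\dots,x_{|D'|}$ (with $|D'|\ge|D|$) are additional unlabeled inputs drawn i.i.d. from $\rho_{\mathcal X}$, independently of $D$. Put $D'=\{(x_1,y_1'),\dots,(x_{|D|},y_{|D|}'),(x_{|D|+1},0),\dots,(x_{|D'|},0)\}$ with $y_i'=\frac{|D'|}{|D|}y_i$ for $1\le i\le|D|$; $\mathbf y_{D'}\in\mathbb R^{|D'|}$ is the vector of all responses in $D'$. Estimator. $S_{D'}:\mathcal H_K\to\mathbb R^{|D'|}$, $S_{D'}f=(f(x_1),\dots,f(x_{|D'|}))^\top$, with $S_{D'}^*\mathbf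 c=\sum_i c_iK_{x_i}$, and $L_{K,D'}=\frac1{|D'|}S_{D'}^*S_{D'}$. Then $f_{D',\lambda}=(\lambda I+L_{K,D'})^{-1}\frac1{|D'|}S_{D'}^*\mathbf y_{D'}$ and $f_{D',\lambda}^\sharp=f_{D',\lambda}+\lambda(\lambda I+L_{K,D'})^{-1}f_{D',\lambda}$. Complexity. $\mathcal N(\lambda)=\mathrm{Tr}((L_K+\lambda I)^{-1}L_K)$ and $\mathcal B_{n,\lambda}=\frac{2\kappa}{\sqrt n}\left\{\frac{\kappa}{\sqrt{n\lambda}}+\sqrt{\mathcal N(\lambda)}\right\}$. *)

theory Defs
  imports "HOL-Probability.Probability"
begin

section \<open>Kernels and reproducing kernel Hilbert spaces\<close>

text \<open>The input space is a whole type \<open>'a :: metric_space\<close>; its compactness is a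
  hypothesis \<open>compact UNIV\<close>.\<close>

definition mercer_kernel :: "('a::metric_space \<Rightarrow> 'a \<Rightarrow> real) \<Rightarrow> bool" where
  "mercer_kernel K \<longleftrightarrow>
     continuous_on UNIV (\<lambda>(x, t). K x t) \<and>
     (\<forall>x t. K x t = K t x) \<and>
     (\<forall>(n::nat) (xs :: nat \<Rightarrow> 'a) (c :: nat \<Rightarrow> real).
        (\<Sum>i<n. \<Sum>j<n. c i * c j * K (xs i) (xs j)) \<ge> 0)"

definition kappa :: "('a \<Rightarrow> 'a \<Rightarrow> real) \<Rightarrow> real" where
  "kappa K = max 1 (SUP x. sqrt (K x x))"

text \<open>A real Hilbert space whose elements are functions: carrier \<open>H\<close>, inner product \<open>ip\<close>
  (only its values on the carrier matter), pointwise vector space operations.\<close>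

definition inner_fun_space ::
    "('a \<Rightarrow> real) set \<Rightarrow> (('a \<Rightarrow> real) \<Rightarrow> ('a \<Rightarrow> real) \<Rightarrow> real) \<Rightarrow> bool" where
  "inner_fun_space H ip \<longleftrightarrow>
     (\<lambda>x. 0) \<in> H \<and>
     (\<forall>f\<in>H. \<forall>g\<in>H. (\<lambda>x. f x + g x) \<in> H) \<and>
     (\<forall>c. \<forall>f\<in>H. (\<lambda>x. c * f x) \<in> H) \<and>
     (\<forall>f\<in>H. \<forall>g\<in>H. ip f g = ip g f) \<and>
     (\<forall>f\<in>H. \<forall>g\<in>H. \<forall>h\<in>H. ip (\<lambda>x. f x + g x) h = ip f h + ip g h) \<and>
     (\<forall>c. \<forall>f\<in>H. \<forall>h\<in>H. ip (\<lambda>x. c * f x) h = c * ip f h) \<and>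
     (\<forall>f\<in>H. ip f f \<ge> 0) \<and>
     (\<forall>f\<in>H. ip f f = 0 \<longrightarrow> f = (\<lambda>x. 0))"

definition fun_norm :: "(('a \<Rightarrow> real) \<Rightarrow> ('a \<Rightarrow> real) \<Rightarrow> real) \<Rightarrow> ('a \<Rightarrow> real) \<Rightarrow> real" where
  "fun_norm ip f = sqrt (ip f f)"

definition hilbert_fun_space ::
    "('a \<Rightarrow> real) set \<Rightarrow> (('a \<Rightarrow> real) \<Rightarrow> ('a \<Rightarrow> real) \<Rightarrow> real) \<Rightarrow> bool" where
  "hilbert_fun_space H ip \<longleftrightarrow>
     inner_fun_space H ip \<and>
     (\<forall>F :: nat \<Rightarrow> 'a \<Rightarrow> real.
        (\<forall>k. F k \<in> H) \<and>
        (\<forall>e>0. \<exists>k0. \<forall>k\<ge>k0. \<forall>l\<ge>k0. fun_norm ip (\<lambda>x. F k x - F l x) < e) \<longrightarrow>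
        (\<exists>f\<in>H. (\<lambda>k. fun_norm ip (\<lambda>x. F k x - f x)) \<longlonglongrightarrow> 0))"

text \<open>\<open>(H, ip)\<close> is the reproducing kernel Hilbert space of \<open>K\<close>; these properties determine
  \<open>H\<close>, and \<open>ip\<close> on \<open>H\<close>, uniquely.  The function \<open>K x = K(x, \<cdot>)\<close> is the kernel section at \<open>x\<close>.\<close>

definition is_rkhs ::
    "('a \<Rightarrow> 'a \<Rightarrow> real) \<Rightarrow> ('a \<Rightarrow> real) set \<Rightarrow>
     (('a \<Rightarrow> real) \<Rightarrow> ('a \<Rightarrow> real) \<Rightarrow> real) \<Rightarrow> bool" where
  "is_rkhs K H ip \<longleftrightarrow>
     hilbert_fun_space H ip \<and>
     (\<forall>x. K x \<in> H) \<and>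
     (\<forall>f\<in>H. \<forall>x. ip f (K x) = f x)"

section \<open>Operators on a Hilbert space of functions\<close>

text \<open>The operator \<open>A + \<lambda> I\<close> and its inverse as a self-map of the carrier \<open>H\<close>.\<close>

definition shift_op ::
    "(('a \<Rightarrow> real) \<Rightarrow> 'a \<Rightarrow> real) \<Rightarrow> real \<Rightarrow> ('a \<Rightarrow> real) \<Rightarrow> 'a \<Rightarrow> real" where
  "shift_op A lam f = (\<lambda>x. A f x + lam * f x)"

definition resolvent ::
    "('a \<Rightarrow> real) set \<Rightarrow> (('a \<Rightarrow> real) \<Rightarrow> 'a \<Rightarrow> real) \<Rightarrow> real \<Rightarrow> ('a \<Rightarrow> real) \<Rightarrow> 'a \<Rightarrow> real" where
  "resolvent H A lam = inv_into H (shift_op A lam)"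

definition orthonormal_basis ::
    "('a \<Rightarrow> real) set \<Rightarrow> (('a \<Rightarrow> real) \<Rightarrow> ('a \<Rightarrow> real) \<Rightarrow> real) \<Rightarrow> ('a \<Rightarrow> real) set \<Rightarrow> bool" where
  "orthonormal_basis H ip B \<longleftrightarrow>
     B \<subseteq> H \<and>
     (\<forall>e\<in>B. \<forall>e'\<in>B. ip e e' = (if e = e' then 1 else 0)) \<and>
     (\<forall>f\<in>H. (\<forall>e\<in>B. ip f e = 0) \<longrightarrow> f = (\<lambda>x. 0))"

text \<open>Trace of a trace-class operator on \<open>H\<close>.  The sum does not depend on the orthonormal
  basis that is chosen.\<close>

definition op_trace ::
    "('a \<Rightarrow> real) set \<Rightarrow> (('a \<Rightarrow> real) \<Rightarrow> ('a \<Rightarrow> real) \<Rightarrow> real) \<Rightarrow>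
     (('a \<Rightarrow> real) \<Rightarrow> 'a \<Rightarrow> real) \<Rightarrow> real" where
  "op_trace H ip A = infsum (\<lambda>e. ip (A e) e) (SOME B. orthonormal_basis H ip B)"

section \<open>Square integrable functions and spectral calculus\<close>

text \<open>Elements of \<open>L\<^sup>2(\<nu>)\<close> are represented by functions; two functions represent the same
  element iff they agree almost everywhere.\<close>

definition L2_space :: "'a measure \<Rightarrow> ('a \<Rightarrow> real) set" where
  "L2_space \<nu> = {f \<in> borel_measurable \<nu>. integrable \<nu> (\<lambda>x. (f x)\<^sup>2)}"

definition L2_inner :: "'a measure \<Rightarrow> ('a \<Rightarrow> real) \<Rightarrow> ('a \<Rightarrow> real) \<Rightarrow> real" where
  "L2_inner \<nu> f g = (\<integral>x. f x * g x \<partial>\<nu>)"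

definition L2_norm :: "'a measure \<Rightarrow> ('a \<Rightarrow> real) \<Rightarrow> real" where
  "L2_norm \<nu> f = sqrt (\<integral>x. (f x)\<^sup>2 \<partial>\<nu>)"

definition L2_eigenspace ::
    "'a measure \<Rightarrow> (('a \<Rightarrow> real) \<Rightarrow> 'a \<Rightarrow> real) \<Rightarrow> real \<Rightarrow> ('a \<Rightarrow> real) set" where
  "L2_eigenspace \<nu> A m = {\<phi> \<in> L2_space \<nu>. AE x in \<nu>. A \<phi> x = m * \<phi> x}"

definition L2_eigenvalues ::
    "'a measure \<Rightarrow> (('a \<Rightarrow> real) \<Rightarrow> 'a \<Rightarrow> real) \<Rightarrow> real set" where
  "L2_eigenvalues \<nu> A = {m. \<exists>\<phi>\<in>L2_eigenspace \<nu> A m. L2_norm \<nu> \<phi> \<noteq> 0}"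

text \<open>\<open>p\<close> is the orthogonal projection of \<open>u\<close> onto the eigenspace for \<open>m\<close>.\<close>

definition is_eigenprojection ::
    "'a measure \<Rightarrow> (('a \<Rightarrow> real) \<Rightarrow> 'a \<Rightarrow> real) \<Rightarrow> real \<Rightarrow> ('a \<Rightarrow> real) \<Rightarrow> ('a \<Rightarrow> real) \<Rightarrow> bool" where
  "is_eigenprojection \<nu> A m u p \<longleftrightarrow>
     p \<in> L2_eigenspace \<nu> A m \<and>
     (\<forall>\<phi>\<in>L2_eigenspace \<nu> A m. L2_inner \<nu> (\<lambda>x. u x - p x) \<phi> = 0)"

text \<open>\<open>g = h(A) u\<close> in \<open>L\<^sup>2(\<nu>)\<close> for a compact self-adjoint operator \<open>A\<close>, whose spectral calculus is
  \<open>h(A) u = (\<Sum>m. h(m) P\<^sub>m u)\<close>: here \<open>m\<close> ranges over the eigenvalues (including \<open>0\<close>, if it is one),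
  \<open>P\<^sub>m\<close> is the orthogonal projection onto the eigenspace for \<open>m\<close>, and the series converges
  unconditionally in the norm of \<open>L\<^sup>2(\<nu>)\<close>.\<close>

definition is_spectral_apply ::
    "'a measure \<Rightarrow> (('a \<Rightarrow> real) \<Rightarrow> 'a \<Rightarrow> real) \<Rightarrow> (real \<Rightarrow> real) \<Rightarrow>
     ('a \<Rightarrow> real) \<Rightarrow> ('a \<Rightarrow> real) \<Rightarrow> bool" where
  "is_spectral_apply \<nu> A h u g \<longleftrightarrow>
     u \<in> L2_space \<nu> \<and> g \<in> L2_space \<nu> \<and>
     (\<exists>P :: real \<Rightarrow> 'a \<Rightarrow> real.
        (\<forall>m\<in>L2_eigenvalues \<nu> A. is_eigenprojection \<nu> A m u (P m)) \<and>
        ((\<lambda>S. L2_norm \<nu> (\<lambda>x. g x - (\<Sum>m\<in>S. h m * P m x))) \<longlongrightarrow> 0)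
          (finite_subsets_at_top (L2_eigenvalues \<nu> A)))"

text \<open>\<open>g = A\<^sup>r u\<close>.  For \<open>r > 0\<close> the eigenvalue \<open>0\<close> does not contribute, since \<open>0 powr r = 0\<close>.\<close>

definition is_power_apply ::
    "'a measure \<Rightarrow> (('a \<Rightarrow> real) \<Rightarrow> 'a \<Rightarrow> real) \<Rightarrow> real \<Rightarrow>
     ('a \<Rightarrow> real) \<Rightarrow> ('a \<Rightarrow> real) \<Rightarrow> bool" where
  "is_power_apply \<nu> A r u g \<longleftrightarrow> is_spectral_apply \<nu> A (\<lambda>m. m powr r) u g"

section \<open>The sampling distribution and the integral operator\<close>

definition marginal :: "('a::metric_space \<times> real) measure \<Rightarrow> 'a measure" where
  "marginal \<rho> = distr \<rho> borel fst"

text \<open>\<open>f\<close> is (a version of) the regression function \<open>x \<mapsto> E[y | x]\<close>.\<close>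

definition regression_function ::
    "('a::metric_space \<times> real) measure \<Rightarrow> ('a \<Rightarrow> real) \<Rightarrow> bool" where
  "regression_function \<rho> f \<longleftrightarrow>
     f \<in> borel_measurable borel \<and>
     integrable \<rho> snd \<and>
     (AE z in \<rho>. f (fst z) = real_cond_exp \<rho> (vimage_algebra (space \<rho>) fst borel) snd z)"

text \<open>The same formula gives the operator \<open>L\<close> on \<open>L\<^sup>2\<close> and its restriction \<open>L\<^sub>K\<close> to the
  reproducing kernel Hilbert space.\<close>

definition int_op ::
    "('a::metric_space \<times> real) measure \<Rightarrow> ('a \<Rightarrow> 'a \<Rightarrow> real) \<Rightarrow> ('a \<Rightarrow> real) \<Rightarrow> 'a \<Rightarrow> real" where
  "int_op \<rho> K f = (\<lambda>x. \<integral>t. K x t * f t \<partial>marginal \<rho>)"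

definition eff_dim ::
    "('a::metric_space \<times> real) measure \<Rightarrow> ('a \<Rightarrow> 'a \<Rightarrow> real) \<Rightarrow> ('a \<Rightarrow> real) set \<Rightarrow>
     (('a \<Rightarrow> real) \<Rightarrow> ('a \<Rightarrow> real) \<Rightarrow> real) \<Rightarrow> real \<Rightarrow> real" where
  "eff_dim \<rho> K H ip lam =
     op_trace H ip (\<lambda>f. resolvent H (int_op \<rho> K) lam (int_op \<rho> K f))"

definition B_quant ::
    "('a::metric_space \<times> real) measure \<Rightarrow> ('a \<Rightarrow> 'a \<Rightarrow> real) \<Rightarrow> ('a \<Rightarrow> real) set \<Rightarrow>
     (('a \<Rightarrow> real) \<Rightarrow> ('a \<Rightarrow> real) \<Rightarrow> real) \<Rightarrow> nat \<Rightarrow> real \<Rightarrow> real" where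
  "B_quant \<rho> K H ip n lam =
     2 * kappa K / sqrt (real n) *
       (kappa K / sqrt (real n * lam) + sqrt (eff_dim \<rho> K H ip lam))"

section \<open>The semi-supervised sample and the estimator\<close>

text \<open>The law of \<open>n\<close> labeled observations (indices \<open>0..<n\<close>) drawn independently from \<open>\<rho>\<close>
  together with \<open>N - n\<close> unlabeled inputs (indices \<open>n..<N\<close>) drawn independently from the
  marginal.\<close>

type_synonym 'a sample = "(nat \<Rightarrow> 'a \<times> real) \<times> (nat \<Rightarrow> 'a)"

definition sample_measure ::
    "('a::metric_space \<times> real) measure \<Rightarrow> nat \<Rightarrow> nat \<Rightarrow> 'a sample measure" where
  "sample_measure \<rho> n N =
     (\<Pi>\<^sub>M i\<in>{..<n}. \<rho>) \<Otimes>\<^sub>M (\<Pi>\<^sub>M i\<in>{n..<N}. marginal \<rho>)"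

definition sample_input :: "nat \<Rightarrow> 'a sample \<Rightarrow> nat \<Rightarrow> 'a" where
  "sample_input n \<omega> i = (if i < n then fst (fst \<omega> i) else snd \<omega> i)"

definition sample_response :: "nat \<Rightarrow> nat \<Rightarrow> 'a sample \<Rightarrow> nat \<Rightarrow> real" where
  "sample_response n N \<omega> i = (if i < n then real N / real n * snd (fst \<omega> i) else 0)"

text \<open>Vectors of length \<open>N\<close> are functions on \<open>nat\<close> of which only the values at indices
  \<open>i < N\<close> are used.\<close>

definition sampling_op :: "(nat \<Rightarrow> 'a) \<Rightarrow> ('a \<Rightarrow> real) \<Rightarrow> nat \<Rightarrow> real" where
  "sampling_op xs f = (\<lambda>i. f (xs i))"

definition sampling_adj ::
    "('a \<Rightarrow> 'a \<Rightarrow> real) \<Rightarrow> nat \<Rightarrow> (nat \<Rightarrow> 'a) \<Rightarrow> (nat \<Rightarrow> real) \<Rightarrow> 'a \<Rightarrow> real" where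
  "sampling_adj K N xs c = (\<lambda>x. \<Sum>i<N. c i * K (xs i) x)"

definition emp_op ::
    "('a \<Rightarrow> 'a \<Rightarrow> real) \<Rightarrow> nat \<Rightarrow> (nat \<Rightarrow> 'a) \<Rightarrow> ('a \<Rightarrow> real) \<Rightarrow> 'a \<Rightarrow> real" where
  "emp_op K N xs f = (\<lambda>x. 1 / real N * sampling_adj K N xs (sampling_op xs f) x)"

definition krr_estimator ::
    "('a \<Rightarrow> 'a \<Rightarrow> real) \<Rightarrow> ('a \<Rightarrow> real) set \<Rightarrow> nat \<Rightarrow> nat \<Rightarrow> real \<Rightarrow> 'a sample \<Rightarrow> 'a \<Rightarrow> real" where
  "krr_estimator K H n N lam \<omega> =
     resolvent H (emp_op K N (sample_input n \<omega>)) lam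
       (\<lambda>x. 1 / real N * sampling_adj K N (sample_input n \<omega>) (sample_response n N \<omega>) x)"

definition sharp_estimator ::
    "('a \<Rightarrow> 'a \<Rightarrow> real) \<Rightarrow> ('a \<Rightarrow> real) set \<Rightarrow> nat \<Rightarrow> nat \<Rightarrow> real \<Rightarrow> 'a sample \<Rightarrow> 'a \<Rightarrow> real" where
  "sharp_estimator K H n N lam \<omega> =
     (\<lambda>x. krr_estimator K H n N lam \<omega> x +
          lam * resolvent H (emp_op K N (sample_input n \<omega>)) lam
                  (krr_estimator K H n N lam \<omega>) x)"

definition L2_error ::
    "('a::metric_space \<times> real) measure \<Rightarrow> ('a \<Rightarrow> 'a \<Rightarrow> real) \<Rightarrow> ('a \<Rightarrow> real) set \<Rightarrow>
     ('a \<Rightarrow> real) \<Rightarrow> nat \<Rightarrow> nat \<Rightarrow> real \<Rightarrow> 'a sample \<Rightarrow> real" where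
  "L2_error \<rho> K H fstar n N lam \<omega> =
     L2_norm (marginal \<rho>) (\<lambda>x. sharp_estimator K H n N lam \<omega> x - fstar x)"

end

theory Submission
  imports Defs
begin

text \<open>
  Let \<open>h\<close> be \<open>L\<^sup>r u\<^sup>*\<close> with the eigenvalues below \<open>\<lambda>\<close> cut off.  Spectral calculus on finitely many
  eigenspaces gives \<open>\<parallel>h - f\<^sup>*\<parallel> \<le> \<lambda>\<^sup>r \<parallel>u\<^sup>*\<parallel>\<close> in \<open>L\<^sup>2\<close> and \<open>\<parallel>h\<parallel>\<^sub>K \<le> \<lambda>\<^bsup>r-1/2\<^esup> \<parallel>u\<^sup>*\<parallel>\<close>.  The rest of the
  argument takes place in the norms \<open>\<langle>(L + \<lambda>) f, f\<rangle>\<^bsup>1/2\<^esup>\<close> and \<open>\<langle>(L + \<lambda>)\<^bsup>-1\<^esup> f, f\<rangle>\<^bsup>1/2\<^esup>\<close>, so that no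
  square roots of operators are needed: if the empirical operator \<open>A\<close> satisfies
  \<open>\<parallel>(L + \<lambda>)\<^bsup>-1/2\<^esup> (A - L) f\<parallel> \<le> d \<parallel>f\<parallel>\<^sub>K\<close>, then the two regularized norms of \<open>f\<close> differ at most by the
  factor \<open>1 + d / \<lambda>\<^bsup>1/2\<^esup>\<close>, and the error is controlled by \<open>d\<close> and by the deviation of the data.

  Both deviations are norms of averages of centred independent elements of a Hilbert space.
  Pinelis' method applies: \<open>cosh (t \<parallel>S\<^sub>m\<parallel>)\<close> grows in expectation at most by the factor
  \<open>1 + t\<^sup>2 \<sigma>\<^sup>2\<close> per summand, which only involves the scalar Gram matrix of the summands.
  Two events of probability \<open>1 - \<delta>/2\<close> each, one for the labelled data and one for all inputs, then
  give the bound.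
\<close>

section \<open>Positive semidefinite forms on spaces of functions\<close>

text \<open>For r < 1/2 the target f^* is in general no element of H, so the empirical operator is
  applied to h instead, whose norm in H may be as large as lam^(r - 1/2) times that of u^*. An
  operator deviation d therefore costs d lam^(r - 1/2) = (d / sqrt lam) lam^r: this is the origin of
  the quotient B_N / sqrt lam. Unlabelled inputs enter only through d, hence they can keep this
  quotient bounded even where B_n / sqrt lam is not. The exponent 3 has two sources. Passing from
  the population norm to the empirical one and back costs p^2 with p = 1 + d / sqrt lam, and the
  deviation applied to h contributes one more factor p - 1. Each of these factors carries one
  logarithm, because the exponential inequality is used with a threshold linear in l = log (4 /
  \<delta>); the data term has p^2 and one logarithm of its own. Resolvents are inverses given by
  choice, so neither their existence nor their measurability in the sample is immediate; both come
  from one explicit convergent iteration.\<close>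

lemma discriminant_le:
  fixes x y z :: real
  assumes nonneg: "\<And>s t. 0 \<le> s\<^sup>2 * x + 2 * s * t * y + t\<^sup>2 * z"
  shows "y\<^sup>2 \<le> x * z"
proof (cases "z = 0")
  case False
  then have pos: "0 < z" using nonneg[of 0 1] by simp
  have "0 \<le> z * (z * x - y\<^sup>2)"
    using nonneg[of z "- y"] by (simp add: power2_eq_square algebra_simps)
  then show ?thesis using pos by (simp add: zero_le_mult_iff mult.commute)
next
  case True
  have "y = 0"
  proof (rule ccontr)
    assume "y \<noteq> 0"
    \<comment> \<open>For z = 0 the form is affine in t with slope 2 y; this t gives it the value
      -1.\<close>
    then show False using nonneg[of 1 "- (x + 1) / (2 * y)"] True by (simp add: field_simps)
  qed
  then show ?thesis using True by simp
qed

text \<open>The form may be degenerate, as it is on functions that represent classes in L2. The same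
  facts then serve the inner product of H, the two regularized forms and L2.\<close>

locale semi_inner =
  fixes V :: "('a \<Rightarrow> real) set" and b :: "('a \<Rightarrow> real) \<Rightarrow> ('a \<Rightarrow> real) \<Rightarrow> real"
  assumes zero_closed: "(\<lambda>x. 0) \<in> V"
    and add_closed: "f \<in> V \<Longrightarrow> g \<in> V \<Longrightarrow> (\<lambda>x. f x + g x) \<in> V"
    and scale_closed: "f \<in> V \<Longrightarrow> (\<lambda>x. c * f x) \<in> V"
    and form_sym: "f \<in> V \<Longrightarrow> g \<in> V \<Longrightarrow> b f g = b g f"
    and form_add_left:
      "f \<in> V \<Longrightarrow> g \<in> V \<Longrightarrow> h \<in> V \<Longrightarrow> b (\<lambda>x. f x + g x) h = b f h + b g h"
    and form_scale_left: "f \<in> V \<Longrightarrow> h \<in> V \<Longrightarrow> b (\<lambda>x. c * f x) h = c * b f h"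
    and form_nonneg: "f \<in> V \<Longrightarrow> 0 \<le> b f f"
begin

abbreviation "nrm \<equiv> fun_norm b"

lemma diff_closed: "f \<in> V \<Longrightarrow> g \<in> V \<Longrightarrow> (\<lambda>x. f x - g x) \<in> V"
  using add_closed[of f "\<lambda>x. (-1) * g x"] scale_closed[of g "-1"] by simp

lemma sum_closed:
  "finite I \<Longrightarrow> (\<And>i. i \<in> I \<Longrightarrow> F i \<in> V) \<Longrightarrow> (\<lambda>x. \<Sum>i\<in>I. F i x) \<in> V"
  by (induction I rule: finite_induct) (simp_all add: zero_closed add_closed)

lemma lincomb_closed:
  "finite I \<Longrightarrow> (\<And>i. i \<in> I \<Longrightarrow> F i \<in> V) \<Longrightarrow> (\<lambda>x. \<Sum>i\<in>I. c i * F i x) \<in> V"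
  by (rule sum_closed) (auto intro: scale_closed)

lemma form_diff_left:
  assumes "f \<in> V" "g \<in> V" "h \<in> V"
  shows "b (\<lambda>x. f x - g x) h = b f h - b g h"
  using form_add_left[of f "\<lambda>x. (-1)
    * g x" h] scale_closed[of g "-1"] form_scale_left[of g h "-1"] assms
  by simp

lemma form_zero_left: "h \<in> V \<Longrightarrow> b (\<lambda>x. 0) h = 0"
  using form_scale_left[of "\<lambda>x. 0" h 0] zero_closed by simp

lemma form_zero_right: "h \<in> V \<Longrightarrow> b h (\<lambda>x. 0) = 0"
  using form_sym[OF zero_closed, of h] form_zero_left[of h] by simp

lemma form_add_right:
  "f \<in> V \<Longrightarrow> g \<in> V \<Longrightarrow> h \<in> V \<Longrightarrow> b h (\<lambda>x. f x + g x) = b h f + b h g"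
  by (simp add: form_sym[of h] add_closed form_add_left)

lemma form_diff_right:
  "f \<in> V \<Longrightarrow> g \<in> V \<Longrightarrow> h \<in> V \<Longrightarrow> b h (\<lambda>x. f x - g x) = b h f - b h g"
  by (simp add: form_sym[of h] diff_closed form_diff_left)

lemma form_scale_right: "f \<in> V \<Longrightarrow> h \<in> V \<Longrightarrow> b h (\<lambda>x. c * f x) = c * b h f"
  by (simp add: form_sym[of h] scale_closed form_scale_left)

lemma form_sum_left:
  assumes "finite I" "\<And>i. i \<in> I \<Longrightarrow> F i \<in> V" "h \<in> V"
  shows "b (\<lambda>x. \<Sum>i\<in>I. F i x) h = (\<Sum>i\<in>I. b (F i) h)"
  using assms
  by (induction I rule: finite_induct) (simp_all add: form_zero_left form_add_left sum_closed)

lemma form_lincomb_left: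
  assumes "finite I" "\<And>i. i \<in> I \<Longrightarrow> F i \<in> V" "h \<in> V"
  shows "b (\<lambda>x. \<Sum>i\<in>I. c i * F i x) h = (\<Sum>i\<in>I. c i * b (F i) h)"
  using assms by (subst form_sum_left) (auto intro: scale_closed simp: form_scale_left)

lemma form_lincomb_right:
  assumes "finite I" "\<And>i. i \<in> I \<Longrightarrow> F i \<in> V" "h \<in> V"
  shows "b h (\<lambda>x. \<Sum>i\<in>I. c i * F i x) = (\<Sum>i\<in>I. c i * b h (F i))"
  using assms by (simp add: form_sym[of h] lincomb_closed form_lincomb_left)

lemma form_lincomb_lincomb:
  assumes "finite I" "\<And>i. i \<in> I \<Longrightarrow> F i \<in> V"
  shows "b (\<lambda>x. \<Sum>i\<in>I. c i * F i x) (\<lambda>x. \<Sum>i\<in>I. c i * F i x)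
    = (\<Sum>i\<in>I. \<Sum>j\<in>I. c i * c j * b (F i) (F j))"
  using assms
  by (simp add: form_lincomb_left form_lincomb_right lincomb_closed sum_distrib_left mult.assoc)

lemma form_combo:
  assumes "f \<in> V" "g \<in> V"
  shows "b (\<lambda>x. s * f x + t * g x) (\<lambda>x. s * f x + t * g x)
    = s\<^sup>2 * b f f + 2 * s * t * b f g + t\<^sup>2 * b g g"
  using assms form_sym[of f g]
  by (simp add: form_add_left form_add_right form_scale_left form_scale_right add_closed
    scale_closed
      power2_eq_square algebra_simps)

lemma form_diff_self:
  assumes "f \<in> V" "g \<in> V"
  shows "b (\<lambda>x. f x - g x) (\<lambda>x. f x - g x) = b f f - 2 * b f g + b g g"
  using assms form_sym[of f g]
  by (simp add: form_diff_left form_diff_right diff_closed algebra_simps)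

lemma form_add_self:
  assumes "f \<in> V" "g \<in> V"
  shows "b (\<lambda>x. f x + g x) (\<lambda>x. f x + g x) = b f f + 2 * b f g + b g g"
  using form_combo[OF assms, of 1 1] by simp

text \<open>The parallelogram law without its sum term; it bounds a centred feature by the feature
  and its mean.\<close>

lemma form_diff_self_le:
  assumes "f \<in> V" "g \<in> V"
  shows "b (\<lambda>x. f x - g x) (\<lambda>x. f x - g x) \<le> 2 * b f f + 2 * b g g"
  using form_nonneg[OF add_closed[OF assms]]
  unfolding form_diff_self[OF assms] form_add_self[OF assms] by linarith

lemma Cauchy_Schwarz_sq:
  assumes "f \<in> V" "g \<in> V"
  shows "(b f g)\<^sup>2 \<le> b f f * b g g"
proof (rule discriminant_le)
  fix s t
  show "0 \<le> s\<^sup>2 * b f f + 2 * s * t * b f g + t\<^sup>2 * b g g"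
    unfolding form_combo[OF assms, symmetric] by (intro form_nonneg add_closed scale_closed assms)
qed

lemma nrm_sq: "f \<in> V \<Longrightarrow> (nrm f)\<^sup>2 = b f f"
  by (simp add: fun_norm_def form_nonneg)

lemma nrm_nonneg: "f \<in> V \<Longrightarrow> 0 \<le> nrm f"
  by (simp add: fun_norm_def form_nonneg)

text \<open>Bounds for adjoints and resolvents arise as an estimate of b f f by a multiple of the
  norm of f itself; this cancels that norm, also when it vanishes.\<close>

lemma nrm_le_if_form_le:
  assumes "f \<in> V" "0 \<le> c" "b f f \<le> c * nrm f"
  shows "nrm f \<le> c"
proof (rule ccontr)
  assume "\<not> nrm f \<le> c"
  then have "c * nrm f < nrm f * nrm f"
    using assms(2) by (intro mult_strict_right_mono) auto
  then show False using assms(3) nrm_sq[OF assms(1)] by (simp add: power2_eq_square)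
qed

lemma Cauchy_Schwarz: "f \<in> V \<Longrightarrow> g \<in> V \<Longrightarrow> \<bar>b f g\<bar> \<le> nrm f * nrm g"
  using Cauchy_Schwarz_sq[of f g] nrm_sq[of f] nrm_sq[of g] nrm_nonneg[of f] nrm_nonneg[of g]
  by (metis abs_le_square_iff abs_of_nonneg mult_nonneg_nonneg power_mult_distrib)

lemma nrm_triangle:
  assumes "f \<in> V" "g \<in> V"
  shows "nrm (\<lambda>x. f x + g x) \<le> nrm f + nrm g"
proof (rule power2_le_imp_le)
  show "(nrm (\<lambda>x. f x + g x))\<^sup>2 \<le> (nrm f + nrm g)\<^sup>2"
    using Cauchy_Schwarz[OF assms] form_add_self[OF assms] nrm_sq[OF assms(1)] nrm_sq[OF assms(2)]
      nrm_sq[OF add_closed[OF assms]]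
    by (simp add: power2_sum)
qed (simp add: nrm_nonneg assms)

lemma nrm_scale: "f \<in> V \<Longrightarrow> nrm (\<lambda>x. c * f x) = \<bar>c\<bar> * nrm f"
  by (simp add: fun_norm_def form_scale_left form_scale_right scale_closed real_sqrt_mult
      flip: mult.assoc)

lemma nrm_triangle_diff:
  assumes "f \<in> V" "g \<in> V"
  shows "nrm (\<lambda>x. f x - g x) \<le> nrm f + nrm g"
  using nrm_triangle[of f "\<lambda>x. (-1) * g x"] nrm_scale[of g "-1"] scale_closed[of g "-1"] assms
  by simp

lemma nrm_diff_commute:
  "f \<in> V \<Longrightarrow> g \<in> V \<Longrightarrow> nrm (\<lambda>x. f x - g x) = nrm (\<lambda>x. g x - f x)"
  using nrm_scale[of "\<lambda>x. f x - g x" "-1"] diff_closed[of f g] by simp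

lemma nrm_lincomb_le:
  assumes "finite I" "\<And>i. i \<in> I \<Longrightarrow> F i \<in> V"
  shows "nrm (\<lambda>x. \<Sum>i\<in>I. c i * F i x) \<le> (\<Sum>i\<in>I. \<bar>c i\<bar> * nrm (F i))"
  using assms
proof (induction I rule: finite_induct)
  case empty
  then show ?case by (simp add: fun_norm_def form_zero_left zero_closed)
next
  case (insert i I)
  then have "nrm (\<lambda>x. c i * F i x + (\<Sum>i\<in>I. c i * F i x))
      \<le> nrm (\<lambda>x. c i * F i x) + nrm (\<lambda>x. \<Sum>i\<in>I. c i * F i x)"
    by (intro nrm_triangle scale_closed lincomb_closed) auto
  then show ?case using insert by (simp add: nrm_scale)
qed

end

section \<open>Bounded positive operators and their resolvents\<close>

locale hilbert_functions =
  fixes H :: "('a \<Rightarrow> real) set" and ip :: "('a \<Rightarrow> real) \<Rightarrow> ('a \<Rightarrow> real) \<Rightarrow> real"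
  assumes hilbert: "hilbert_fun_space H ip"
begin

sublocale semi_inner H ip
  using hilbert unfolding hilbert_fun_space_def inner_fun_space_def
  by unfold_locales blast+

lemma eq_zero_if_form_zero: "f \<in> H \<Longrightarrow> ip f f = 0 \<Longrightarrow> f = (\<lambda>x. 0)"
  using hilbert unfolding hilbert_fun_space_def inner_fun_space_def by blast

lemma eq_zero_if_nrm_zero: "f \<in> H \<Longrightarrow> nrm f = 0 \<Longrightarrow> f = (\<lambda>x. 0)"
  using eq_zero_if_form_zero nrm_sq[of f] by simp

lemma complete:
  assumes "\<And>k. F k \<in> H"
    and "\<And>e. e > 0 \<Longrightarrow> \<exists>k0. \<forall>k\<ge>k0. \<forall>l\<ge>k0. nrm (\<lambda>x. F k x - F l x) < e"
  obtains f where "f \<in> H" "(\<lambda>k. nrm (\<lambda>x. F k x - f x)) \<longlonglongrightarrow> 0"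
proof -
  have "\<exists>f\<in>H. (\<lambda>k. nrm (\<lambda>x. F k x - f x)) \<longlonglongrightarrow> 0"
    using hilbert assms unfolding hilbert_fun_space_def by blast
  then show ?thesis using that by blast
qed

lemma form_tendsto:
  assumes F: "\<And>k. F k \<in> H" and f: "f \<in> H" and g: "g \<in> H"
    and lim: "(\<lambda>k. nrm (\<lambda>x. F k x - f x)) \<longlonglongrightarrow> 0"
  shows "(\<lambda>k. ip (F k) g) \<longlonglongrightarrow> ip f g"
proof -
  have "(\<lambda>k. nrm (\<lambda>x. F k x - f x) * nrm g) \<longlonglongrightarrow> 0"
    using tendsto_mult_right[OF lim, of "nrm g"] by simp
  moreover have "\<forall>k. norm (ip (F k) g - ip f g) \<le> nrm (\<lambda>x. F k x - f x) * nrm g"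
    using Cauchy_Schwarz[OF diff_closed[OF F f] g] by (simp add: form_diff_left F f g)
  ultimately have "(\<lambda>k. ip (F k) g - ip f g) \<longlonglongrightarrow> 0"
    by (intro tendsto_0_le[where K = 1 and g = "\<lambda>k. ip (F k) g - ip f g"
          and f = "\<lambda>k. nrm (\<lambda>x. F k x - f x) * nrm g"])
      (auto intro!: always_eventually simp: abs_mult nrm_nonneg diff_closed F f g)
  then show ?thesis by (simp add: LIM_zero_iff)
qed

lemma complete_geometric:
  assumes F: "\<And>k. F k \<in> H" and th: "0 \<le> \<theta>" "\<theta> < 1"
    and step: "\<And>k. nrm (\<lambda>x. F (Suc k) x - F k x) \<le> C * \<theta> ^ k"
  obtains f where "f \<in> H" "(\<lambda>k. nrm (\<lambda>x. F k x - f x)) \<longlonglongrightarrow> 0"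
proof (rule complete[OF F])
  have C: "0 \<le> C" using step[of 0] nrm_nonneg[OF diff_closed[OF F F, of "Suc 0" 0]] by simp
  define D where "D = C / (1 - \<theta>)"
  have D: "0 \<le> D" using C th by (simp add: D_def)
  \<comment> \<open>The factor 1 - \<theta> ^ k is the exact geometric sum; the weaker bound D *
    \<theta> ^ j would not survive the induction.\<close>
  have tail: "nrm (\<lambda>x. F (j + k) x - F j x) \<le> D * \<theta> ^ j * (1 - \<theta> ^ k)" for j k
  proof (induction k)
    case 0
    then show ?case by (simp add: fun_norm_def form_zero_left zero_closed)
  next
    case (Suc k)
    have "nrm (\<lambda>x. (F (Suc (j + k)) x - F (j + k) x) + (F (j + k) x - F j x))
        \<le> nrm (\<lambda>x. F (Suc (j + k)) x - F (j + k) x) + nrm (\<lambda>x. F (j + k) x - F j x)"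
      by (intro nrm_triangle diff_closed F)
    also have "\<dots> \<le> C * \<theta> ^ (j + k) + D * \<theta> ^ j * (1 - \<theta> ^ k)"
      using step[of "j + k"] Suc by simp
    also have "\<dots> = D * \<theta> ^ j * (1 - \<theta> ^ Suc k)"
      using th by (simp add: D_def field_simps power_add)
    finally show ?case by simp
  qed
  have tail': "nrm (\<lambda>x. F k x - F j x) \<le> D * \<theta> ^ j" if "j \<le> k" for j k
  proof -
    have "D * \<theta> ^ j * (1 - \<theta> ^ (k - j)) \<le> D * \<theta> ^ j * 1"
      using D th by (intro mult_left_mono) auto
    then show ?thesis using tail[of j "k - j"] that by simp
  qed
  fix e :: real assume e: "e > 0"
  have "(\<lambda>j. D * \<theta> ^ j) \<longlonglongrightarrow> D * 0"
    by (intro tendsto_mult_left LIMSEQ_power_zero) (use th in simp)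
  then have "\<forall>\<^sub>F j in sequentially. D * \<theta> ^ j < e"
    using e by (auto dest: order_tendstoD)
  then obtain k0 where k0: "\<And>j. j \<ge> k0 \<Longrightarrow> D * \<theta> ^ j < e"
    by (auto simp: eventually_sequentially)
  have "nrm (\<lambda>x. F k x - F l x) < e" if "k \<ge> k0" "l \<ge> k0" for k l
  proof (cases "l \<le> k")
    case True
    show ?thesis using tail'[OF True] k0[OF that(2)] by simp
  next
    case False
    then show ?thesis using tail'[of k l] k0[OF that(1)] nrm_diff_commute[OF F F, of k l] by simp
  qed
  then show "\<exists>k0. \<forall>k\<ge>k0. \<forall>l\<ge>k0. nrm (\<lambda>x. F k x - F l x) < e" by blast
qed (rule that)

end

text \<open>Fixed-step iteration for the equation (A + lam) u = g. It serves twice: its limit shows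
  that A + lam is onto, and its iterates, finite expressions in the sample, make the resolvent
  measurable.\<close>

fun richardson ::
    "(('a \<Rightarrow> real) \<Rightarrow> 'a \<Rightarrow> real) \<Rightarrow> real \<Rightarrow> real \<Rightarrow> ('a \<Rightarrow> real) \<Rightarrow> nat \<Rightarrow> 'a \<Rightarrow> real" where
  "richardson A lam \<tau> g 0 = (\<lambda>x. 0)"
| "richardson A lam \<tau> g (Suc j) =
     (\<lambda>x. richardson A lam \<tau> g j x - \<tau> * (shift_op A lam (richardson A lam \<tau> g j) x - g x))"

locale positive_operator = hilbert_functions H ip
  for H :: "('a \<Rightarrow> real) set" and ip +
  fixes A :: "('a \<Rightarrow> real) \<Rightarrow> 'a \<Rightarrow> real" and c :: real
  assumes op_closed: "f \<in> H \<Longrightarrow> A f \<in> H"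
    and op_add: "f \<in> H \<Longrightarrow> g \<in> H \<Longrightarrow> A (\<lambda>x. f x + g x) = (\<lambda>x. A f x + A g x)"
    and op_scale: "f \<in> H \<Longrightarrow> A (\<lambda>x. s * f x) = (\<lambda>x. s * A f x)"
    and op_sym: "f \<in> H \<Longrightarrow> g \<in> H \<Longrightarrow> ip (A f) g = ip f (A g)"
    and op_pos: "f \<in> H \<Longrightarrow> 0 \<le> ip (A f) f"
    and op_bound: "f \<in> H \<Longrightarrow> nrm (A f) \<le> c * nrm f"
    and bound_pos: "0 < c"
begin

lemma op_diff: "f \<in> H \<Longrightarrow> g \<in> H \<Longrightarrow> A (\<lambda>x. f x - g x) = (\<lambda>x. A f x - A g x)"
  using op_add[of f "\<lambda>x. (-1) * g x"] op_scale[of g "-1"] scale_closed[of g "-1"] by simp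

end

locale shifted_operator = positive_operator H ip A c
  for H :: "('a \<Rightarrow> real) set" and ip A c +
  fixes lam :: real
  assumes lam: "0 < lam"
begin

abbreviation "sh \<equiv> shift_op A lam"
abbreviation "res \<equiv> resolvent H A lam"

text \<open>Minimizer of 1 - 2 t lam + t^2 (c + lam)^2, whose minimum is the square of
  \<open>rate\<close>. It depends on A only through the norm bound c, so that one step size serves
  all samples.\<close>

definition "step_size = lam / (c + lam)\<^sup>2"

lemma shift_closed: "f \<in> H \<Longrightarrow> sh f \<in> H"
  by (simp add: shift_op_def add_closed op_closed scale_closed)

lemma shift_diff: "f \<in> H \<Longrightarrow> g \<in> H \<Longrightarrow> sh (\<lambda>x. f x - g x) = (\<lambda>x. sh f x - sh g x)"
  by (auto simp: shift_op_def op_diff algebra_simps)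

lemma form_shift: "f \<in> H \<Longrightarrow> g \<in> H \<Longrightarrow> ip (sh f) g = ip (A f) g + lam * ip f g"
  by (simp add: shift_op_def form_add_left form_scale_left op_closed scale_closed)

lemma shift_coercive: "f \<in> H \<Longrightarrow> lam * ip f f \<le> ip (sh f) f"
  by (simp add: form_shift op_pos)

lemma nrm_shift_le: "f \<in> H \<Longrightarrow> nrm (sh f) \<le> (c + lam) * nrm f"
  using nrm_triangle[of "A f" "\<lambda>x. lam * f x"] op_bound[of f] lam
  by (simp add: shift_op_def op_closed scale_closed nrm_scale algebra_simps)

lemma shift_sym: "f \<in> H \<Longrightarrow> g \<in> H \<Longrightarrow> ip (sh f) g = ip f (sh g)"
  unfolding form_shift
  by (simp add: shift_op_def form_add_right form_scale_right op_closed scale_closed op_sym)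

definition "rate = sqrt (1 - (lam / (c + lam))\<^sup>2)"

lemma rate: "0 \<le> rate" "rate < 1"
proof -
  have "0 < lam / (c + lam)" "lam / (c + lam) \<le> 1" using lam bound_pos by auto
  then have "(lam / (c + lam))\<^sup>2 \<le> 1" "0 < (lam / (c + lam))\<^sup>2"
    by (auto intro: power_le_one)
  then show "0 \<le> rate" "rate < 1" by (auto simp: rate_def)
qed

text \<open>In the expanded square, coercivity controls the term linear in the step size and the
  norm bound controls the quadratic one.\<close>

lemma contraction:
  assumes f: "f \<in> H"
  shows "nrm (\<lambda>x. f x - step_size * sh f x) \<le> rate * nrm f"
proof (rule power2_le_imp_le)
  let ?b = "c + lam"
  have b: "0 < ?b" using lam bound_pos by simp
  have t: "0 < step_size" using lam b by (simp add: step_size_def)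
  have 1: "step_size * lam = (lam / ?b)\<^sup>2" "step_size\<^sup>2 * ?b\<^sup>2 = (lam / ?b)\<^sup>2"
    using b by (simp_all add: step_size_def power2_eq_square divide_simps)
  have "(nrm (\<lambda>x. f x - step_size * sh f x))\<^sup>2
      = ip f f - 2 * step_size * ip f (sh f) + step_size\<^sup>2 * ip (sh f) (sh f)"
    using form_diff_self[of f "\<lambda>x. step_size * sh f x"] f
      nrm_sq[of "\<lambda>x. f x - step_size * sh f x"]
    by (simp add: diff_closed scale_closed shift_closed form_scale_right form_scale_left
        power2_eq_square algebra_simps)
  also have "\<dots> \<le> ip f f - 2 * step_size * (lam * ip f f) + step_size\<^sup>2 * (?b\<^sup>2 * ip f f)"
  proof -
    have "ip (sh f) (sh f) \<le> ?b\<^sup>2 * ip f f"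
      using power_mono[OF nrm_shift_le[OF f] nrm_nonneg[OF shift_closed[OF f]], of 2]
      by (simp add: nrm_sq f shift_closed power_mult_distrib)
    then have "step_size\<^sup>2 * ip (sh f) (sh f) \<le> step_size\<^sup>2 * (?b\<^sup>2 * ip f f)"
      by (intro mult_left_mono) auto
    moreover have "step_size * (lam * ip f f) \<le> step_size * ip f (sh f)"
      using shift_coercive[OF f] t form_sym[OF f shift_closed[OF f]] by simp
    ultimately show ?thesis by linarith
  qed
  also have "\<dots> = (1 - (lam / ?b)\<^sup>2) * ip f f"
    using 1 by (simp add: algebra_simps)
  also have "\<dots> = (rate * nrm f)\<^sup>2"
  proof -
    have "(lam / ?b)\<^sup>2 \<le> 1" using lam bound_pos by (intro power_le_one) auto
    then show ?thesis by (simp add: rate_def power_mult_distrib nrm_sq f)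
  qed
  finally show "(nrm (\<lambda>x. f x - step_size * sh f x))\<^sup>2 \<le> (rate * nrm f)\<^sup>2" .
qed (simp add: nrm_nonneg f rate)

lemma richardson_closed: "g \<in> H \<Longrightarrow> richardson A lam \<tau> g j \<in> H"
  by (induction j) (auto intro!: zero_closed diff_closed scale_closed shift_closed)

lemma shift_surj:
  assumes g: "g \<in> H"
  obtains f where "f \<in> H" "sh f = g"
proof -
  let ?u = "richardson A lam step_size g"
  note u = richardson_closed[OF g, of step_size]
  define C where "C = nrm (\<lambda>x. ?u 1 x - ?u 0 x)"
  have inc: "nrm (\<lambda>x. ?u (Suc k) x - ?u k x) \<le> C * rate ^ k" for k
  proof (induction k)
    case 0
    then show ?case by (simp add: C_def)
  next
    case (Suc k)
    let ?d = "\<lambda>x. ?u (Suc k) x - ?u k x"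
    have d: "?d \<in> H" by (intro diff_closed u)
    have "(\<lambda>x. ?u (Suc (Suc k)) x - ?u (Suc k) x) = (\<lambda>x. ?d x - step_size * sh ?d x)"
      unfolding shift_diff[OF u u] by (subst (1 3) richardson.simps) (auto simp: algebra_simps)
    then have "nrm (\<lambda>x. ?u (Suc (Suc k)) x - ?u (Suc k) x) \<le> rate * nrm ?d"
      using contraction[OF d] by simp
    also have "\<dots> \<le> rate * (C * rate ^ k)" by (intro mult_left_mono Suc rate)
    finally show ?case by (simp add: algebra_simps)
  qed
  obtain f where f: "f \<in> H" and lim: "(\<lambda>k. nrm (\<lambda>x. ?u k x - f x)) \<longlonglongrightarrow> 0"
    using complete_geometric[OF u rate inc] by blast
  let ?r = "\<lambda>x. sh f x - g x"
  have r: "?r \<in> H" by (intro diff_closed shift_closed f g)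
  have t: "0 < step_size" using lam bound_pos by (simp add: step_size_def)
  have bound: "nrm ?r \<le> (c + lam) * nrm (\<lambda>x. ?u k x - f x) + C * rate ^ k / step_size" for k
  proof -
    let ?w = "\<lambda>x. f x - ?u k x" and ?d = "\<lambda>x. ?u (Suc k) x - ?u k x"
    \<comment> \<open>The residual of f is that of the k-th iterate plus A + lam applied to f minus
      the iterate; the residual of an iterate is its increment divided by minus the step
      size.\<close>
    have "nrm ?r = nrm (\<lambda>x. sh ?w x - (1 / step_size) * ?d x)"
      using t by (intro arg_cong[where f = nrm] ext)
        (simp add: shift_diff f u algebra_simps)
    also have "\<dots> \<le> nrm (sh ?w) + nrm (\<lambda>x. (1 / step_size) * ?d x)"
      by (intro nrm_triangle_diff shift_closed scale_closed diff_closed u f)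
    also have "\<dots> \<le> (c + lam) * nrm ?w + 1 / step_size * (C * rate ^ k)"
      using mult_left_mono[OF inc[of k], of "1 / step_size"] nrm_shift_le[OF diff_closed[OF f u]] t
      by (subst nrm_scale[OF diff_closed[OF u u]]) (intro add_mono, auto)
    finally show ?thesis by (simp add: nrm_diff_commute[OF f u])
  qed
  have "(\<lambda>k. (c + lam) * nrm (\<lambda>x. ?u k x - f x) + C * rate ^ k / step_size)
      \<longlonglongrightarrow> (c + lam) * 0 + C * 0 / step_size"
    by (intro tendsto_intros lim LIMSEQ_power_zero) (use rate t in auto)
  then have "nrm ?r \<le> 0"
    using bound by (intro LIMSEQ_le_const) auto
  then have "?r = (\<lambda>x. 0)"
    using nrm_nonneg[OF r] eq_zero_if_nrm_zero[OF r] by simp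
  then have "sh f = g" by (simp add: fun_eq_iff)
  then show ?thesis using f that by blast
qed

lemma shift_inj: "inj_on sh H"
proof (rule inj_onI)
  fix f g assume f: "f \<in> H" and g: "g \<in> H" and eq: "sh f = sh g"
  let ?d = "\<lambda>x. f x - g x"
  have d: "?d \<in> H" using f g by (rule diff_closed)
  have "sh ?d = (\<lambda>x. 0)" using eq by (simp add: shift_diff f g)
  then have "lam * ip ?d ?d \<le> 0"
    using shift_coercive[OF d] by (simp add: form_zero_left d)
  then have "ip ?d ?d = 0"
    using form_nonneg[OF d] lam by (simp add: mult_le_0_iff)
  then have "?d = (\<lambda>x. 0)" using eq_zero_if_form_zero[OF d] by simp
  then show "f = g" by (simp add: fun_eq_iff)
qed

lemma range_shift: "g \<in> H \<Longrightarrow> g \<in> sh ` H"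
  by (rule shift_surj[of g]) auto

lemma res_closed: "g \<in> H \<Longrightarrow> res g \<in> H"
  unfolding resolvent_def by (rule inv_into_into[OF range_shift])

lemma shift_res: "g \<in> H \<Longrightarrow> sh (res g) = g"
  unfolding resolvent_def by (rule f_inv_into_f[OF range_shift])

lemma res_shift: "f \<in> H \<Longrightarrow> res (sh f) = f"
  by (simp add: resolvent_def inv_into_f_f shift_inj)

lemma res_unique: "f \<in> H \<Longrightarrow> sh f = g \<Longrightarrow> res g = f"
  using res_shift by blast

lemma res_add: "f \<in> H \<Longrightarrow> g \<in> H \<Longrightarrow> res (\<lambda>x. f x + g x) = (\<lambda>x. res f x + res g x)"
proof (rule res_unique)
  assume fg: "f \<in> H" "g \<in> H"
  show "sh (\<lambda>x. res f x + res g x) = (\<lambda>x. f x + g x)"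
    using shift_res[OF fg(1)] shift_res[OF fg(2)] fg
    by (simp add: shift_op_def op_add res_closed fun_eq_iff algebra_simps)
qed (simp add: add_closed res_closed)

lemma res_scale: "f \<in> H \<Longrightarrow> res (\<lambda>x. s * f x) = (\<lambda>x. s * res f x)"
proof (rule res_unique)
  assume f: "f \<in> H"
  show "sh (\<lambda>x. s * res f x) = (\<lambda>x. s * f x)"
  proof
    fix x
    have "s * (A (res f) x + lam * res f x) = s * f x"
      using shift_res[OF f] by (simp add: shift_op_def fun_eq_iff)
    then show "sh (\<lambda>x. s * res f x) x = s * f x"
      by (simp add: shift_op_def op_scale res_closed f algebra_simps)
  qed
qed (simp add: scale_closed res_closed)

lemma res_diff: "f \<in> H \<Longrightarrow> g \<in> H \<Longrightarrow> res (\<lambda>x. f x - g x) = (\<lambda>x. res f x - res g x)"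
  using res_add[of f "\<lambda>x. (-1) * g x"] res_scale[of g "-1"] scale_closed[of g "-1"] by simp

lemma op_res: "f \<in> H \<Longrightarrow> A (res f) = (\<lambda>x. f x - lam * res f x)"
  using shift_res[of f] by (auto simp: shift_op_def fun_eq_iff algebra_simps)

lemma op_eq_shift: "A f = (\<lambda>x. sh f x - lam * f x)"
  by (simp add: shift_op_def)

lemma res_sym: "f \<in> H \<Longrightarrow> g \<in> H \<Longrightarrow> ip (res f) g = ip f (res g)"
  using shift_sym[of "res f" "res g"] by (simp add: res_closed shift_res)

lemma form_res: "f \<in> H \<Longrightarrow> ip (res f) f = ip (sh (res f)) (res f)"
  by (simp add: shift_res form_sym res_closed)

lemma res_pos: "f \<in> H \<Longrightarrow> 0 \<le> ip (res f) f"
  using order_trans[OF mult_nonneg_nonneg[OF less_imp_le[OF lam] form_nonneg[OF res_closed]]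
      shift_coercive[OF res_closed]]
  by (simp add: form_res)

lemma nrm_res_le: "f \<in> H \<Longrightarrow> lam * nrm (res f) \<le> nrm f"
proof (cases "nrm (res f) = 0")
  case False
  assume f: "f \<in> H"
  have "lam * nrm (res f) * nrm (res f) = lam * ip (res f) (res f)"
    using nrm_sq[OF res_closed[OF f]] by (simp add: power2_eq_square)
  also have "\<dots> \<le> ip f (res f)"
    using shift_coercive[OF res_closed[OF f]] by (simp add: shift_res f)
  also have "\<dots> \<le> nrm f * nrm (res f)"
    using Cauchy_Schwarz[OF f res_closed[OF f]] by simp
  finally show ?thesis using False nrm_nonneg[OF res_closed[OF f]] by simp
qed (simp add: nrm_nonneg)

lemma form_res_le: "f \<in> H \<Longrightarrow> lam * ip (res f) f \<le> ip f f"
proof -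
  assume f: "f \<in> H"
  have "ip (res f) f \<le> nrm (res f) * nrm f"
    using Cauchy_Schwarz[OF res_closed[OF f] f] by simp
  then have "lam * ip (res f) f \<le> lam * (nrm (res f) * nrm f)"
    using lam by simp
  also have "\<dots> = (lam * nrm (res f)) * nrm f" by simp
  also have "\<dots> \<le> nrm f * nrm f"
    by (intro mult_right_mono nrm_res_le nrm_nonneg f)
  finally show ?thesis using nrm_sq[OF f] by (simp add: power2_eq_square)
qed

sublocale shift: semi_inner H "\<lambda>f g. ip (sh f) g"
proof unfold_locales
  fix f g h and s :: real
  assume f: "f \<in> H"
  show "ip (sh f) f \<ge> 0"
    by (rule order_trans[OF mult_nonneg_nonneg[OF less_imp_le[OF lam] form_nonneg[OF f]]
          shift_coercive[OF f]])
  assume h: "h \<in> H"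
  show "ip (sh (\<lambda>x. s * f x)) h = s * ip (sh f) h"
    by (simp add: form_shift scale_closed f h op_scale form_scale_left op_closed algebra_simps)
  assume g: "g \<in> H"
  show "ip (sh f) g = ip (sh g) f"
    using shift_sym[OF f g] form_sym[OF f shift_closed[OF g]] by simp
  show "ip (sh (\<lambda>x. f x + g x)) h = ip (sh f) h + ip (sh g) h"
    by (simp add: form_shift add_closed f g h op_add form_add_left op_closed algebra_simps)
qed (auto intro: zero_closed add_closed scale_closed)

sublocale dual: semi_inner H "\<lambda>f g. ip (res f) g"
proof unfold_locales
  fix f g h and s :: real
  assume f: "f \<in> H"
  show "ip (res f) f \<ge> 0" by (rule res_pos[OF f])
  assume h: "h \<in> H"
  show "ip (res (\<lambda>x. s * f x)) h = s * ip (res f) h"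
    by (simp add: res_scale f h form_scale_left res_closed)
  assume g: "g \<in> H"
  show "ip (res f) g = ip (res g) f"
    using res_sym[OF f g] form_sym[OF f res_closed[OF g]] by simp
  show "ip (res (\<lambda>x. f x + g x)) h = ip (res f) h + ip (res g) h"
    by (simp add: res_add f g h form_add_left res_closed)
qed (auto intro: zero_closed add_closed scale_closed)

lemma shift_nrm_res: "f \<in> H \<Longrightarrow> shift.nrm (res f) = dual.nrm f"
  unfolding fun_norm_def by (subst form_res) simp_all

text \<open>Cauchy-Schwarz for the form of A + lam, applied to \<open>res f\<close> and
  \<open>g\<close>: the two regularized norms are dual to each other.\<close>

lemma form_le_dual_shift:
  assumes "f \<in> H" "g \<in> H"
  shows "\<bar>ip f g\<bar> \<le> dual.nrm f * shift.nrm g"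
proof -
  have "\<bar>ip (sh (res f)) g\<bar> \<le> shift.nrm (res f) * shift.nrm g"
    by (intro shift.Cauchy_Schwarz res_closed assms)
  then show ?thesis by (simp add: shift_res shift_nrm_res assms)
qed

lemma shift_nrm_ge: "f \<in> H \<Longrightarrow> sqrt lam * nrm f \<le> shift.nrm f"
  using shift_coercive[of f] by (simp add: fun_norm_def flip: real_sqrt_mult)

lemma dual_nrm_le: "f \<in> H \<Longrightarrow> sqrt lam * dual.nrm f \<le> nrm f"
  using form_res_le[of f] by (simp add: fun_norm_def flip: real_sqrt_mult)

text \<open>The detour through the norm of H replaces commuting the resolvent with a square root of
  A + lam: each of the two comparisons contributes one factor sqrt lam.\<close>

lemma res_contraction:
  assumes f: "f \<in> H"
  shows "lam * shift.nrm (res f) \<le> shift.nrm f"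
proof -
  have "lam * shift.nrm (res f) = lam * dual.nrm f" by (simp add: shift_nrm_res f)
  also have "\<dots> = sqrt lam * (sqrt lam * dual.nrm f)"
    using lam by (simp flip: mult.assoc)
  also have "\<dots> \<le> sqrt lam * nrm f"
    by (intro mult_left_mono dual_nrm_le f) (use lam in auto)
  also have "\<dots> \<le> shift.nrm f" by (rule shift_nrm_ge[OF f])
  finally show ?thesis .
qed

text \<open>Since \<open>res g\<close> is a fixed point of the iteration, the error of the iterates
  contracts at every step.\<close>

lemma richardson_tendsto:
  assumes g: "g \<in> H"
  shows "(\<lambda>j. nrm (\<lambda>x. richardson A lam step_size g j x - res g x)) \<longlonglongrightarrow> 0"
proof -
  let ?u = "richardson A lam step_size g"
  note u = richardson_closed[OF g, of step_size]
  let ?C = "nrm (\<lambda>x. ?u 0 x - res g x)"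
  have "nrm (\<lambda>x. ?u k x - res g x) \<le> ?C * rate ^ k" for k
  proof (induction k)
    case (Suc k)
    let ?d = "\<lambda>x. ?u k x - res g x"
    have d: "?d \<in> H" by (intro diff_closed u res_closed g)
    have "(\<lambda>x. ?u (Suc k) x - res g x) = (\<lambda>x. ?d x - step_size * sh ?d x)"
      by (simp add: shift_diff u res_closed g shift_res) (auto simp: algebra_simps)
    then have "nrm (\<lambda>x. ?u (Suc k) x - res g x) \<le> rate * nrm ?d"
      using contraction[OF d] by simp
    also have "\<dots> \<le> rate * (?C * rate ^ k)" by (intro mult_left_mono Suc rate)
    finally show ?case by (simp add: algebra_simps)
  qed simp
  then have le: "\<forall>\<^sub>F k in sequentially. norm (nrm (\<lambda>x. ?u k x - res g x)) \<le> ?C * rate ^ k"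
    by (simp add: nrm_nonneg diff_closed u res_closed g)
  have "(\<lambda>k. ?C * rate ^ k) \<longlonglongrightarrow> ?C * 0"
    by (intro tendsto_mult_left LIMSEQ_power_zero) (use rate in simp)
  then show ?thesis
    by (intro Lim_null_comparison[OF le]) simp
qed

end

section \<open>Compact metric spaces\<close>

lemma compact_finite_net:
  assumes "compact (UNIV :: 'a::metric_space set)" and e: "e > 0"
  obtains F :: "'a::metric_space set" where "finite F" "\<And>x. \<exists>p\<in>F. dist p x < e"
proof -
  have "UNIV \<subseteq> (\<Union>p\<in>UNIV. ball p e)" using e by auto
  then obtain F :: "'a set" where F: "finite F" "UNIV \<subseteq> (\<Union>p\<in>F. ball p e)"
    using compactE_image[OF assms(1), of UNIV "\<lambda>p. ball p e"] by auto
  show ?thesis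
    using F(2) by (intro that[OF F(1)]) (auto simp: subset_iff)
qed

lemma compact_countable_dense:
  assumes "compact (UNIV :: 'a::metric_space set)"
  obtains D :: "'a::metric_space set" where "countable D" "\<And>x e. e > 0 \<Longrightarrow> \<exists>p\<in>D. dist p x < e"
proof -
  have "\<forall>n::nat. \<exists>F :: 'a set. finite F \<and> (\<forall>x. \<exists>p\<in>F. dist p x < 1 / Suc n)"
    by (metis compact_finite_net[OF assms] of_nat_0_less_iff zero_less_Suc zero_less_divide_1_iff)
  then obtain F :: "nat \<Rightarrow> 'a set"
    where F: "\<And>n. finite (F n)" "\<And>n x. \<exists>p\<in>F n. dist p x < 1 / Suc n"
    by metis
  show ?thesis
  proof
    show "countable (\<Union>n. F n)" using F(1) by (auto intro: countable_finite)
    fix x :: 'a and e :: real assume "e > 0"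
    then obtain n where "1 / real (Suc n) < e" using nat_approx_posE by blast
    then show "\<exists>p\<in>\<Union>n. F n. dist p x < e"
      using F(2)[of n x] by (meson UN_I UNIV_I less_trans)
  qed
qed

text \<open>Library results on products of Borel spaces need second countability as a type class; it is
  avoided by approximations that take finitely many values in the first argument.\<close>

lemma Caratheodory_measurable:
  fixes F :: "'a::metric_space \<Rightarrow> 'c \<Rightarrow> real"
  assumes cpt: "compact (UNIV :: 'a set)"
    and meas: "\<And>x. F x \<in> borel_measurable M"
    and cont: "\<And>c. c \<in> space M \<Longrightarrow> continuous_on UNIV (\<lambda>x. F x c)"
  shows "(\<lambda>(x, c). F x c) \<in> borel_measurable (borel \<Otimes>\<^sub>M M)"
proof -
  have net: "\<exists>P :: 'a \<Rightarrow> 'a. finite (range P) \<and> P \<in> borel \<rightarrow>\<^sub>M count_space UNIV \<and>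
      (\<forall>x. dist (P x) x < 1 / Suc n)" for n :: nat
  proof -
    obtain S :: "'a set" where S: "finite S" "\<And>x. \<exists>p\<in>S. dist p x < 1 / Suc n"
      using compact_finite_net[OF cpt, of "1 / Suc n"] by auto
    obtain ps where ps: "set ps = S" using finite_list[OF S(1)] by blast
    \<comment> \<open>Taking the first suitable point of a fixed list makes this approximation of x
      measurable: it is a finite chain of case distinctions over open balls.\<close>
    define P where "P x = the (find (\<lambda>p. dist p x < 1 / Suc n) ps)" for x
    have P: "P x \<in> S \<and> dist (P x) x < 1 / Suc n" for x
    proof -
      obtain p where p: "find (\<lambda>p. dist p x < 1 / Suc n) ps = Some p"
        using S(2)[of x] ps by (cases "find (\<lambda>p. dist p x < 1 / Suc n) ps")
          (auto simp: find_None_iff)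
      then have "P x = p" by (simp add: P_def)
      then show ?thesis using p ps unfolding find_Some_iff by auto
    qed
    have "(\<lambda>x. the (find (\<lambda>p. dist p x < e) qs)) \<in> borel \<rightarrow>\<^sub>M count_space UNIV"
      for qs :: "'a list" and e :: real
    proof (induction qs)
      case (Cons q qs)
      have "open {x. dist q x < e}"
        using open_ball[of q e] by (simp add: ball_def)
      then have "Measurable.pred borel (\<lambda>x. dist q x < e)"
        by (simp add: pred_def borel_open)
      then show ?case using Cons
        by (simp add: if_distrib[of the])
    qed simp
    then have "P \<in> borel \<rightarrow>\<^sub>M count_space UNIV" unfolding P_def[abs_def] .
    moreover have "finite (range P)" by (rule finite_subset[OF _ S(1)]) (use P in auto)
    ultimately show ?thesis using P by blast
  qed
  obtain P :: "nat \<Rightarrow> 'a \<Rightarrow> 'a"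
    where P: "\<And>n. finite (range (P n))" "\<And>n. P n \<in> borel \<rightarrow>\<^sub>M count_space UNIV"
      "\<And>n x. dist (P n x) x < 1 / Suc n"
    using choice[of "\<lambda>n P. finite (range P) \<and> P \<in> borel \<rightarrow>\<^sub>M count_space UNIV \<and>
      (\<forall>x. dist (P x) x < 1 / Suc n)"] net by blast
  have lim: "(\<lambda>n. P n x) \<longlonglongrightarrow> x" for x
  proof (rule metric_LIMSEQ_I)
    fix e :: real assume "e > 0"
    then obtain m where m: "1 / real (Suc m) < e" using nat_approx_posE by blast
    have "dist (P n x) x < e" if "n \<ge> m" for n
    proof -
      have "1 / real (Suc n) \<le> 1 / real (Suc m)" using that by (simp add: frac_le)
      then show ?thesis using P(3)[of n x] m by linarith
    qed
    then show "\<exists>m. \<forall>n\<ge>m. dist (P n x) x < e" by blast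
  qed
  show ?thesis
  proof (rule borel_measurable_LIMSEQ_real[where u = "\<lambda>n (x, c). F (P n x) c"])
    fix z :: "'a \<times> 'c" assume "z \<in> space (borel \<Otimes>\<^sub>M M)"
    then obtain x c where z: "z = (x, c)" "c \<in> space M" by (auto simp: space_pair_measure)
    have "(\<lambda>n. F (P n x) c) \<longlonglongrightarrow> F x c"
      using cont[OF z(2)] lim[of x] by (rule continuous_on_tendsto_compose) auto
    then show "(\<lambda>n. case z of (x, c) \<Rightarrow> F (P n x) c) \<longlonglongrightarrow> (case z of (x, c) \<Rightarrow> F x c)"
      by (simp add: z)
  next
    fix n
    \<comment> \<open>Written as a finite sum over the values of \<open>P n\<close>, the dependence
      on x and on c separates into products of measurable functions.\<close>
    have *: "F (P n x) c = (\<Sum>p\<in>range (P n). (if P n x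
      = p then 1 else 0) * F p c)" for x :: 'a and c :: 'c
      using P(1)[of n] by (simp add: if_distrib[of "\<lambda>u. u * _"] sum.delta cong: if_cong)
    have [measurable]: "P n \<in> borel \<rightarrow>\<^sub>M count_space UNIV" by (rule P(2))
    note meas[measurable]
    show "(\<lambda>(x, c). F (P n x) c) \<in> borel_measurable (borel \<Otimes>\<^sub>M M)"
      unfolding * split_beta' by measurable
  qed
qed

section \<open>Reproducing kernel Hilbert spaces over a compact space\<close>

locale compact_rkhs =
  fixes K :: "'a::metric_space \<Rightarrow> 'a \<Rightarrow> real" and H :: "('a \<Rightarrow> real) set"
    and ip :: "('a \<Rightarrow> real) \<Rightarrow> ('a \<Rightarrow> real) \<Rightarrow> real"
  assumes compact_UNIV: "compact (UNIV :: 'a set)"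
    and mercer: "mercer_kernel K"
    and rkhs: "is_rkhs K H ip"
begin

sublocale hilbert_functions H ip
  using rkhs by unfold_locales (simp add: is_rkhs_def)

lemma section_closed: "K x \<in> H"
  and reproducing: "f \<in> H \<Longrightarrow> ip f (K x) = f x"
  using rkhs by (auto simp: is_rkhs_def)

lemma kernel_sym: "K x t = K t x"
  using mercer by (auto simp: mercer_kernel_def)

lemma kernel_continuous: "continuous_on UNIV (\<lambda>(x, t). K x t)"
  using mercer by (auto simp: mercer_kernel_def)

lemma section_continuous: "continuous_on UNIV (K x)"
  using continuous_on_compose2[OF kernel_continuous
      continuous_on_Pair[OF continuous_on_const[where c = x] continuous_on_id]] by simp

lemma diagonal_continuous: "continuous_on UNIV (\<lambda>x. K x x)"
  using continuous_on_compose2[OF kernel_continuous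
      continuous_on_Pair[OF continuous_on_id continuous_on_id]] by simp

lemma form_section: "ip (K x) (K t) = K x t"
  by (rule reproducing[OF section_closed])

lemma diagonal_nonneg: "0 \<le> K x x"
  using form_nonneg[OF section_closed] by (simp add: form_section)

abbreviation "\<kappa> \<equiv> kappa K"

lemma kappa_ge_1: "1 \<le> \<kappa>"
  by (simp add: kappa_def)

lemma kappa_pos: "0 < \<kappa>"
  using kappa_ge_1 by linarith

lemma diagonal_le: "K x x \<le> \<kappa>\<^sup>2"
proof -
  have "compact (range (\<lambda>x. sqrt (K x x)))"
    by (intro compact_continuous_image compact_UNIV continuous_intros diagonal_continuous)
  then have "bdd_above (range (\<lambda>x. sqrt (K x x)))"
    by (intro bounded_imp_bdd_above compact_imp_bounded)
  then have "sqrt (K x x) \<le> \<kappa>"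
    unfolding kappa_def by (intro max.coboundedI2 cSUP_upper) auto
  then have "(sqrt (K x x))\<^sup>2 \<le> \<kappa>\<^sup>2"
    by (intro power_mono) (auto simp: diagonal_nonneg)
  then show ?thesis by (simp add: diagonal_nonneg)
qed

lemma nrm_section: "nrm (K x) \<le> \<kappa>"
  using diagonal_le[of x] kappa_pos
  by (simp add: fun_norm_def form_section real_le_lsqrt diagonal_nonneg)

lemma eval_le: "f \<in> H \<Longrightarrow> \<bar>f x\<bar> \<le> \<kappa> * nrm f"
proof -
  assume f: "f \<in> H"
  have "\<bar>f x\<bar> \<le> nrm f * nrm (K x)"
    using Cauchy_Schwarz[OF f section_closed, of x] by (simp add: reproducing f)
  also have "\<dots> \<le> nrm f * \<kappa>"
    by (intro mult_left_mono nrm_section nrm_nonneg f)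
  finally show ?thesis by (simp add: mult.commute)
qed

lemma eval_tendsto:
  assumes "\<And>k. F k \<in> H" "f \<in> H" "(\<lambda>k. nrm (\<lambda>x. F k x - f x)) \<longlonglongrightarrow> 0"
  shows "(\<lambda>k. F k x) \<longlonglongrightarrow> f x"
  using form_tendsto[OF assms(1,2) section_closed assms(3), of x] assms(1,2)
  by (simp add: reproducing)

lemma member_continuous:
  assumes f: "f \<in> H"
  shows "continuous_on UNIV f"
  unfolding continuous_on_def
proof
  fix x
  \<comment> \<open>This is the distance of the sections \<open>K y\<close> and \<open>K x\<close>
    in H, expressed through the kernel so that its continuity is evident.\<close>
  define d where "d y = sqrt (K y y - 2 * K x y + K x x)" for y
  have "continuous_on UNIV d"
    unfolding d_def
    by (intro continuous_intros diagonal_continuous section_continuous)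
  then have "(d \<longlongrightarrow> d x) (at x)"
    by (auto simp: continuous_on_def)
  then have "((\<lambda>y. nrm f * d y) \<longlongrightarrow> nrm f * d x) (at x)"
    by (rule tendsto_mult_left)
  then have lim: "((\<lambda>y. nrm f * d y) \<longlongrightarrow> 0) (at x)"
    by (simp add: d_def)
  have "norm (f y - f x) \<le> nrm f * d y" for y
  proof -
    have "norm (f y - f x) = \<bar>ip f (\<lambda>t. K y t - K x t)\<bar>"
      by (simp add: form_diff_right section_closed f reproducing)
    also have "\<dots> \<le> nrm f * nrm (\<lambda>t. K y t - K x t)"
      by (intro Cauchy_Schwarz f diff_closed section_closed)
    also have "nrm (\<lambda>t. K y t - K x t) = d y"
      unfolding fun_norm_def d_def
      by (simp add: form_diff_self section_closed form_section kernel_sym[of y x])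
    finally show ?thesis .
  qed
  then have "((\<lambda>y. f y - f x) \<longlongrightarrow> 0) (at x)"
    by (intro Lim_null_comparison[OF _ lim]) simp
  then show "(f \<longlongrightarrow> f x) (at x within UNIV)"
    by (simp add: LIM_zero_iff)
qed

lemma member_measurable: "f \<in> H \<Longrightarrow> f \<in> borel_measurable borel"
  by (intro borel_measurable_continuous_onI member_continuous)

lemma kernel_measurable: "(\<lambda>(x, t). K x t) \<in> borel_measurable (borel \<Otimes>\<^sub>M borel)"
proof (rule Caratheodory_measurable[OF compact_UNIV])
  show "continuous_on UNIV (\<lambda>x. K x t)" for t
    using section_continuous[of t] by (simp add: kernel_sym[of _ t])
qed (intro borel_measurable_continuous_onI section_continuous)

subsection \<open>Orthonormal bases\<close>

text \<open>Squared lengths 0 are allowed next to 1, so that the padded enumeration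
  \<open>basis\<close> is covered; the last assumption holds where \<open>n i\<close> is 1 and where
  \<open>F i\<close> is the zero function.\<close>

lemma Bessel:
  assumes I: "finite I" and F: "\<And>i. i \<in> I \<Longrightarrow> F i \<in> H" and f: "f \<in> H"
    and orth: "\<And>i j. i \<in> I \<Longrightarrow> j \<in> I \<Longrightarrow> ip (F i) (F j) = (if i = j then n i else 0)"
    and n: "\<And>i. i \<in> I \<Longrightarrow> ip f (F i) * n i = ip f (F i)"
  shows "(\<Sum>i\<in>I. (ip f (F i))\<^sup>2) \<le> ip f f"
proof -
  let ?s = "\<lambda>x. \<Sum>i\<in>I. ip f (F i) * F i x"
  have s: "?s \<in> H" using I F by (rule lincomb_closed)
  have fs: "ip f ?s = (\<Sum>i\<in>I. (ip f (F i))\<^sup>2)"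
    using I F f by (simp add: form_lincomb_right power2_eq_square)
  have "ip ?s ?s = (\<Sum>i\<in>I. \<Sum>j\<in>I. ip f (F i) * ip f (F j) * ip (F i) (F j))"
    using I F by (rule form_lincomb_lincomb)
  also have "\<dots> = (\<Sum>i\<in>I. ip f (F i) * (ip f (F i) * n i))"
    using I by (intro sum.cong refl) (simp add: orth if_distrib[of "\<lambda>u. _
      * u"] sum.delta' cong: if_cong)
  also have "\<dots> = (\<Sum>i\<in>I. (ip f (F i))\<^sup>2)"
    by (intro sum.cong refl) (simp add: n power2_eq_square)
  finally have "ip (\<lambda>x. f x - ?s x) (\<lambda>x. f x - ?s x) = ip f f - (\<Sum>i\<in>I. (ip f (F i))\<^sup>2)"
    using fs by (simp add: form_diff_self f s)
  then show ?thesis using form_nonneg[OF diff_closed[OF f s]] by simp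
qed

text \<open>Needed because \<open>op_trace\<close> picks its basis by \<open>SOME\<close>. A maximal
  orthonormal set is total, since otherwise a normalized vector orthogonal to it could be
  added.\<close>

lemma ex_orthonormal_basis: "\<exists>B. orthonormal_basis H ip B"
proof -
  define ortho where
    "ortho B \<longleftrightarrow> B \<subseteq> H \<and> (\<forall>e\<in>B. \<forall>e'\<in>B. ip e e' = (if e = e' then 1 else 0))" for B
  have "\<exists>M\<in>Collect ortho. \<forall>X\<in>Collect ortho. M \<subseteq> X \<longrightarrow> X = M"
  proof (rule subset_Zorn')
    fix C assume C: "subset.chain (Collect ortho) C"
    have "ip e e' = (if e = e' then 1 else 0)" if "X \<in> C" "Y \<in> C" "e \<in> X" "e' \<in> Y" for e e' X Y
    proof -
      have "X \<subseteq> Y \<or> Y \<subseteq> X" "ortho X" "ortho Y"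
        using C that(1,2) by (auto simp: subset_chain_def)
      then show ?thesis using that(3,4) by (auto simp: ortho_def)
    qed
    moreover have "\<Union>C \<subseteq> H"
      using C unfolding subset_chain_def ortho_def by blast
    ultimately show "\<Union>C \<in> Collect ortho" by (auto simp: ortho_def)
  qed
  then obtain M where M: "ortho M" and max: "\<And>X. ortho X \<Longrightarrow> M \<subseteq> X \<Longrightarrow> X = M" by auto
  have "f = (\<lambda>x. 0)" if f: "f \<in> H" "\<And>e. e \<in> M \<Longrightarrow> ip f e = 0" for f
  proof (rule ccontr)
    assume "f \<noteq> (\<lambda>x. 0)"
    then have pos: "0 < ip f f"
      using eq_zero_if_form_zero[OF f(1)] form_nonneg[OF f(1)] by fastforce
    define g where "g = (\<lambda>x. (1 / sqrt (ip f f)) * f x)"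
    have g: "g \<in> H" unfolding g_def by (rule scale_closed[OF f(1)])
    have gg: "ip g g = 1"
      using pos unfolding g_def
      by (simp only: form_scale_left form_scale_right f(1) scale_closed) simp
    have ge: "ip g e = 0" "ip e g = 0" if "e \<in> M" for e
    proof -
      have e: "e \<in> H" using that M by (auto simp: ortho_def)
      show "ip g e = 0"
        unfolding g_def by (simp only: form_scale_left f(1) e f(2)[OF that] mult_zero_right)
      then show "ip e g = 0" using form_sym[OF e g] by simp
    qed
    then have "g \<notin> M" using gg by force
    moreover have "ortho (insert g M)"
      unfolding ortho_def
    proof (intro conjI ballI)
      show "insert g M \<subseteq> H" using M g by (auto simp: ortho_def)
      fix e e' assume "e \<in> insert g M" "e' \<in> insert g M"
      then show "ip e e' = (if e = e' then 1 else 0)"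
        using M gg ge \<open>g \<notin> M\<close> by (cases "e = g"; cases "e' = g") (auto simp: ortho_def)
    qed
    ultimately show False using max[of "insert g M"] by blast
  qed
  then have "orthonormal_basis H ip M"
    using M by (auto simp: orthonormal_basis_def ortho_def)
  then show ?thesis ..
qed

definition onb :: "('a \<Rightarrow> real) set" where "onb = (SOME B. orthonormal_basis H ip B)"

lemma onb: "orthonormal_basis H ip onb"
  unfolding onb_def by (rule someI_ex[OF ex_orthonormal_basis])

lemma onb_closed: "e \<in> onb \<Longrightarrow> e \<in> H"
  and onb_orth: "e \<in> onb \<Longrightarrow> e' \<in> onb \<Longrightarrow> ip e e' = (if e = e' then 1 else 0)"
  and onb_total: "f \<in> H \<Longrightarrow> (\<And>e. e \<in> onb \<Longrightarrow> ip f e = 0) \<Longrightarrow> f = (\<lambda>x. 0)"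
  using onb unfolding orthonormal_basis_def by blast+

text \<open>Every basis function is non-zero at some point p of a countable dense set, by
  continuity. At a given p only countably many are non-zero, because by Bessel their squared values
  have sum at most \<open>K p p\<close>.\<close>

lemma countable_onb: "countable onb"
proof -
  obtain D :: "'a set" where D: "countable D" "\<And>x e. e > 0 \<Longrightarrow> \<exists>p\<in>D. dist p x < e"
    using compact_countable_dense[OF compact_UNIV] by blast
  have "onb \<subseteq> (\<Union>p\<in>D. {e \<in> onb. (e p)\<^sup>2 \<noteq> 0})"
  proof
    fix e assume e: "e \<in> onb"
    then have H: "e \<in> H" by (rule onb_closed)
    have "e \<noteq> (\<lambda>x. 0)" using onb_orth[OF e e] form_zero_left[OF H] by auto
    then obtain x where x: "e x \<noteq> 0" by auto
    have "continuous_on UNIV e" by (rule member_continuous[OF H])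
    then obtain d where d: "d > 0" "\<And>y. dist y x < d \<Longrightarrow> dist (e y) (e x) < \<bar>e x\<bar>"
      using x unfolding continuous_on_iff by (metis UNIV_I zero_less_abs_iff)
    obtain p where p: "p \<in> D" "dist p x < d" using D(2)[OF d(1)] by blast
    then have "e p \<noteq> 0" using d(2)[of p] by (auto simp: dist_real_def)
    then show "e \<in> (\<Union>p\<in>D. {e \<in> onb. (e p)\<^sup>2 \<noteq> 0})" using e p by auto
  qed
  moreover have "countable {e \<in> onb. (e p)\<^sup>2 \<noteq> 0}" for p
  proof (rule summable_countable_real)
    have "(\<Sum>e\<in>F. (e p)\<^sup>2) \<le> K p p" if "finite F" "F \<subseteq> onb" for F
    proof -
      have "(\<Sum>e\<in>F. (ip (K p) e)\<^sup>2) \<le> ip (K p) (K p)"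
        using that by (intro Bessel[where n
          = "\<lambda>_. 1"]) (auto simp: section_closed onb_closed onb_orth subset_iff)
      moreover have "ip (K p) e = e p" if "e \<in> F" for e
        using that \<open>F \<subseteq> onb\<close> by (metis form_sym onb_closed reproducing section_closed subset_iff)
      ultimately show ?thesis by (simp add: form_section)
    qed
    then show "(\<lambda>e. (e p)\<^sup>2) summable_on onb"
      by (intro nonneg_bdd_above_summable_on bdd_aboveI2) auto
  qed
  ultimately show ?thesis
    using D(1) by (meson countable_UN countable_subset)
qed

text \<open>An enumeration of the basis; indices that are not used are mapped to \<open>0\<close>.\<close>

definition basis :: "nat \<Rightarrow> 'a \<Rightarrow> real" where
  "basis k = (if k \<in> to_nat_on onb ` onb then inv_into onb (to_nat_on onb) k else (\<lambda>x. 0))"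

lemma basis_to_nat_on: "e \<in> onb \<Longrightarrow> basis (to_nat_on onb e) = e"
  by (simp add: basis_def inv_into_f_f[OF inj_on_to_nat_on[OF countable_onb]])

lemma basis_cases: "(\<exists>e\<in>onb. basis k = e \<and> k = to_nat_on onb e) \<or> basis k = (\<lambda>x. 0)"
  using basis_to_nat_on by (auto simp: basis_def)

lemma basis_closed: "basis k \<in> H"
  using basis_cases[of k] onb_closed zero_closed by auto

definition basis_weight :: "nat \<Rightarrow> real" where
  "basis_weight k = ip (basis k) (basis k)"

lemma basis_weight: "basis_weight k = 1 \<or> basis_weight k = 0 \<and> basis k = (\<lambda>x. 0)"
  using basis_cases[of k] onb_orth form_zero_left[OF zero_closed]
  by (auto simp: basis_weight_def)

lemma basis_orth: "ip (basis i) (basis j) = (if i = j then basis_weight i else 0)"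
proof (cases "i = j")
  case False
  show ?thesis
    using basis_cases[of i] basis_cases[of j]
  proof (elim disjE bexE conjE)
    fix e e' assume "e \<in> onb" "basis i = e" "i = to_nat_on onb e"
      "e' \<in> onb" "basis j = e'" "j = to_nat_on onb e'"
    then show ?thesis using False onb_orth[of e e'] by auto
  qed (use False in \<open>auto simp: form_zero_left form_zero_right onb_closed zero_closed\<close>)
qed (simp add: basis_weight_def)

lemma basis_total: "f \<in> H \<Longrightarrow> (\<And>k. ip f (basis k) = 0) \<Longrightarrow> f = (\<lambda>x. 0)"
  using onb_total[of f] basis_to_nat_on by metis

lemma form_basis_weight: "f \<in> H \<Longrightarrow> ip f (basis k) * basis_weight k = ip f (basis k)"
  using basis_weight[of k] form_zero_right[of f] by auto

lemma Bessel_basis: "f \<in> H \<Longrightarrow> (\<Sum>k<m. (ip f (basis k))\<^sup>2) \<le> ip f f"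
  by (intro Bessel[where n = basis_weight]) (auto simp: basis_closed basis_orth form_basis_weight)

lemma form_partial_sum_self:
  assumes "finite I" "\<And>k. k \<in> I \<Longrightarrow> c k * basis_weight k = c k"
  shows "ip (\<lambda>x. \<Sum>k\<in>I. c k * basis k x) (\<lambda>x. \<Sum>k\<in>I. c k * basis k x) = (\<Sum>k\<in>I. (c k)\<^sup>2)"
proof -
  have "ip (\<lambda>x. \<Sum>k\<in>I. c k * basis k x) (\<lambda>x. \<Sum>k\<in>I. c k * basis k x)
      = (\<Sum>i\<in>I. \<Sum>j\<in>I. c i * c j * ip (basis i) (basis j))"
    using assms(1) by (intro form_lincomb_lincomb basis_closed)
  also have "\<dots> = (\<Sum>i\<in>I. c i * (c i * basis_weight i))"
    using assms(1) by (intro sum.cong refl)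
      (simp add: basis_orth if_distrib[of "\<lambda>u. _ * u"] sum.delta' cong: if_cong)
  also have "\<dots> = (\<Sum>i\<in>I. (c i)\<^sup>2)"
    by (intro sum.cong refl) (simp add: assms(2) power2_eq_square)
  finally show ?thesis .
qed

text \<open>Riesz-Fischer. The assumption on the weights forces the coefficients at padding indices
  to be 0.\<close>

lemma basis_series:
  assumes w: "\<And>k. c k * basis_weight k = c k" and bdd: "\<And>m. (\<Sum>k<m. (c k)\<^sup>2) \<le> C"
  obtains f where "f \<in> H" "(\<lambda>m. nrm (\<lambda>x. (\<Sum>k<m. c k * basis k x) - f x)) \<longlonglongrightarrow> 0"
    "\<And>k. ip f (basis k) = c k"
proof -
  let ?s = "\<lambda>m x. \<Sum>k<m. c k * basis k x"
  have s: "?s m \<in> H" for m by (intro lincomb_closed basis_closed) simp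
  have sq: "(nrm (\<lambda>x. ?s m x - ?s l x))\<^sup>2 = (\<Sum>k\<in>{l..<m}. (c k)\<^sup>2)" if "l \<le> m" for l m
  proof -
    have split: "?s m x = ?s l x + (\<Sum>k\<in>{l..<m}. c k * basis k x)" for x
      using sum.union_disjoint[of "{..<l}" "{l..<m}" "\<lambda>k. c k * basis k x"] that
      by (simp add: ivl_disj_un ivl_disj_int)
    have "(\<lambda>x. ?s m x - ?s l x) = (\<lambda>x. \<Sum>k\<in>{l..<m}. c k * basis k x)"
      by (rule ext) (subst split, simp)
    then have "(nrm (\<lambda>x. ?s m x - ?s l x))\<^sup>2
      = ip (\<lambda>x. \<Sum>k\<in>{l..<m}. c k * basis k x) (\<lambda>x. \<Sum>k\<in>{l..<m}. c k * basis k x)"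
      using nrm_sq[of "\<lambda>x. \<Sum>k\<in>{l..<m}. c k * basis k x"]
      by (simp add: lincomb_closed basis_closed)
    then show ?thesis by (simp add: form_partial_sum_self w)
  qed
  have "summable (\<lambda>k. (c k)\<^sup>2)"
    using bdd by (intro bounded_imp_summable[where B = C])
      (simp, metis bdd lessThan_Suc_atMost)
  then have cau: "\<exists>N. \<forall>m\<ge>N. \<forall>n. norm (sum (\<lambda>k. (c k)\<^sup>2) {m..<n}) < e" if "e > 0" for e
    using that by (simp add: summable_Cauchy)
  obtain f where f: "f \<in> H" and lim: "(\<lambda>m. nrm (\<lambda>x. ?s m x - f x)) \<longlonglongrightarrow> 0"
  proof (rule complete[of ?s])
    fix e :: real assume e: "e > 0"
    obtain N where N: "\<And>m n. m \<ge> N \<Longrightarrow> norm (sum (\<lambda>k. (c k)\<^sup>2) {m..<n}) < e\<^sup>2"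
      using cau[of "e\<^sup>2"] e by auto
    have *: "nrm (\<lambda>x. ?s k x - ?s l x) < e" if "N \<le> l" "l \<le> k" for k l
    proof (rule power_less_imp_less_base)
      show "(nrm (\<lambda>x. ?s k x - ?s l x))\<^sup>2 < e\<^sup>2"
        using N[OF that(1), of k] by (simp add: sq[OF that(2)])
    qed (use e in simp)
    have "nrm (\<lambda>x. ?s k x - ?s l x) < e" if "k \<ge> N" "l \<ge> N" for k l
      using *[of l k] *[of k l] nrm_diff_commute[OF s s, of k l] that by (cases "l \<le> k") auto
    then show "\<exists>k0. \<forall>k\<ge>k0. \<forall>l\<ge>k0. nrm (\<lambda>x. ?s k x - ?s l x) < e" by blast
  qed (use s in auto)
  have "ip f (basis k) = c k" for k
  proof (rule LIMSEQ_unique)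
    show "(\<lambda>m. ip (?s m) (basis k)) \<longlonglongrightarrow> ip f (basis k)"
      by (rule form_tendsto[OF s f basis_closed lim])
    have "ip (?s m) (basis k) = c k" if "m \<ge> Suc k" for m
      using that w[of k]
      by (simp add: form_lincomb_left basis_closed basis_orth if_distrib[of "\<lambda>u. _
        * u"] sum.delta cong: if_cong)
    then show "(\<lambda>m. ip (?s m) (basis k)) \<longlonglongrightarrow> c k"
      by (intro tendsto_eventually eventually_sequentiallyI)
  qed
  then show ?thesis using f lim that by blast
qed

lemma expansion_tendsto:
  assumes f: "f \<in> H"
  shows "(\<lambda>m. nrm (\<lambda>x. (\<Sum>k<m. ip f (basis k) * basis k x) - f x)) \<longlonglongrightarrow> 0"
proof -
  obtain g where g: "g \<in> H"
    "(\<lambda>m. nrm (\<lambda>x. (\<Sum>k<m. ip f (basis k) * basis k x) - g x)) \<longlonglongrightarrow> 0"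
    "\<And>k. ip g (basis k) = ip f (basis k)"
    using basis_series[OF form_basis_weight[OF f] Bessel_basis[OF f]] by blast
  have "(\<lambda>x. g x - f x) = (\<lambda>x. 0)"
    by (rule basis_total) (simp_all add: diff_closed g f form_diff_left basis_closed)
  then have "g = f" by (simp add: fun_eq_iff)
  then show ?thesis using g(2) by simp
qed

lemma Parseval:
  assumes f: "f \<in> H" and g: "g \<in> H"
  shows "(\<lambda>m. \<Sum>k<m. ip f (basis k) * ip g (basis k)) \<longlonglongrightarrow> ip f g"
proof -
  have "(\<lambda>m. ip (\<lambda>x. \<Sum>k<m. ip f (basis k) * basis k x) g) \<longlonglongrightarrow> ip f g"
    by (intro form_tendsto expansion_tendsto lincomb_closed basis_closed f g) simp
  then show ?thesis
    by (simp add: form_lincomb_left basis_closed g form_sym[OF basis_closed g])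
qed

text \<open>The representer has the coefficients \<open>\<phi> (basis k)\<close>; testing the
  functional on the partial sums of this very series bounds their squares by C^2. It is used to
  place the image of the integral operator in H.\<close>

lemma Riesz:
  assumes add: "\<And>f g. f \<in> H \<Longrightarrow> g \<in> H \<Longrightarrow> \<phi> (\<lambda>x. f x + g x) = \<phi> f + \<phi> g"
    and scale: "\<And>f s. f \<in> H \<Longrightarrow> \<phi> (\<lambda>x. s * f x) = s * \<phi> f"
    and bound: "\<And>f. f \<in> H \<Longrightarrow> \<bar>\<phi> f\<bar> \<le> C * nrm f"
  obtains w where "w \<in> H" "\<And>g. g \<in> H \<Longrightarrow> ip w g = \<phi> g"
proof -
  have zero: "\<phi> (\<lambda>x. 0) = 0" using scale[OF zero_closed, of 0] by simp
  have lincomb: "\<phi> (\<lambda>x. \<Sum>k<m. c k * basis k x) = (\<Sum>k<m. c k * \<phi> (basis k))" for m c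
    by (induction m) (simp_all add: zero add scale lincomb_closed scale_closed basis_closed)
  have w: "\<phi> (basis k) * basis_weight k = \<phi> (basis k)" for k
    using basis_weight[of k] zero by auto
  have bdd: "(\<Sum>k<m. (\<phi> (basis k))\<^sup>2) \<le> C\<^sup>2" for m
  proof -
    let ?s = "\<lambda>x. \<Sum>k<m. \<phi> (basis k) * basis k x" and ?S = "\<Sum>k<m. (\<phi> (basis k))\<^sup>2"
    have s: "?s \<in> H" by (intro lincomb_closed basis_closed) simp
    have "nrm ?s = sqrt ?S" unfolding fun_norm_def by (simp add: form_partial_sum_self w)
    moreover have "\<phi> ?s = ?S" by (simp add: lincomb power2_eq_square)
    ultimately have le: "?S \<le> C * sqrt ?S" using bound[OF s] by simp
    have S: "0 \<le> ?S" by (intro sum_nonneg) simp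
    show ?thesis
    proof (cases "?S = 0")
      case False
      then have "0 < sqrt ?S" using S by simp
      moreover have "sqrt ?S * sqrt ?S \<le> C * sqrt ?S" using le S by simp
      ultimately have "sqrt ?S \<le> C" by (rule mult_right_le_imp_le[rotated])
      then have "(sqrt ?S)\<^sup>2 \<le> C\<^sup>2" using S by (intro power_mono) auto
      then show ?thesis using S by simp
    qed simp
  qed
  obtain v where v: "v \<in> H" "\<And>k. ip v (basis k) = \<phi> (basis k)"
    using basis_series[OF w bdd] by blast
  have "ip v g = \<phi> g" if g: "g \<in> H" for g
  proof (rule LIMSEQ_unique)
    let ?g = "\<lambda>m x. \<Sum>k<m. ip g (basis k) * basis k x"
    have gm: "?g m \<in> H" for m by (intro lincomb_closed basis_closed) simp
    show "(\<lambda>m. ip (?g m) v) \<longlonglongrightarrow> ip v g"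
      using form_tendsto[OF gm g v(1) expansion_tendsto[OF g]] form_sym[OF v(1) g] by simp
    have "ip (?g m) v = \<phi> (?g m)" for m
      by (simp add: form_lincomb_left basis_closed v lincomb form_sym[OF basis_closed v(1)])
    moreover have "(\<lambda>m. \<phi> (?g m)) \<longlonglongrightarrow> \<phi> g"
    proof -
      define d where "d m = nrm (\<lambda>x. ?g m x - g x)" for m
      have d: "d \<longlonglongrightarrow> 0" unfolding d_def by (rule expansion_tendsto[OF g])
      have "norm (\<phi> (?g m) - \<phi> g) \<le> C * d m" for m
      proof -
        have "\<phi> (\<lambda>x. (?g m x - g x) + g x) = \<phi> (\<lambda>x. ?g m x - g x) + \<phi> g"
          by (intro add diff_closed gm g)
        then show ?thesis using bound[OF diff_closed[OF gm[of m] g]] by (simp add: d_def)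
      qed
      then have "\<forall>\<^sub>F m in sequentially. norm (\<phi> (?g m) - \<phi> g) \<le> C * d m" by simp
      moreover have "(\<lambda>m. C * d m) \<longlonglongrightarrow> 0"
        using tendsto_mult_left[OF d, of C] by simp
      ultimately have "(\<lambda>m. \<phi> (?g m) - \<phi> g) \<longlonglongrightarrow> 0"
        by (rule Lim_null_comparison)
      then show ?thesis by (simp add: LIM_zero_iff)
    qed
    ultimately show "(\<lambda>m. ip (?g m) v) \<longlonglongrightarrow> \<phi> g" by simp
  qed
  then show ?thesis using v(1) that by blast
qed

text \<open>Non-negative terms make the sum independent of the order, so the unordered sum over the
  chosen basis equals the series over its enumeration; the last assumption removes the padding
  indices.\<close>

lemma op_trace_eqI:
  assumes lim: "(\<lambda>m. \<Sum>k<m. ip (A (basis k)) (basis k)) \<longlonglongrightarrow> t"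
    and nonneg: "\<And>f. f \<in> H \<Longrightarrow> 0 \<le> ip (A f) f"
    and zero: "ip (A (\<lambda>x. 0)) (\<lambda>x. 0) = 0"
  shows "op_trace H ip A = t"
proof -
  let ?\<phi> = "\<lambda>e. ip (A e) e"
  have "(\<lambda>k. ?\<phi> (basis k)) sums t" using lim by (simp add: sums_def)
  then have "((\<lambda>k. ?\<phi> (basis k)) has_sum t) UNIV"
    by (intro sums_nonneg_imp_has_sum) (auto simp: nonneg basis_closed)
  then have "((\<lambda>k. ?\<phi> (basis k)) has_sum t) (to_nat_on onb ` onb)"
    by (subst has_sum_cong_neutral[where g = "\<lambda>k. ?\<phi> (basis k)" and T = UNIV])
      (auto simp: basis_def zero)
  then have "(((\<lambda>k. ?\<phi> (basis k)) \<circ> to_nat_on onb) has_sum t) onb"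
    by (simp add: has_sum_reindex inj_on_to_nat_on[OF countable_onb])
  then have "(?\<phi> has_sum t) onb"
    by (rule has_sum_cong[THEN iffD1, rotated]) (simp add: basis_to_nat_on)
  then show ?thesis
    unfolding op_trace_def onb_def[symmetric] by (rule infsumI)
qed

end

section \<open>A Bernstein inequality for sums in a Hilbert space\<close>

lemma cosh_sqrt_sums:
  assumes "0 \<le> (z::real)"
  shows "(\<lambda>n. z ^ n / fact (2 * n)) sums cosh (sqrt z)"
proof -
  let ?f = "\<lambda>n. if even n then sqrt z ^ n /\<^sub>R fact n else 0"
  have "?f sums cosh (sqrt z)" by (rule cosh_converges)
  moreover have "(\<lambda>n. ?f (2 * n)) sums cosh (sqrt z) \<longleftrightarrow> ?f sums cosh (sqrt z)"
    by (rule sums_mono_reindex) (auto simp: strict_mono_def elim!: evenE)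
  moreover have "?f (2 * n) = z ^ n / fact (2 * n)" for n
    using assms by (simp add: power_mult divide_inverse)
  ultimately show ?thesis by simp
qed

lemma convex_on_power_nonneg: "convex_on {0::real..} (\<lambda>x. x ^ n)"
  by (cases "even n") (auto intro: convex_power_odd convex_on_subset[OF convex_power_even])

text \<open>As a power series in z, cosh (sqrt z) has the non-negative coefficients 1 / (2 n)!, so
  it inherits convexity on the half-line from the powers.\<close>

lemma cosh_sqrt_convex:
  assumes "0 \<le> (x::real)" "0 \<le> y" "0 \<le> u" "u \<le> 1"
  shows "cosh (sqrt (u * x + (1 - u) * y)) \<le> u * cosh (sqrt x) + (1 - u) * cosh (sqrt y)"
proof (rule sums_le)
  show "(\<lambda>n. (u * x + (1 - u) * y) ^ n / fact (2 * n)) sums cosh (sqrt (u * x + (1 - u) * y))"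
    by (rule cosh_sqrt_sums) (use assms in simp)
  show "(\<lambda>n. u * (x ^ n / fact (2 * n)) + (1 - u) * (y ^ n / fact (2 * n)))
      sums (u * cosh (sqrt x) + (1 - u) * cosh (sqrt y))"
    by (intro sums_add sums_mult cosh_sqrt_sums assms)
  fix n
  have "(u * x + (1 - u) * y) ^ n \<le> u * x ^ n + (1 - u) * y ^ n"
    using convex_onD[OF convex_on_power_nonneg[of n], of u y x] assms by (simp add: add.commute)
  then have "(u * x + (1 - u) * y) ^ n / fact (2 * n)
    \<le> (u * x ^ n + (1 - u) * y ^ n) / fact (2 * n)"
    by (rule divide_right_mono) simp
  then show "(u * x + (1 - u) * y) ^ n / fact (2 * n)
      \<le> u * (x ^ n / fact (2 * n)) + (1 - u) * (y ^ n / fact (2 * n))"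
    by (simp add: add_divide_distrib)
qed

lemma sinh_ge_self: "0 \<le> x \<Longrightarrow> x \<le> sinh (x::real)"
proof -
  assume x: "0 \<le> x"
  have "sinh 0 - 0 \<le> sinh x - x"
  proof (rule DERIV_nonneg_imp_nondecreasing[OF x])
    fix y :: real
    show "\<exists>d. ((\<lambda>y. sinh y - y) has_real_derivative d) (at y) \<and> 0 \<le> d"
      by (rule exI[of _ "cosh y - 1"]) (auto intro!: derivative_eq_intros simp: cosh_real_ge_1)
  qed
  then show ?thesis by simp
qed

text \<open>With \<open>a = \<bar>x\<bar>\<close>, \<open>b = \<bar>y\<bar>\<close> and \<open>c\<close> the inner product of \<open>x\<close> and \<open>y\<close>, the left-hand side
  is \<open>cosh \<bar>x + y\<bar>\<close>; as a function of \<open>c\<close> it is convex, so that it suffices to compare it with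
  the affine right-hand side at \<open>c = \<plusminus>a b\<close>.\<close>

lemma cosh_add_le:
  fixes a b c :: real
  assumes a: "0 \<le> a" and b: "0 \<le> b" and c: "\<bar>c\<bar> \<le> a * b"
  shows "cosh (sqrt (a\<^sup>2 + 2 * c + b\<^sup>2)) \<le> cosh a * (exp b - b) + c * (sinh a / a)"
proof -
  \<comment> \<open>The cosine of the angle between the two vectors. If a * b = 0, then c = 0 and
    division by zero gives s = 0, so c = a b s holds in every case.\<close>
  define s where "s = c / (a * b)"
  have cs: "c = a * b * s" using c by (auto simp: s_def)
  have s: "\<bar>s\<bar> \<le> 1"
    using c a b by (cases "a * b = 0") (auto simp: s_def abs_mult divide_simps)
  \<comment> \<open>The weight that makes a^2 + 2 c + b^2 a convex combination of (a + b)^2 and (a -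
    b)^2.\<close>
  define u where "u = (1 + s) / 2"
  have u: "0 \<le> u" "u \<le> 1" using s by (auto simp: u_def)
  have "cosh (sqrt (a\<^sup>2 + 2 * c + b\<^sup>2)) = cosh (sqrt (u * (a + b)\<^sup>2 + (1 - u) * (a - b)\<^sup>2))"
    unfolding cs u_def by (intro arg_cong[where f = "\<lambda>x. cosh (sqrt x)"])
      (simp add: power2_eq_square field_simps)
  also have "\<dots> \<le> u * cosh (sqrt ((a + b)\<^sup>2)) + (1 - u) * cosh (sqrt ((a - b)\<^sup>2))"
    by (intro cosh_sqrt_convex u) auto
  also have "\<dots> = u * cosh (a + b) + (1 - u) * cosh (a - b)"
    by (simp add: cosh_real_abs)
  also have "\<dots> = cosh a * cosh b + s * (sinh a * sinh b)"
    by (simp add: u_def cosh_add cosh_diff field_simps)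
  \<comment> \<open>The excess of sinh b over b is moved into the first summand. What remains is c
    times a quantity depending on a only; it is linear in the new vector and will vanish in
    expectation.\<close>
  also have "\<dots> \<le> cosh a * (exp b - b) + s * (sinh a * b)"
  proof -
    have "s * sinh a \<le> 1 * sinh a" using s a by (intro mult_right_mono) auto
    also have "\<dots> \<le> cosh a" using sinh_le_cosh_real[of a] by simp
    finally have "s * sinh a * (sinh b - b) \<le> cosh a * (sinh b - b)"
      using sinh_ge_self[OF b] by (intro mult_right_mono) auto
    moreover have "exp b = cosh b + sinh b" by (simp add: cosh_plus_sinh)
    ultimately show ?thesis by (simp add: algebra_simps)
  qed
  also have "s * (sinh a * b) = c * (sinh a / a)"
    by (cases "a = 0") (simp_all add: cs)
  finally show ?thesis by simp
qed

lemma exp_minus_self_le: "0 \<le> (b::real) \<Longrightarrow> b \<le> 1 \<Longrightarrow> exp b - b \<le> 1 + b\<^sup>2"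
  using exp_bound[of b] by simp

text \<open>D z w plays the inner product of the centred vectors attached to z and w. Their norms
  are bounded by 2 B, because centring at most doubles a bound B, and \<sigma>^2 bounds their second
  moment.\<close>

locale centered_kernel = prob_space P
  for P :: "'z measure" +
  fixes D :: "'z \<Rightarrow> 'z \<Rightarrow> real" and B \<sigma> :: real
  assumes kernel_measurable: "(\<lambda>(z, w). D z w) \<in> borel_measurable (P \<Otimes>\<^sub>M P)"
    and kernel_sym: "D z w = D w z"
    and kernel_psd: "0 \<le> (\<Sum>i<(n::nat). \<Sum>j<n. c i * c j * D (zs i) (zs j))"
    and kernel_integrable: "integrable P (D z)"
    and kernel_centered: "(\<integral>w. D z w \<partial>P) = 0"
    and diagonal_bound: "AE z in P. D z z \<le> (2 * B)\<^sup>2"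
    and diagonal_integrable: "integrable P (\<lambda>z. D z z)"
    and diagonal_integral: "(\<integral>z. D z z \<partial>P) \<le> \<sigma>\<^sup>2"
    and B_pos: "0 < B" and sigma_nonneg: "0 \<le> \<sigma>"
begin

definition gram_sum :: "nat \<Rightarrow> (nat \<Rightarrow> 'z) \<Rightarrow> real" where
  "gram_sum m zs = (\<Sum>i<m. \<Sum>j<m. D (zs i) (zs j))"

lemma gram_sum_nonneg: "0 \<le> gram_sum m zs"
  using kernel_psd[of "\<lambda>_. 1" zs m] by (simp add: gram_sum_def)

lemma diagonal_nonneg: "0 \<le> D z z"
  using kernel_psd[of "\<lambda>_. 1" "\<lambda>_. z" 1] by simp

lemma gram_sum_Suc:
  "gram_sum (Suc m) (zs(m := w)) = gram_sum m zs + 2 * (\<Sum>i<m. D (zs i) w) + D w w"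
proof -
  have "gram_sum (Suc m) (zs(m := w))
      = (\<Sum>i<m. (\<Sum>j<m. D (zs i) (zs j)) + D (zs i) w) + ((\<Sum>j<m. D w (zs j)) + D w w)"
    by (simp add: gram_sum_def)
  moreover have "(\<Sum>j<m. D w (zs j)) = (\<Sum>i<m. D (zs i) w)"
    by (intro sum.cong refl kernel_sym)
  ultimately show ?thesis
    by (simp add: sum.distrib gram_sum_def)
qed

text \<open>Cauchy-Schwarz for the sum so far and the new vector: positive semidefiniteness is used
  with coefficient s at the old points and t at the new one.\<close>

lemma cross_sum_le: "(\<Sum>i<m. D (zs i) w)\<^sup>2 \<le> gram_sum m zs * D w w"
proof (rule discriminant_le)
  let ?C = "\<Sum>i<m. D (zs i) w" and ?N = "gram_sum m zs"
  fix s t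
  show "0 \<le> s\<^sup>2 * ?N + 2 * s * t * ?C + t\<^sup>2 * D w w"
  proof -
    let ?c = "\<lambda>i. if i < m then s else t" and ?z = "zs(m := w)"
    have "0 \<le> (\<Sum>i<Suc m. \<Sum>j<Suc m. ?c i * ?c j * D (?z i) (?z j))" by (rule kernel_psd)
    also have "\<dots> = (\<Sum>i<m. (\<Sum>j<m. s * s * D (zs i) (zs j)) + s * t * D (zs i) w)
        + ((\<Sum>j<m. t * s * D w (zs j)) + t * t * D w w)"
      by simp
    also have "(\<Sum>j<m. t * s * D w (zs j)) = t * s * ?C"
      unfolding sum_distrib_left by (intro sum.cong refl arg_cong2[where f = "(*)"] kernel_sym)
    also have "(\<Sum>i<m. (\<Sum>j<m. s * s * D (zs i) (zs j)) + s * t * D (zs i) w) + (t * s * ?C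
          + t * t * D w w)
        = s\<^sup>2 * ?N + 2 * s * t * ?C + t\<^sup>2 * D w w"
      by (simp add: sum.distrib gram_sum_def power2_eq_square mult.commute flip: sum_distrib_left)
    finally show ?thesis .
  qed
qed

lemma kernel_component_measurable:
  "f \<in> M \<rightarrow>\<^sub>M P \<Longrightarrow> g \<in> M \<rightarrow>\<^sub>M P \<Longrightarrow> (\<lambda>x. D (f x) (g x)) \<in> borel_measurable M"
  using measurable_compose[OF measurable_Pair kernel_measurable] by simp

lemma gram_sum_measurable: "gram_sum m \<in> borel_measurable (Pi\<^sub>M {..<m} (\<lambda>_. P))"
  unfolding gram_sum_def
  by (intro borel_measurable_sum kernel_component_measurable measurable_component_singleton) auto

text \<open>\<open>cosh_add_le\<close> with b = t sqrt (D w w), which is almost surely at most 1 by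
  the restriction on t. The term linear in c integrates to 0 by centring, and exp b - b \<le> 1 +
  b^2 leaves the second moment.\<close>

lemma cosh_moment_step:
  assumes t: "0 \<le> t" "t * (2 * B) \<le> 1"
  shows "(\<integral>\<^sup>+ w. ennreal (cosh (t * sqrt (gram_sum (Suc m) (zs(m := w))))) \<partial>P)
    \<le> ennreal (cosh (t * sqrt (gram_sum m zs))) * ennreal (1 + t\<^sup>2 * \<sigma>\<^sup>2)"
proof -
  define a where "a = t * sqrt (gram_sum m zs)"
  define b where "b w = t * sqrt (D w w)" for w
  define c where "c w = t\<^sup>2 * (\<Sum>i<m. D (zs i) w)" for w
  have a: "0 \<le> a" using t by (simp add: a_def gram_sum_nonneg)
  have b: "0 \<le> b w" for w using t by (simp add: b_def diagonal_nonneg)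
  have c: "\<bar>c w\<bar> \<le> a * b w" for w
  proof -
    have "\<bar>\<Sum>i<m. D (zs i) w\<bar> \<le> sqrt (gram_sum m zs) * sqrt (D w w)"
      using real_sqrt_le_mono[OF cross_sum_le[of zs w m]] by (simp add: real_sqrt_mult)
    then have "t\<^sup>2 * \<bar>\<Sum>i<m. D (zs i) w\<bar> \<le> t\<^sup>2 * (sqrt (gram_sum m zs) * sqrt (D w w))"
      by (rule mult_left_mono) simp
    then show ?thesis by (simp add: a_def b_def c_def abs_mult power2_eq_square mult_ac)
  qed
  have eq: "t * sqrt (gram_sum (Suc m) (zs(m := w))) = sqrt (a\<^sup>2 + 2 * c w + (b w)\<^sup>2)" for w
  proof -
    have "a\<^sup>2 + 2 * c w + (b w)\<^sup>2 = t\<^sup>2 * gram_sum (Suc m) (zs(m := w))"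
      by (simp add: a_def b_def c_def gram_sum_Suc power_mult_distrib gram_sum_nonneg
        diagonal_nonneg
          algebra_simps)
    then show ?thesis using t by (simp add: real_sqrt_mult)
  qed
  let ?g = "\<lambda>w. cosh a * (1 + (b w)\<^sup>2) + c w * (sinh a / a)"
  have b2: "(b w)\<^sup>2 = t\<^sup>2 * D w w" for w
    by (simp add: b_def power_mult_distrib diagonal_nonneg)
  have int: "integrable P ?g"
    unfolding b2 c_def
    by (intro Bochner_Integration.integrable_add integrable_mult_right integrable_mult_left
        Bochner_Integration.integrable_sum diagonal_integrable kernel_integrable integrable_const)
  have AE_le: "AE w in P. cosh (sqrt (a\<^sup>2 + 2 * c w + (b w)\<^sup>2)) \<le> ?g w"
    using diagonal_bound
  proof eventually_elim
    case (elim w)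
    then have "sqrt (D w w) \<le> 2 * B" using B_pos
      by (intro real_le_lsqrt) (auto simp: diagonal_nonneg)
    then have "b w \<le> t * (2 * B)" unfolding b_def using t by (intro mult_left_mono) auto
    then have "b w \<le> 1" using t by simp
    then have "cosh a * (exp (b w) - b w) \<le> cosh a * (1 + (b w)\<^sup>2)"
      using exp_minus_self_le[OF b] by (intro mult_left_mono) auto
    then show ?case using cosh_add_le[OF a b c, of w] by linarith
  qed
  have "(\<integral>\<^sup>+ w. ennreal (cosh (t * sqrt (gram_sum (Suc m) (zs(m := w))))) \<partial>P)
      \<le> (\<integral>\<^sup>+ w. ennreal (?g w) \<partial>P)"
    unfolding eq using AE_le by (intro nn_integral_mono_AE)
      (auto elim!: eventually_mono intro: ennreal_leI)
  also have "\<dots> = ennreal (\<integral>w. ?g w \<partial>P)"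
  proof (rule nn_integral_eq_integral[OF int])
    show "AE w in P. 0 \<le> ?g w"
      using AE_le by eventually_elim (rule order_trans[OF less_imp_le[OF cosh_real_pos]])
  qed
  also have "(\<integral>w. ?g w \<partial>P) = cosh a * (1 + t\<^sup>2 * (\<integral>w. D w w \<partial>P))"
    unfolding b2 c_def
    by (simp add: Bochner_Integration.integral_add Bochner_Integration.integral_sum
        diagonal_integrable kernel_integrable kernel_centered prob_space)
  also have "ennreal \<dots> \<le> ennreal (cosh a * (1 + t\<^sup>2 * \<sigma>\<^sup>2))"
    using diagonal_integral by (intro ennreal_leI mult_left_mono add_left_mono) auto
  also have "\<dots> = ennreal (cosh a) * ennreal (1 + t\<^sup>2 * \<sigma>\<^sup>2)"
    by (intro ennreal_mult) auto
  finally show ?thesis unfolding a_def .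
qed

lemma cosh_moment:
  assumes t: "0 \<le> t" "t * (2 * B) \<le> 1"
  shows "(\<integral>\<^sup>+ zs. ennreal (cosh (t * sqrt (gram_sum m zs))) \<partial>Pi\<^sub>M {..<m} (\<lambda>_. P))
    \<le> ennreal ((1 + t\<^sup>2 * \<sigma>\<^sup>2) ^ m)"
proof (induction m)
  case 0
  interpret E: prob_space "Pi\<^sub>M {} (\<lambda>_. P) :: (nat \<Rightarrow> 'z) measure"
    by (rule prob_space_PiM) unfold_locales
  show ?case by (simp add: gram_sum_def E.emeasure_space_1)
next
  case (Suc m)
  interpret product_sigma_finite "\<lambda>_::nat. P" by unfold_locales
  have meas: "(\<lambda>zs. ennreal (cosh (t
    * sqrt (gram_sum m zs)))) \<in> borel_measurable (Pi\<^sub>M {..<m} (\<lambda>_. P))" for m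
    using gram_sum_measurable[of m] by (intro measurable_compose[OF _ measurable_ennreal]
        borel_measurable_continuous_on[where f = "\<lambda>x. cosh (t * sqrt x)"] continuous_intros)
  have "(\<integral>\<^sup>+ zs. ennreal (cosh (t * sqrt (gram_sum (Suc m) zs))) \<partial>Pi\<^sub>M {..<Suc m} (\<lambda>_. P))
      = (\<integral>\<^sup>+ zs. (\<integral>\<^sup>+ w. ennreal (cosh (t * sqrt (gram_sum (Suc m) (zs(m := w))))) \<partial>P)
        \<partial>Pi\<^sub>M {..<m} (\<lambda>_. P))"
    unfolding lessThan_Suc
    by (rule product_nn_integral_insert) (use meas[of "Suc m"] in \<open>auto simp: lessThan_Suc\<close>)
  also have "\<dots> \<le> (\<integral>\<^sup>+ zs. ennreal (cosh (t * sqrt (gram_sum m zs))) * ennreal (1 + t\<^sup>2 * \<sigma>\<^sup>2)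
      \<partial>Pi\<^sub>M {..<m} (\<lambda>_. P))"
    by (intro nn_integral_mono cosh_moment_step t)
  also have "\<dots> = (\<integral>\<^sup>+ zs. ennreal (cosh (t * sqrt (gram_sum m zs))) \<partial>Pi\<^sub>M {..<m} (\<lambda>_. P))
      * ennreal (1 + t\<^sup>2 * \<sigma>\<^sup>2)"
    by (rule nn_integral_multc[OF meas])
  also have "\<dots> \<le> ennreal ((1 + t\<^sup>2 * \<sigma>\<^sup>2) ^ m) * ennreal (1 + t\<^sup>2 * \<sigma>\<^sup>2)"
    by (intro mult_right_mono Suc) auto
  also have "\<dots> = ennreal ((1 + t\<^sup>2 * \<sigma>\<^sup>2) ^ Suc m)"
    by (subst ennreal_mult[symmetric]) (auto simp: mult.commute)
  finally show ?case .
qed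

text \<open>Markov's inequality for the cosh moment; cosh x \<ge> exp x / 2 is the source of the
  factor 2.\<close>

theorem gram_sum_tail:
  assumes l: "1 \<le> l"
  shows "1 - 2 * exp (- l) \<le> measure (Pi\<^sub>M {..<m} (\<lambda>_. P))
    {zs \<in> space (Pi\<^sub>M {..<m} (\<lambda>_. P)). gram_sum m zs \<le> ((2 * B + 2 * \<sigma> * sqrt m) * l)\<^sup>2}"
proof -
  interpret Pi: prob_space "Pi\<^sub>M {..<m} (\<lambda>_. P)"
    by (rule prob_space_PiM) unfold_locales
  let ?M = "Pi\<^sub>M {..<m} (\<lambda>_. P)" and ?S = "(2 * B + 2 * \<sigma> * sqrt m) * l"
  \<comment> \<open>This t satisfies the restriction of \<open>cosh_moment\<close> and keeps t
    \<sigma> sqrt m at most 1. It does not depend on l; the price is a threshold linear in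
    l.\<close>
  define t where "t = 1 / (2 * B + \<sigma> * sqrt m)"
  have den: "0 < 2 * B + \<sigma> * sqrt m" using B_pos sigma_nonneg by (simp add: add_pos_nonneg)
  have t: "0 < t" "t * (2 * B) \<le> 1"
    using den B_pos sigma_nonneg by (auto simp: t_def divide_simps)
  \<comment> \<open>The share of \<sigma> sqrt m in the denominator of t. The exponent becomes y^2 -
    l (1 + y), which is at most -l since y \<le> 1 \<le> l; the coefficient 2 of \<sigma> in the
    threshold is what leaves the term l y.\<close>
  define y where "y = t * (\<sigma> * sqrt m)"
  have y: "0 \<le> y" "y \<le> 1"
    using den B_pos sigma_nonneg by (auto simp: t_def y_def divide_simps)
  have tB: "t * (2 * B) = 1 - y" using den by (simp add: t_def y_def field_simps)
  have tS: "t * ?S = l * (1 + y)"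
  proof -
    have "t * ?S = l * (t * (2 * B) + 2 * (t * (\<sigma> * sqrt m)))" by (simp add: algebra_simps)
    then show ?thesis unfolding tB y_def[symmetric] by (simp add: add.commute)
  qed
  have S: "0 \<le> ?S" using B_pos sigma_nonneg l by simp
  note meas[measurable] = gram_sum_measurable[of m]
  let ?bad = "{zs \<in> space ?M. ?S\<^sup>2 < gram_sum m zs}"
  have bad: "?bad \<in> sets ?M" by measurable
  have "ennreal (exp (t * ?S) / 2) * emeasure ?M ?bad
      = (\<integral>\<^sup>+ zs. ennreal (exp (t * ?S) / 2) * indicator ?bad zs \<partial>?M)"
    using bad by (simp add: nn_integral_cmult_indicator)
  also have "\<dots> \<le> (\<integral>\<^sup>+ zs. ennreal (cosh (t * sqrt (gram_sum m zs))) \<partial>?M)"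
  proof (intro nn_integral_mono)
    fix zs
    show "ennreal (exp (t * ?S) / 2) * indicator ?bad zs
      \<le> ennreal (cosh (t * sqrt (gram_sum m zs)))"
    proof (cases "zs \<in> ?bad")
      case True
      then have "?S \<le> sqrt (gram_sum m zs)" by (intro real_le_rsqrt) auto
      then have "exp (t * ?S) \<le> exp (t * sqrt (gram_sum m zs))" using t by simp
      then have "exp (t * ?S) / 2 \<le> cosh (t * sqrt (gram_sum m zs))"
        by (simp add: cosh_field_def add_increasing2)
      then show ?thesis using True by (simp add: ennreal_leI)
    qed simp
  qed
  also have "\<dots> \<le> ennreal ((1 + t\<^sup>2 * \<sigma>\<^sup>2) ^ m)"
    using cosh_moment t by simp
  also have "\<dots> \<le> ennreal (exp (y\<^sup>2))"
  proof (rule ennreal_leI)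
    have "(1 + t\<^sup>2 * \<sigma>\<^sup>2) ^ m \<le> exp (t\<^sup>2 * \<sigma>\<^sup>2) ^ m"
      by (intro power_mono exp_ge_add_one_self) auto
    also have "\<dots> = exp (y\<^sup>2)"
      by (simp add: y_def power_mult_distrib flip: exp_of_nat_mult)
    finally show "(1 + t\<^sup>2 * \<sigma>\<^sup>2) ^ m \<le> exp (y\<^sup>2)" .
  qed
  finally have le: "exp (t * ?S) / 2 * measure ?M ?bad \<le> exp (y\<^sup>2)"
    by (simp add: Pi.emeasure_eq_measure ennreal_mult'[symmetric])
  have "x \<le> 2 * (q * inverse e)" if "e / 2 * x \<le> q" "0 < e" for e x q :: real
    using that by (simp add: field_simps)
  from this[OF le exp_gt_zero]
  have "measure ?M ?bad \<le> 2 * (exp (y\<^sup>2) * exp (- (t * ?S)))"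
    unfolding exp_minus .
  also have "\<dots> = 2 * exp (y\<^sup>2 - l * (1 + y))" by (simp add: tS exp_diff exp_minus divide_inverse)
  also have "\<dots> \<le> 2 * exp (- l)"
  proof -
    have "y\<^sup>2 \<le> 1 * y" unfolding power2_eq_square using y by (intro mult_right_mono) auto
    also have "\<dots> \<le> l * y" using l y by (intro mult_right_mono) auto
    finally show ?thesis by (simp add: algebra_simps)
  qed
  finally have "measure ?M ?bad \<le> 2 * exp (- l)" .
  moreover have "{zs \<in> space ?M. gram_sum m zs \<le> ?S\<^sup>2} = space ?M - ?bad" by auto
  ultimately show ?thesis using Pi.prob_compl[OF bad] by simp
qed

end

text \<open>Serves two limits: from truncated to full Hilbert-Schmidt norms, and from positive
  bounds on the response down to M.\<close>

lemma (in prob_space) prob_Inter_decreasing: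
  assumes A: "\<And>k::nat. A k \<in> events" "\<And>k. A (Suc k) \<subseteq> A k" and p: "\<And>k. p \<le> prob (A k)"
  shows "p \<le> prob (\<Inter>k. A k)"
proof (rule LIMSEQ_le_const)
  show "(\<lambda>k. prob (A k)) \<longlonglongrightarrow> prob (\<Inter>k. A k)"
    using A by (intro finite_Lim_measure_decseq decseq_SucI) auto
qed (use p in auto)

section \<open>The integral operator\<close>

locale rkhs_measure = compact_rkhs K H ip + nu: prob_space \<nu>
  for K :: "'a::metric_space \<Rightarrow> 'a \<Rightarrow> real" and H ip and \<nu> :: "'a measure" +
  assumes sets_nu: "sets \<nu> = sets borel"
begin

lemma space_nu: "space \<nu> = UNIV"
  using sets_eq_imp_space_eq[OF sets_nu] by simp

lemma borel_measurable_nu: "borel_measurable \<nu> = borel_measurable borel"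
  by (rule measurable_cong_sets[OF sets_nu refl])

lemma member_measurable_nu: "f \<in> H \<Longrightarrow> f \<in> borel_measurable \<nu>"
  by (simp add: borel_measurable_nu member_measurable)

lemma L2_mult_integrable:
  assumes "f \<in> L2_space \<nu>" "g \<in> L2_space \<nu>"
  shows "integrable \<nu> (\<lambda>x. f x * g x)"
proof (rule Bochner_Integration.integrable_bound)
  show "integrable \<nu> (\<lambda>x. (f x)\<^sup>2 + (g x)\<^sup>2)" using assms by (simp add: L2_space_def)
  show "(\<lambda>x. f x * g x) \<in> borel_measurable \<nu>"
    using assms by (auto simp: L2_space_def intro!: borel_measurable_times)
  have "\<bar>a * b\<bar> \<le> a\<^sup>2 + b\<^sup>2" for a b :: real
  proof -
    have "2 * (\<bar>a\<bar> * \<bar>b\<bar>) \<le> a\<^sup>2 + b\<^sup>2" using sum_squares_bound[of "\<bar>a\<bar>" "\<bar>b\<bar>"] by simp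
    moreover have "0 \<le> \<bar>a\<bar> * \<bar>b\<bar>" by simp
    ultimately show ?thesis unfolding abs_mult by linarith
  qed
  then show "AE x in \<nu>. norm (f x * g x) \<le> norm ((f x)\<^sup>2 + (g x)\<^sup>2)" by simp
qed

sublocale L2: semi_inner "L2_space \<nu>" "L2_inner \<nu>"
proof unfold_locales
  show "(\<lambda>x. 0) \<in> L2_space \<nu>" by (simp add: L2_space_def)
  fix f g h :: "'a \<Rightarrow> real" and c :: real
  assume f: "f \<in> L2_space \<nu>"
  show "(\<lambda>x. c * f x) \<in> L2_space \<nu>"
    using f by (auto simp: L2_space_def power_mult_distrib intro!: borel_measurable_times)
  show "0 \<le> L2_inner \<nu> f f" by (simp add: L2_inner_def)
  show "L2_inner \<nu> (\<lambda>x. c * f x) h = c * L2_inner \<nu> f h" by (simp add: L2_inner_def mult.assoc)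
  assume g: "g \<in> L2_space \<nu>"
  show "(\<lambda>x. f x + g x) \<in> L2_space \<nu>"
    using f g L2_mult_integrable[OF f g]
    by (auto simp: L2_space_def power2_sum mult.assoc intro!: borel_measurable_add)
  show "L2_inner \<nu> f g = L2_inner \<nu> g f" by (simp add: L2_inner_def mult.commute)
  assume h: "h \<in> L2_space \<nu>"
  show "L2_inner \<nu> (\<lambda>x. f x + g x) h = L2_inner \<nu> f h + L2_inner \<nu> g h"
    by (simp add: L2_inner_def distrib_right L2_mult_integrable f g h)
qed

lemma L2_norm_eq: "L2_norm \<nu> = L2.nrm"
  by (simp add: fun_eq_iff L2_norm_def fun_norm_def L2_inner_def power2_eq_square)

lemma member_L2:
  assumes f: "f \<in> H"
  shows "f \<in> L2_space \<nu>"
proof -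
  have "(f x)\<^sup>2 \<le> (\<kappa> * nrm f)\<^sup>2" for x
    using power_mono[OF eval_le[OF f] abs_ge_zero, of x 2] by simp
  then have "integrable \<nu> (\<lambda>x. (f x)\<^sup>2)"
    using member_measurable_nu[OF f]
      by (intro nu.integrable_const_bound[where B = "(\<kappa> * nrm f)\<^sup>2"]) auto
  then show ?thesis using member_measurable_nu[OF f] by (simp add: L2_space_def)
qed

lemma L2_norm_le:
  assumes f: "f \<in> H"
  shows "L2.nrm f \<le> \<kappa> * nrm f"
proof -
  have "f x * f x \<le> (\<kappa> * nrm f)\<^sup>2" for x
    using power_mono[OF eval_le[OF f] abs_ge_zero, of x 2] by (simp add: power2_eq_square)
  then have "(\<integral>x. f x * f x \<partial>\<nu>) \<le> (\<integral>x. (\<kappa> * nrm f)\<^sup>2 \<partial>\<nu>)"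
    using L2_mult_integrable[OF member_L2 member_L2, OF f f] by (intro integral_mono) auto
  then have "L2_inner \<nu> f f \<le> (\<kappa> * nrm f)\<^sup>2"
    by (simp add: L2_inner_def nu.prob_space)
  then show ?thesis
    unfolding fun_norm_def[of "L2_inner \<nu>"] using kappa_pos nrm_nonneg[OF f]
      by (intro real_le_lsqrt) (auto simp: L2.form_nonneg member_L2 f)
qed

definition L :: "('a \<Rightarrow> real) \<Rightarrow> 'a \<Rightarrow> real" where
  "L f x = (\<integral>t. K x t * f t \<partial>\<nu>)"

text \<open>L is the adjoint of the inclusion of H into L2. Riesz supplies an element of H with this
  property, and the reproducing property identifies it pointwise with the integral, so no H-valued
  integral is needed.\<close>

lemma
  assumes f: "f \<in> L2_space \<nu>"
  shows L_closed: "L f \<in> H"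
    and form_L: "g \<in> H \<Longrightarrow> ip (L f) g = L2_inner \<nu> f g"
proof -
  have "\<exists>w\<in>H. \<forall>g\<in>H. ip w g = L2_inner \<nu> f g"
  proof (rule Riesz[of "L2_inner \<nu> f" "L2.nrm f * \<kappa>"])
    fix g h :: "'a \<Rightarrow> real" and s :: real
    assume g: "g \<in> H"
    show "L2_inner \<nu> f (\<lambda>x. s * g x) = s * L2_inner \<nu> f g"
      by (intro L2.form_scale_right f member_L2 g)
    have "\<bar>L2_inner \<nu> f g\<bar> \<le> L2.nrm f * L2.nrm g" by (intro L2.Cauchy_Schwarz f member_L2 g)
    also have "\<dots> \<le> L2.nrm f * (\<kappa> * nrm g)"
      by (intro mult_left_mono L2_norm_le g L2.nrm_nonneg f)
    finally show "\<bar>L2_inner \<nu> f g\<bar> \<le> L2.nrm f * \<kappa> * nrm g" by (simp add: mult.assoc)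
    assume "h \<in> H"
    then show "L2_inner \<nu> f (\<lambda>x. g x + h x) = L2_inner \<nu> f g + L2_inner \<nu> f h"
      by (intro L2.form_add_right f member_L2 g)
  qed auto
  then obtain w where w: "w \<in> H" "\<And>g. g \<in> H \<Longrightarrow> ip w g = L2_inner \<nu> f g" by blast
  have "w = L f"
  proof
    fix x
    have "w x = L2_inner \<nu> f (K x)" using w section_closed by (simp flip: reproducing)
    then show "w x = L f x" by (simp add: L2_inner_def L_def mult.commute)
  qed
  then show "L f \<in> H" "g \<in> H \<Longrightarrow> ip (L f) g = L2_inner \<nu> f g" using w by auto
qed

lemma L_add: "f \<in> L2_space \<nu> \<Longrightarrow> g \<in> L2_space \<nu> \<Longrightarrow> L (\<lambda>x. f x + g x) = (\<lambda>x. L f x + L g x)"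
  using L2_mult_integrable[OF member_L2[OF section_closed]]
  by (simp add: fun_eq_iff L_def distrib_left)

lemma L_scale: "L (\<lambda>x. s * f x) = (\<lambda>x. s * L f x)"
  by (simp add: fun_eq_iff L_def mult.left_commute[of _ s])

lemma L_diff: "f \<in> L2_space \<nu> \<Longrightarrow> g \<in> L2_space \<nu> \<Longrightarrow> L (\<lambda>x. f x - g x) = (\<lambda>x. L f x - L g x)"
  using L2_mult_integrable[OF member_L2[OF section_closed]]
  by (simp add: fun_eq_iff L_def right_diff_distrib)

lemma nrm_L_le:
  assumes f: "f \<in> L2_space \<nu>"
  shows "nrm (L f) \<le> \<kappa> * L2.nrm f"
proof (rule nrm_le_if_form_le)
  note Lf = L_closed[OF f]
  have "ip (L f) (L f) = L2_inner \<nu> f (L f)" by (rule form_L[OF f Lf])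
  also have "\<dots> \<le> L2.nrm f * L2.nrm (L f)"
    using L2.Cauchy_Schwarz[OF f member_L2[OF Lf]] by simp
  also have "\<dots> \<le> L2.nrm f * (\<kappa> * nrm (L f))"
    by (intro mult_left_mono L2_norm_le Lf L2.nrm_nonneg f)
  finally show "ip (L f) (L f) \<le> \<kappa> * L2.nrm f * nrm (L f)" by (simp add: mult_ac)
qed (use kappa_pos in \<open>auto simp: L2.nrm_nonneg L_closed f\<close>)

sublocale T: positive_operator H ip L "\<kappa>\<^sup>2"
proof unfold_locales
  fix f g :: "'a \<Rightarrow> real" and s :: real
  show "L (\<lambda>x. s * f x) = (\<lambda>x. s * L f x)" by (rule L_scale)
  assume f: "f \<in> H"
  note f2 = member_L2[OF f]
  show "L f \<in> H" by (rule L_closed[OF f2])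
  show "0 \<le> ip (L f) f" by (simp add: form_L f2 f L2.form_nonneg)
  have "nrm (L f) \<le> \<kappa> * (\<kappa> * nrm f)"
    by (rule order_trans[OF nrm_L_le[OF f2] mult_left_mono[OF L2_norm_le[OF f]]])
      (use kappa_pos in simp)
  then show "nrm (L f) \<le> \<kappa>\<^sup>2 * nrm f" by (simp add: power2_eq_square mult.assoc)
  assume g: "g \<in> H"
  note g2 = member_L2[OF g]
  show "L (\<lambda>x. f x + g x) = (\<lambda>x. L f x + L g x)" by (rule L_add[OF f2 g2])
  have "ip (L f) g = L2_inner \<nu> g f" by (simp add: form_L f2 g L2.form_sym g2)
  also have "\<dots> = ip f (L g)" by (simp add: form_L f g2 form_sym[OF f L_closed[OF g2]])
  finally show "ip (L f) g = ip f (L g)" .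
qed (use kappa_pos in simp)

end

section \<open>The regularized kernel and the effective dimension\<close>

locale regularized = rkhs_measure K H ip \<nu>
  for K :: "'a::metric_space \<Rightarrow> 'a \<Rightarrow> real" and H ip \<nu> +
  fixes lam :: real
  assumes lam: "0 < lam"
begin

sublocale T: shifted_operator H ip L "\<kappa>\<^sup>2" lam
  by unfold_locales (rule lam)

lemma L2_norm_le_shift: "f \<in> H \<Longrightarrow> L2.nrm f \<le> T.shift.nrm f"
  unfolding fun_norm_def
  by (intro real_sqrt_le_mono)
    (use lam in \<open>simp add: T.form_shift form_L member_L2 form_nonneg\<close>)

text \<open>Dual to \<open>L2_norm_le_shift\<close>, as L is the adjoint of the inclusion. It
  applies to functions outside H, in particular to h - f^*.\<close>

lemma dual_norm_L_le:
  assumes f: "f \<in> L2_space \<nu>"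
  shows "T.dual.nrm (L f) \<le> L2.nrm f"
proof (rule T.dual.nrm_le_if_form_le)
  note Lf = L_closed[OF f]
  note R = T.res_closed[OF Lf]
  have "ip (T.res (L f)) (L f) = L2_inner \<nu> f (T.res (L f))"
    by (simp add: form_sym[OF R Lf] form_L[OF f R])
  also have "\<dots> \<le> L2.nrm f * L2.nrm (T.res (L f))"
    using L2.Cauchy_Schwarz[OF f member_L2[OF R]] by simp
  also have "\<dots> \<le> L2.nrm f * T.dual.nrm (L f)"
    using L2_norm_le_shift[OF R] unfolding T.shift_nrm_res[OF Lf]
    by (intro mult_left_mono L2.nrm_nonneg f)
  finally show "ip (T.res (L f)) (L f) \<le> L2.nrm f * T.dual.nrm (L f)" .
qed (simp_all add: L2.nrm_nonneg L_closed f)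

text \<open>The kernel of the form of (L + lam)^(-1) on sections; its diagonal is the squared dual
  norm of \<open>K x\<close>.\<close>

definition G :: "'a \<Rightarrow> 'a \<Rightarrow> real" where
  "G x t = T.res (K x) t"

lemma form_G: "ip (T.res (K x)) (K t) = G x t"
  by (simp add: G_def reproducing T.res_closed section_closed)

lemma G_sym: "G x t = G t x"
  using T.dual.form_sym[OF section_closed section_closed] by (simp add: form_G)

lemma G_continuous: "continuous_on UNIV (G x)"
  unfolding G_def by (intro member_continuous T.res_closed section_closed)

lemma G_measurable: "(\<lambda>(x, t). G x t) \<in> borel_measurable (borel \<Otimes>\<^sub>M borel)"
proof (rule Caratheodory_measurable[OF compact_UNIV])
  show "continuous_on UNIV (\<lambda>x. G x t)" for t
    using G_continuous[of t] by (subst G_sym)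
qed (intro borel_measurable_continuous_onI G_continuous)

lemma G_diagonal_measurable: "(\<lambda>x. G x x) \<in> borel_measurable borel"
  using measurable_compose[OF measurable_Pair[OF measurable_ident measurable_ident] G_measurable]
    by simp

lemma G_diagonal_nonneg: "0 \<le> G x x"
  using T.res_pos[OF section_closed] by (simp add: form_G)

lemma G_diagonal_le: "G x x \<le> \<kappa>\<^sup>2 / lam"
proof -
  have "lam * G x x \<le> K x x"
    using T.form_res_le[OF section_closed, of x] by (simp add: form_G form_section)
  then have "lam * G x x \<le> \<kappa>\<^sup>2" using diagonal_le[of x] by linarith
  then show ?thesis using lam by (simp add: field_simps)
qed

lemma G_diagonal_integrable: "integrable \<nu> (\<lambda>x. G x x)"
  using G_diagonal_measurable G_diagonal_le G_diagonal_nonneg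
  by (intro nu.integrable_const_bound[where B = "\<kappa>\<^sup>2 / lam"]) (auto simp: borel_measurable_nu)

text \<open>\<open>trace_eq\<close> identifies this with N(lam). In this form it is directly the
  second moment that the concentration inequality asks for.\<close>

definition eff :: real where "eff = (\<integral>x. G x x \<partial>\<nu>)"

lemma eff_nonneg: "0 \<le> eff"
  unfolding eff_def by (intro integral_nonneg_AE) (simp add: G_diagonal_nonneg)

definition B_eff :: "nat \<Rightarrow> real" where
  "B_eff n = 2 * \<kappa> / sqrt (real n) * (\<kappa> / sqrt (real n * lam) + sqrt eff)"

lemma B_eff_nonneg: "0 \<le> B_eff n"
  using kappa_pos lam eff_nonneg by (simp add: B_eff_def)

lemma res_L: "f \<in> H \<Longrightarrow> T.res (L f) = L (T.res f)"
proof (rule T.res_unique)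
  assume f: "f \<in> H"
  show "T.sh (L (T.res f)) = L f"
    unfolding shift_op_def
    by (simp add: T.op_res f T.op_diff T.op_scale T.res_closed T.op_closed scale_closed)
qed (simp add: T.op_closed T.res_closed)

text \<open>By Parseval, G x x is the sum over k of the values at x of \<open>basis k\<close> times
  its resolvent; integrating termwise turns this into the trace.\<close>

lemma trace_eq: "op_trace H ip (\<lambda>f. T.res (L f)) = eff"
proof (rule op_trace_eqI)
  show "0 \<le> ip (T.res (L f)) f" if f: "f \<in> H" for f
    using T.form_res_le[OF f]
    by (simp add: res_L f T.op_res form_diff_left form_scale_left T.res_closed scale_closed)
  have z: "L (\<lambda>x. 0) = (\<lambda>x. 0)" by (simp add: L_def fun_eq_iff)
  show "ip (T.res (L (\<lambda>x. 0))) (\<lambda>x. 0) = 0"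
    unfolding z by (intro form_zero_right T.res_closed zero_closed)
  let ?s = "\<lambda>m x. \<Sum>k<m. basis k x * T.res (basis k) x"
  have eval: "basis k x * T.res (basis k) x
    = ip (K x) (basis k) * ip (T.res (K x)) (basis k)" for k x
  proof -
    have "basis k x = ip (K x) (basis k)"
      by (simp add: form_sym[OF section_closed basis_closed] reproducing basis_closed)
    moreover have "T.res (basis k) x = ip (T.res (K x)) (basis k)"
      using T.dual.form_sym[OF section_closed basis_closed, of x k]
      by (simp add: reproducing T.res_closed basis_closed)
    ultimately show ?thesis by simp
  qed
  \<comment> \<open>The dominating constant comes from Cauchy-Schwarz and Bessel: the partial sums
    are at most the norm of \<open>K x\<close> times the norm of its resolvent.\<close>
  have "(\<lambda>m. \<integral>x. ?s m x \<partial>\<nu>) \<longlonglongrightarrow> (\<integral>x. G x x \<partial>\<nu>)"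
  proof (rule integral_dominated_convergence[where w = "\<lambda>_. \<kappa> * (\<kappa> / lam)"])
    show "(\<lambda>x. G x x) \<in> borel_measurable \<nu>"
      using G_diagonal_measurable by (simp add: borel_measurable_nu)
    show "?s m \<in> borel_measurable \<nu>" for m
      by (intro borel_measurable_sum borel_measurable_times member_measurable_nu basis_closed
        T.res_closed)
    have "?s m x = (\<Sum>k<m. ip (K x) (basis k) * ip (T.res (K x)) (basis k))" for m x
      by (simp add: eval)
    then have "(\<lambda>m. ?s m x) \<longlonglongrightarrow> G x x" for x
      using Parseval[OF section_closed T.res_closed[OF section_closed], of x x] form_G[of x x]
        form_sym[OF section_closed T.res_closed[OF section_closed], of x x] by simp
    then show "AE x in \<nu>. (\<lambda>m. ?s m x) \<longlonglongrightarrow> G x x" by simp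
    have "\<bar>?s m x\<bar> \<le> \<kappa> * (\<kappa> / lam)" for m x
    proof -
      let ?a = "\<lambda>k. ip (K x) (basis k)" and ?b = "\<lambda>k. ip (T.res (K x)) (basis k)"
      have "(\<Sum>k<m. ?a k * ?b k)\<^sup>2 \<le> (\<Sum>k<m. (?a k)\<^sup>2) * (\<Sum>k<m. (?b k)\<^sup>2)"
        by (rule Cauchy_Schwarz_ineq_sum)
      also have "\<dots> \<le> ip (K x) (K x) * ip (T.res (K x)) (T.res (K x))"
        by (intro mult_mono Bessel_basis section_closed T.res_closed sum_nonneg form_nonneg) auto
      also have "\<dots> = (nrm (K x) * nrm (T.res (K x)))\<^sup>2"
        by (simp add: power_mult_distrib nrm_sq section_closed T.res_closed)
      finally have "\<bar>\<Sum>k<m. ?a k * ?b k\<bar> \<le> \<bar>nrm (K x) * nrm (T.res (K x))\<bar>"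
        unfolding abs_le_square_iff .
      also have "\<dots> = nrm (K x) * nrm (T.res (K x))"
        by (simp add: abs_mult nrm_nonneg section_closed T.res_closed)
      also have "\<dots> \<le> \<kappa> * (\<kappa> / lam)"
      proof (intro mult_mono nrm_section)
        have "lam * nrm (T.res (K x)) \<le> \<kappa>"
          using T.nrm_res_le[OF section_closed, of x] nrm_section[of x] by linarith
        then show "nrm (T.res (K x)) \<le> \<kappa> / lam" using lam by (simp add: field_simps)
      qed (use kappa_pos in \<open>auto simp: nrm_nonneg T.res_closed section_closed\<close>)
      finally show ?thesis by (simp add: eval)
    qed
    then show "AE x in \<nu>. norm (?s m x) \<le> \<kappa> * (\<kappa> / lam)" for m by simp
  qed simp
  moreover have "(\<integral>x. ?s m x \<partial>\<nu>) = (\<Sum>k<m. ip (T.res (L (basis k))) (basis k))" for m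
  proof -
    have "(\<integral>x. ?s m x \<partial>\<nu>) = (\<Sum>k<m. L2_inner \<nu> (basis k) (T.res (basis k)))"
      unfolding L2_inner_def
      by (intro Bochner_Integration.integral_sum L2_mult_integrable member_L2 basis_closed
        T.res_closed)
    also have "\<dots> = (\<Sum>k<m. ip (L (basis k)) (T.res (basis k)))"
      by (simp add: form_L member_L2 basis_closed T.res_closed)
    also have "\<dots> = (\<Sum>k<m. ip (T.res (L (basis k))) (basis k))"
      by (simp add: T.res_sym T.op_closed basis_closed)
    finally show ?thesis .
  qed
  ultimately show "(\<lambda>m. \<Sum>k<m. ip (T.res (L (basis k))) (basis k)) \<longlonglongrightarrow> eff"
    by (simp add: eff_def)
qed

end

section \<open>Concentration of random features\<close>

text \<open>The features are \<open>c k z\<close> times the section of the kernel at \<open>X z\<close>.  With \<open>m = 1\<close> and \<open>c\<close> the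
  response one gets the labelled part of the sample; with \<open>c k\<close> the \<open>k\<close>-th basis function one gets
  the truncations of the Hilbert-Schmidt norm of the difference of the empirical and the population
  operator.\<close>

locale random_features = regularized K H ip \<nu> lam + P: prob_space P
  for K :: "'a::metric_space \<Rightarrow> 'a \<Rightarrow> real" and H ip \<nu> lam and P :: "'z measure" +
  fixes X :: "'z \<Rightarrow> 'a" and c :: "nat \<Rightarrow> 'z \<Rightarrow> real" and \<mu> :: "nat \<Rightarrow> 'a \<Rightarrow> real"
    and m :: nat and b :: real
  assumes X_measurable: "X \<in> P \<rightarrow>\<^sub>M borel"
    and X_law: "distr P borel X = \<nu>"
    and c_measurable: "c k \<in> borel_measurable P"
    and c_bound: "AE z in P. (\<Sum>k<m. (c k z)\<^sup>2) \<le> b\<^sup>2"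
    and b_pos: "0 < b"
    and mean_closed: "\<mu> k \<in> H"
    and mean: "k < m \<Longrightarrow> g \<in> H \<Longrightarrow> (\<integral>z. c k z * g (X z) \<partial>P) = ip (\<mu> k) g"
begin

definition feature :: "nat \<Rightarrow> 'z \<Rightarrow> 'a \<Rightarrow> real" where
  "feature k z = (\<lambda>t. c k z * K (X z) t - \<mu> k t)"

definition feature_kernel :: "'z \<Rightarrow> 'z \<Rightarrow> real" where
  "feature_kernel z w = (\<Sum>k<m. ip (T.res (feature k z)) (feature k w))"

definition mean_energy :: "nat \<Rightarrow> real" where
  "mean_energy k = ip (T.res (\<mu> k)) (\<mu> k)"

lemma feature_closed: "feature k z \<in> H"
  unfolding feature_def by (intro diff_closed scale_closed section_closed mean_closed)

lemma abs_c_le: "k < m \<Longrightarrow> AE z in P. \<bar>c k z\<bar> \<le> b"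
  using c_bound
proof eventually_elim
  case (elim z)
  have "(c k z)\<^sup>2 \<le> (\<Sum>k<m. (c k z)\<^sup>2)"
    using elim(1) by (intro member_le_sum) auto
  then have "\<bar>c k z\<bar>\<^sup>2 \<le> b\<^sup>2" using elim by simp
  then show ?case using b_pos by (rule power2_le_imp_le[OF _ less_imp_le])
qed

lemma compose_X_measurable: "f \<in> borel_measurable borel \<Longrightarrow> (\<lambda>z. f (X z)) \<in> borel_measurable P"
  by (rule measurable_compose[OF X_measurable])

lemma c_eval_integrable:
  assumes "k < m" "g \<in> H"
  shows "integrable P (\<lambda>z. c k z * g (X z))"
proof (rule P.integrable_const_bound[where B = "b * (\<kappa> * nrm g)"])
  show "AE z in P. norm (c k z * g (X z)) \<le> b * (\<kappa> * nrm g)"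
    using abs_c_le[OF assms(1)]
  proof eventually_elim
    case (elim z)
    then show ?case
      unfolding real_norm_def abs_mult using eval_le[OF assms(2), of "X z"] b_pos
      by (intro mult_mono) auto
  qed
  show "(\<lambda>z. c k z * g (X z)) \<in> borel_measurable P"
    by (intro borel_measurable_times c_measurable compose_X_measurable member_measurable assms)
qed

lemma form_feature:
  "g \<in> H \<Longrightarrow> ip g (feature k w) = c k w * g (X w) - ip (\<mu> k) g"
  unfolding feature_def
  by (simp add: form_diff_right form_scale_right scale_closed section_closed mean_closed reproducing
      form_sym[OF mean_closed])

text \<open>Reduces the forms of features to scalar functions of the observations, from which
  measurability and integrals can be read off.\<close>

lemma feature_form_eq:
  "ip (T.res (feature k z)) (feature k w)
    = c k z * c k w * G (X z) (X w) - c k z * T.res (\<mu> k) (X z) - c k w * T.res (\<mu> k) (X w)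
      + mean_energy k"
proof -
  have 1: "T.res (feature k z) t = c k z * G (X z) t - T.res (\<mu> k) t" for t
    unfolding feature_def
    by (simp add: T.res_diff T.res_scale scale_closed section_closed mean_closed G_def)
  have "ip (\<mu> k) (T.res (feature k z)) = ip (T.res (\<mu> k)) (feature k z)"
    by (simp add: T.res_sym mean_closed feature_closed)
  also have "\<dots> = c k z * T.res (\<mu> k) (X z) - mean_energy k"
    by (simp add: form_feature T.res_closed mean_closed mean_energy_def form_sym[OF mean_closed])
  finally show ?thesis
    by (simp add: form_feature T.res_closed feature_closed 1 algebra_simps)
qed

lemma square_G_integrable:
  assumes "k < m"
  shows "integrable P (\<lambda>z. (c k z)\<^sup>2 * G (X z) (X z))"
proof (rule P.integrable_const_bound[where B = "b\<^sup>2 * (\<kappa>\<^sup>2 / lam)"])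
  show "AE z in P. norm ((c k z)\<^sup>2 * G (X z) (X z)) \<le> b\<^sup>2 * (\<kappa>\<^sup>2 / lam)"
    using abs_c_le[OF assms]
  proof eventually_elim
    case (elim z)
    have "(c k z)\<^sup>2 \<le> b\<^sup>2" using power_mono[OF elim, of 2] by simp
    then have "(c k z)\<^sup>2 * G (X z) (X z) \<le> b\<^sup>2 * (\<kappa>\<^sup>2 / lam)"
      by (intro mult_mono G_diagonal_le G_diagonal_nonneg) auto
    then show ?case by (simp add: abs_mult G_diagonal_nonneg)
  qed
  show "(\<lambda>z. (c k z)\<^sup>2 * G (X z) (X z)) \<in> borel_measurable P"
    by (intro borel_measurable_times borel_measurable_power c_measurable
        compose_X_measurable[OF G_diagonal_measurable])
qed

lemma feature_form_integral:
  assumes "k < m"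
  shows "integrable P (\<lambda>z. ip (T.res (feature k z)) (feature k z))"
    and "(\<integral>z. ip (T.res (feature k z)) (feature k z) \<partial>P)
      = (\<integral>z. (c k z)\<^sup>2 * G (X z) (X z) \<partial>P) - mean_energy k"
proof -
  have eq: "ip (T.res (feature k z)) (feature k z)
      = (c k z)\<^sup>2 * G (X z) (X z) - 2 * (c k z * T.res (\<mu> k) (X z)) + mean_energy k" for z
    by (simp add: feature_form_eq power2_eq_square)
  note int = square_G_integrable[OF assms] c_eval_integrable[OF assms T.res_closed[OF mean_closed]]
  show "integrable P (\<lambda>z. ip (T.res (feature k z)) (feature k z))"
    unfolding eq using int by simp
  have "(\<integral>z. c k z * T.res (\<mu> k) (X z) \<partial>P) = mean_energy k"
    by (simp add: mean assms T.res_closed mean_closed mean_energy_def form_sym[OF mean_closed])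
  then show "(\<integral>z. ip (T.res (feature k z)) (feature k z) \<partial>P)
      = (\<integral>z. (c k z)\<^sup>2 * G (X z) (X z) \<partial>P) - mean_energy k"
    unfolding eq using int by (simp add: P.prob_space)
qed

lemma mean_energy_nonneg: "0 \<le> mean_energy k"
  unfolding mean_energy_def by (rule T.res_pos[OF mean_closed])

lemma mean_energy_le: "k < m \<Longrightarrow> mean_energy k \<le> (\<integral>z. (c k z)\<^sup>2 * G (X z) (X z) \<partial>P)"
  using feature_form_integral(2)[of k]
    integral_nonneg_AE[of "\<lambda>z. ip (T.res (feature k z)) (feature k z)" P]
  by (simp add: T.res_pos feature_closed)

lemma sum_square_G_le:
  "AE z in P. (\<Sum>k<m. (c k z)\<^sup>2 * G (X z) (X z)) \<le> b\<^sup>2 * G (X z) (X z)"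
  using c_bound
proof eventually_elim
  case (elim z)
  then show ?case
    unfolding sum_distrib_right[symmetric] by (intro mult_right_mono G_diagonal_nonneg)
qed

lemma G_X_integral: "integrable P (\<lambda>z. G (X z) (X z))" "(\<integral>z. G (X z) (X z) \<partial>P) = eff"
proof -
  show "integrable P (\<lambda>z. G (X z) (X z))"
    using integrable_distr[OF X_measurable, of "\<lambda>x. G x x"] G_diagonal_integrable
    by (simp add: X_law)
  show "(\<integral>z. G (X z) (X z) \<partial>P) = eff"
    unfolding eff_def
    using integral_distr[OF X_measurable G_diagonal_measurable] by (simp add: X_law)
qed

lemma sum_square_G_integral_le: "(\<Sum>k<m. \<integral>z. (c k z)\<^sup>2 * G (X z) (X z) \<partial>P) \<le> b\<^sup>2 * eff"
proof -
  have "(\<Sum>k<m. \<integral>z. (c k z)\<^sup>2 * G (X z) (X z) \<partial>P) = (\<integral>z. (\<Sum>k<m. (c k z)\<^sup>2 * G (X z) (X z)) \<partial>P)"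
    by (intro Bochner_Integration.integral_sum[symmetric] square_G_integrable) simp
  also have "\<dots> \<le> (\<integral>z. b\<^sup>2 * G (X z) (X z) \<partial>P)"
    by (intro integral_mono_AE Bochner_Integration.integrable_sum square_G_integrable
        integrable_mult_right G_X_integral sum_square_G_le) simp
  finally show ?thesis by (simp add: G_X_integral)
qed

lemma eff_le: "eff \<le> \<kappa>\<^sup>2 / lam"
proof -
  have "eff \<le> (\<integral>x. \<kappa>\<^sup>2 / lam \<partial>\<nu>)"
    unfolding eff_def by (intro integral_mono G_diagonal_integrable G_diagonal_le) simp
  then show ?thesis by (simp add: nu.prob_space)
qed

text \<open>The first constant bounds the joint dual norm of the features before centring, the
  second is a bound for the root of their second moment; centring only lowers the latter.\<close>

sublocale centered_kernel P feature_kernel "b * \<kappa> / sqrt lam" "b * sqrt eff"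
proof unfold_locales
  have "(\<lambda>p. ip (T.res (feature k (fst p))) (feature k (snd p))) \<in> borel_measurable (P \<Otimes>\<^sub>M P)" for k
  proof -
    note [measurable] = X_measurable c_measurable member_measurable[OF T.res_closed[OF mean_closed]]
    have [measurable]: "(\<lambda>p. G (X (fst p)) (X (snd p))) \<in> borel_measurable (P \<Otimes>\<^sub>M P)"
      using measurable_compose[OF measurable_Pair[OF measurable_compose[OF measurable_fst
        X_measurable]
          measurable_compose[OF measurable_snd X_measurable]] G_measurable] by simp
    show ?thesis unfolding feature_form_eq by measurable
  qed
  then show "(\<lambda>(z, w). feature_kernel z w) \<in> borel_measurable (P \<Otimes>\<^sub>M P)"
    unfolding feature_kernel_def split_beta' by (intro borel_measurable_sum)
  fix z w
  show "feature_kernel z w = feature_kernel w z"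
    unfolding feature_kernel_def by (intro sum.cong refl T.dual.form_sym feature_closed)
  have centered: "integrable P (\<lambda>w. ip (T.res (feature k z)) (feature k w))"
    "(\<integral>w. ip (T.res (feature k z)) (feature k w) \<partial>P) = 0" if "k < m" for k
  proof -
    have R: "T.res (feature k z) \<in> H" by (intro T.res_closed feature_closed)
    show "integrable P (\<lambda>w. ip (T.res (feature k z)) (feature k w))"
      unfolding form_feature[OF R] using c_eval_integrable[OF that R] by simp
    show "(\<integral>w. ip (T.res (feature k z)) (feature k w) \<partial>P) = 0"
      unfolding form_feature[OF R] using c_eval_integrable[OF that R]
      by (simp add: mean that R P.prob_space)
  qed
  show "integrable P (feature_kernel z)"
    unfolding feature_kernel_def[abs_def]
      by (intro Bochner_Integration.integrable_sum centered) simp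
  show "(\<integral>w. feature_kernel z w \<partial>P) = 0"
    unfolding feature_kernel_def
    by (subst Bochner_Integration.integral_sum) (auto intro: centered sum.neutral)
  show "integrable P (\<lambda>z. feature_kernel z z)"
    unfolding feature_kernel_def
    by (intro Bochner_Integration.integrable_sum feature_form_integral) simp
  have "(\<integral>z. feature_kernel z z \<partial>P)
      = (\<Sum>k<m. (\<integral>z. (c k z)\<^sup>2 * G (X z) (X z) \<partial>P) - mean_energy k)"
    unfolding feature_kernel_def
    by (subst Bochner_Integration.integral_sum) (auto intro!: feature_form_integral sum.cong)
  also have "\<dots> \<le> (\<Sum>k<m. \<integral>z. (c k z)\<^sup>2 * G (X z) (X z) \<partial>P)"
    by (intro sum_mono) (simp add: mean_energy_nonneg)
  also have "\<dots> \<le> b\<^sup>2 * eff" by (rule sum_square_G_integral_le)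
  finally show "(\<integral>z. feature_kernel z z \<partial>P) \<le> (b * sqrt eff)\<^sup>2"
    by (simp add: power_mult_distrib eff_nonneg)
  have bl: "(2 * (b * \<kappa> / sqrt lam))\<^sup>2 = 4 * (b\<^sup>2 * (\<kappa>\<^sup>2 / lam))"
    using lam by (simp add: power_mult_distrib power_divide)
  show "AE z in P. feature_kernel z z \<le> (2 * (b * \<kappa> / sqrt lam))\<^sup>2"
    using sum_square_G_le
  proof eventually_elim
    case (elim z)
    \<comment> \<open>Subtracting the mean costs a factor 2 in the square, and the mean obeys the
      same bound as the features; together this is the 4 in \<open>bl\<close>.\<close>
    have "ip (T.res (feature k z)) (feature k z)
        \<le> 2 * ((c k z)\<^sup>2 * G (X z) (X z)) + 2 * mean_energy k" for k
    proof -
      let ?f = "\<lambda>t. c k z * K (X z) t"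
      have "ip (T.res (feature k z)) (feature k z)
          \<le> 2 * ip (T.res ?f) ?f + 2 * ip (T.res (\<mu> k)) (\<mu> k)"
        unfolding feature_def
        by (intro T.dual.form_diff_self_le scale_closed section_closed mean_closed)
      also have "ip (T.res ?f) ?f = (c k z)\<^sup>2 * G (X z) (X z)"
        by (simp add: T.dual.form_scale_left T.dual.form_scale_right section_closed scale_closed
          form_G
            power2_eq_square)
      finally show ?thesis by (simp add: mean_energy_def)
    qed
    then have "feature_kernel z z \<le> (\<Sum>k<m. 2 * ((c k z)\<^sup>2 * G (X z) (X z)) + 2 * mean_energy k)"
      unfolding feature_kernel_def by (intro sum_mono)
    also have "\<dots> = 2 * (\<Sum>k<m. (c k z)\<^sup>2 * G (X z) (X z)) + 2 * (\<Sum>k<m. mean_energy k)"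
      by (simp add: sum.distrib sum_distrib_left)
    also have "\<dots> \<le> 2 * (b\<^sup>2 * (\<kappa>\<^sup>2 / lam)) + 2 * (b\<^sup>2 * (\<kappa>\<^sup>2 / lam))"
    proof (intro add_mono mult_left_mono)
      show "(\<Sum>k<m. (c k z)\<^sup>2 * G (X z) (X z)) \<le> b\<^sup>2 * (\<kappa>\<^sup>2 / lam)"
        by (rule order_trans[OF elim mult_left_mono[OF G_diagonal_le]]) simp
      have "(\<Sum>k<m. mean_energy k) \<le> (\<Sum>k<m. \<integral>z. (c k z)\<^sup>2 * G (X z) (X z) \<partial>P)"
        by (intro sum_mono mean_energy_le) simp
      also have "\<dots> \<le> b\<^sup>2 * eff" by (rule sum_square_G_integral_le)
      also have "\<dots> \<le> b\<^sup>2 * (\<kappa>\<^sup>2 / lam)" by (intro mult_left_mono eff_le) simp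
      finally show "(\<Sum>k<m. mean_energy k) \<le> b\<^sup>2 * (\<kappa>\<^sup>2 / lam)" .
    qed auto
    finally show ?case unfolding bl by simp
  qed
  show "0 < b * \<kappa> / sqrt lam" using b_pos kappa_pos lam by simp
  show "0 \<le> b * sqrt eff" using b_pos eff_nonneg by simp
next
  fix n and s :: "nat \<Rightarrow> real" and zs :: "nat \<Rightarrow> 'z"
  have "(\<Sum>i<n. \<Sum>j<n. s i * s j * feature_kernel (zs i) (zs j))
      = (\<Sum>k<m. \<Sum>i<n. \<Sum>j<n. s i * s j * ip (T.res (feature k (zs i))) (feature k (zs j)))"
    unfolding feature_kernel_def sum_distrib_left
    by (subst (2) sum.swap, subst sum.swap) (rule refl)
  also have "\<dots> = (\<Sum>k<m. ip (T.res (\<lambda>t. \<Sum>i<n. s i * feature k (zs i) t)) (\<lambda>t. \<Sum>i<n. s i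
    * feature k (zs i) t))"
    by (subst T.dual.form_lincomb_lincomb) (auto simp: feature_closed)
  also have "0 \<le> \<dots>"
    by (intro sum_nonneg T.res_pos lincomb_closed feature_closed) simp
  finally show "0 \<le> (\<Sum>i<n. \<Sum>j<n. s i * s j * feature_kernel (zs i) (zs j))" .
qed

definition deviation :: "nat \<Rightarrow> nat \<Rightarrow> (nat \<Rightarrow> 'z) \<Rightarrow> 'a \<Rightarrow> real" where
  "deviation n k zs = (\<lambda>t. 1 / real n * (\<Sum>i<n. c k (zs i) * K (X (zs i)) t) - \<mu> k t)"

lemma gram_sum_eq:
  assumes n: "0 < n"
  shows "gram_sum n zs = (real n)\<^sup>2 * (\<Sum>k<m. ip (T.res (deviation n k zs)) (deviation n k zs))"
proof -
  let ?s = "\<lambda>k t. \<Sum>i<n. 1 * feature k (zs i) t"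
  have s: "?s k = (\<lambda>t. real n * deviation n k zs t)" for k
    using n by (auto simp: fun_eq_iff feature_def deviation_def sum_subtractf algebra_simps)
  have dev: "deviation n k zs \<in> H" for k
    unfolding deviation_def
    by (intro diff_closed scale_closed[of _ "1 / real n"] lincomb_closed section_closed
      mean_closed) simp
  have "gram_sum n zs = (\<Sum>k<m. \<Sum>i<n. \<Sum>j<n. 1 * 1
    * ip (T.res (feature k (zs i))) (feature k (zs j)))"
    unfolding gram_sum_def feature_kernel_def
    by (subst (2) sum.swap, subst sum.swap) simp
  also have "\<dots> = (\<Sum>k<m. ip (T.res (?s k)) (?s k))"
    by (intro sum.cong refl T.dual.form_lincomb_lincomb[symmetric] feature_closed) simp
  also have "\<dots> = (\<Sum>k<m. (real n)\<^sup>2 * ip (T.res (deviation n k zs)) (deviation n k zs))"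
    unfolding s
    by (simp add: T.dual.form_scale_left T.dual.form_scale_right dev scale_closed power2_eq_square
        mult.assoc)
  finally show ?thesis by (simp add: sum_distrib_left)
qed

theorem concentration:
  fixes n l
  assumes n: "0 < n" and l: "1 \<le> l"
  defines "E \<equiv> {zs \<in> space (Pi\<^sub>M {..<n} (\<lambda>_. P)).
    (\<Sum>k<m. ip (T.res (deviation n k zs)) (deviation n k zs)) \<le> (b / \<kappa> * B_eff n * l)\<^sup>2}"
  shows "E \<in> sets (Pi\<^sub>M {..<n} (\<lambda>_. P))" "1 - 2 * exp (- l) \<le> measure (Pi\<^sub>M {..<n} (\<lambda>_. P)) E"
proof -
  \<comment> \<open>The shape of \<open>B_eff\<close> is the threshold of the tail bound divided by
    n, normalized so that b = \<kappa> gives exactly \<open>B_eff n\<close>.\<close>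
  have "2 * (b * \<kappa> / sqrt lam) + 2 * (b * sqrt eff) * sqrt (real n) = real n * (b / \<kappa> * B_eff n)"
  proof -
    have "real n = sqrt (real n) * sqrt (real n)" by simp
    then show ?thesis
      using n kappa_pos lam unfolding B_eff_def
      by (simp add: real_sqrt_mult field_simps)
  qed
  then have "((2 * (b * \<kappa> / sqrt lam) + 2 * (b * sqrt eff) * sqrt (real n)) * l)\<^sup>2
      = (real n)\<^sup>2 * (b / \<kappa> * B_eff n * l)\<^sup>2"
    by (simp only: power_mult_distrib mult.assoc)
  then have E: "E = {zs \<in> space (Pi\<^sub>M {..<n} (\<lambda>_. P)).
      gram_sum n zs \<le> ((2 * (b * \<kappa> / sqrt lam) + 2 * (b * sqrt eff) * sqrt (real n)) * l)\<^sup>2}"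
    using n by (simp add: E_def gram_sum_eq)
  note [measurable] = gram_sum_measurable[of n]
  show "E \<in> sets (Pi\<^sub>M {..<n} (\<lambda>_. P))" unfolding E by measurable
  show "1 - 2 * exp (- l) \<le> measure (Pi\<^sub>M {..<n} (\<lambda>_. P)) E"
    unfolding E by (rule gram_sum_tail[OF l])
qed

end

section \<open>Empirical operators\<close>

context compact_rkhs
begin

lemma emp_op_eq: "emp_op K N xs f = (\<lambda>x. 1 / real N * (\<Sum>i<N. f (xs i) * K (xs i) x))"
  by (simp add: emp_op_def sampling_adj_def sampling_op_def fun_eq_iff)

lemma emp_op_closed: "emp_op K N xs f \<in> H"
  unfolding emp_op_eq
  by (intro scale_closed[of _ "1 / real N"] lincomb_closed section_closed) simp

lemma form_emp_op:
  assumes "g \<in> H"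
  shows "ip (emp_op K N xs f) g = 1 / real N * (\<Sum>i<N. f (xs i) * g (xs i))"
proof -
  have "ip (emp_op K N xs f) g = 1 / real N * ip (\<lambda>x. \<Sum>i<N. f (xs i) * K (xs i) x) g"
    unfolding emp_op_eq
    by (intro form_scale_left lincomb_closed section_closed assms) simp
  also have "ip (\<lambda>x. \<Sum>i<N. f (xs i) * K (xs i) x) g = (\<Sum>i<N. f (xs i) * ip (K (xs i)) g)"
    by (intro form_lincomb_left section_closed assms) simp
  finally show ?thesis
    by (simp add: form_sym[OF section_closed assms] reproducing assms)
qed

lemma emp_op_positive:
  assumes N: "0 < N"
  shows "positive_operator H ip (emp_op K N xs) (\<kappa>\<^sup>2)"
proof unfold_locales
  let ?A = "emp_op K N xs"
  fix f g :: "'a \<Rightarrow> real" and s :: real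
  show "?A f \<in> H" by (rule emp_op_closed)
  show "?A (\<lambda>x. f x + g x) = (\<lambda>x. ?A f x + ?A g x)"
    by (simp add: emp_op_eq distrib_right sum.distrib fun_eq_iff add_divide_distrib)
  show "?A (\<lambda>x. s * f x) = (\<lambda>x. s * ?A f x)"
    by (simp add: emp_op_eq fun_eq_iff mult.assoc flip: sum_distrib_left)
  assume f: "f \<in> H"
  show "0 \<le> ip (?A f) f"
    by (simp add: form_emp_op f sum_nonneg)
  show "nrm (?A f) \<le> \<kappa>\<^sup>2 * nrm f"
  proof (rule nrm_le_if_form_le)
    have "ip (?A f) (?A f) = 1 / real N * (\<Sum>i<N. f (xs i) * ?A f (xs i))"
      by (rule form_emp_op[OF emp_op_closed])
    also have "\<dots> \<le> 1 / real N * (\<Sum>i<N. (\<kappa> * nrm f) * (\<kappa> * nrm (?A f)))"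
    proof (intro mult_left_mono sum_mono)
      fix i
      have "f (xs i) * ?A f (xs i) \<le> \<bar>f (xs i)\<bar> * \<bar>?A f (xs i)\<bar>"
        by (metis abs_ge_self abs_mult)
      also have "\<dots> \<le> (\<kappa> * nrm f) * (\<kappa> * nrm (?A f))"
        using kappa_pos by (intro mult_mono eval_le f emp_op_closed) (auto simp: nrm_nonneg f)
      finally show "f (xs i) * ?A f (xs i) \<le> (\<kappa> * nrm f) * (\<kappa> * nrm (?A f))" .
    qed simp
    also have "\<dots> = \<kappa>\<^sup>2 * nrm f * nrm (?A f)" using N by (simp add: power2_eq_square)
    finally show "ip (?A f) (?A f) \<le> \<kappa>\<^sup>2 * nrm f * nrm (?A f)" .
  qed (simp_all add: emp_op_closed nrm_nonneg f)
  assume g: "g \<in> H"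
  show "ip (?A f) g = ip f (?A g)"
    by (simp add: form_sym[OF f emp_op_closed] form_emp_op f g mult.commute)
qed (use kappa_pos in simp)

end

section \<open>The error of the estimator on a fixed sample\<close>

context regularized
begin

text \<open>The Hilbert-Schmidt norm dominates the operator norm, and bounds on its partial sums
  suffice. The constant \<open>c0\<close> supplies the continuity needed to pass from finite
  expansions to f.\<close>

lemma dual_bound_from_basis:
  assumes closed: "\<And>f. f \<in> H \<Longrightarrow> C f \<in> H"
    and add: "\<And>f g. f \<in> H \<Longrightarrow> g \<in> H \<Longrightarrow> C (\<lambda>x. f x + g x) = (\<lambda>x. C f x + C g x)"
    and scale: "\<And>f s. f \<in> H \<Longrightarrow> C (\<lambda>x. s * f x) = (\<lambda>x. s * C f x)"
    and bound: "\<And>f. f \<in> H \<Longrightarrow> T.dual.nrm (C f) \<le> c0 * nrm f"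
    and d: "0 \<le> d" "\<And>m. (\<Sum>k<m. ip (T.res (C (basis k))) (C (basis k))) \<le> d\<^sup>2"
    and f: "f \<in> H"
  shows "T.dual.nrm (C f) \<le> d * nrm f"
proof -
  define s where "s m = (\<lambda>x. \<Sum>k<m. ip f (basis k) * basis k x)" for m
  have s: "s m \<in> H" for m unfolding s_def by (intro lincomb_closed basis_closed) simp
  have zero: "C (\<lambda>x. 0) = (\<lambda>x. 0)" using scale[OF zero_closed, of 0] by simp
  have Cs: "C (s m) = (\<lambda>x. \<Sum>k<m. ip f (basis k) * C (basis k) x)" for m
    unfolding s_def
    by (induction m) (simp_all add: zero add scale lincomb_closed scale_closed basis_closed)
  have le: "T.dual.nrm (C (s m)) \<le> d * nrm f" for m
  proof -
    let ?a = "\<lambda>k. \<bar>ip f (basis k)\<bar>" and ?b = "\<lambda>k. T.dual.nrm (C (basis k))"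
    have "(\<Sum>k<m. ?a k * ?b k)\<^sup>2 \<le> (\<Sum>k<m. (?a k)\<^sup>2) * (\<Sum>k<m. (?b k)\<^sup>2)"
      by (rule Cauchy_Schwarz_ineq_sum)
    also have "\<dots> \<le> ip f f * d\<^sup>2"
      using Bessel_basis[OF f] d(2) form_nonneg[OF f]
      by (intro mult_mono sum_nonneg) (simp_all add: T.dual.nrm_sq T.res_pos closed basis_closed)
    also have "\<dots> = (d * nrm f)\<^sup>2" by (simp add: power_mult_distrib nrm_sq f mult.commute)
    finally have "(\<Sum>k<m. ?a k * ?b k) \<le> d * nrm f"
      by (rule power2_le_imp_le) (simp add: d nrm_nonneg f)
    moreover have "T.dual.nrm (C (s m)) \<le> (\<Sum>k<m. ?a k * ?b k)"
      unfolding Cs by (intro T.dual.nrm_lincomb_le closed basis_closed) simp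
    ultimately show ?thesis by linarith
  qed
  have "T.dual.nrm (C f) \<le> c0 * nrm (\<lambda>x. s m x - f x) + d * nrm f" for m
  proof -
    let ?r = "\<lambda>x. f x - s m x"
    have r: "?r \<in> H" by (intro diff_closed f s)
    have "C (\<lambda>x. ?r x + s m x) = (\<lambda>x. C ?r x + C (s m) x)" by (rule add[OF r s])
    then have "T.dual.nrm (C f) \<le> T.dual.nrm (C ?r) + T.dual.nrm (C (s m))"
      using T.dual.nrm_triangle[OF closed[OF r] closed[OF s]] by simp
    then show ?thesis
      using bound[OF r] le[of m] nrm_diff_commute[OF f s, of m] by simp
  qed
  moreover have "(\<lambda>m. c0 * nrm (\<lambda>x. s m x - f x) + d * nrm f) \<longlonglongrightarrow> c0 * 0 + d * nrm f"
    using expansion_tendsto[OF f] unfolding s_def by (intro tendsto_intros)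
  ultimately show ?thesis by (intro LIMSEQ_le_const) auto
qed

definition basis_deviation :: "nat \<Rightarrow> (nat \<Rightarrow> 'a) \<Rightarrow> nat \<Rightarrow> 'a \<Rightarrow> real" where
  "basis_deviation N xs k = (\<lambda>x. emp_op K N xs (basis k) x - L (basis k) x)"

lemma emp_dual_bound:
  assumes N: "0 < N" and d: "0 \<le> d"
    "\<And>m. (\<Sum>k<m. ip (T.res (basis_deviation N xs k)) (basis_deviation N xs k)) \<le> d\<^sup>2"
    and f: "f \<in> H"
  shows "T.dual.nrm (\<lambda>x. emp_op K N xs f x - L f x) \<le> d * nrm f"
proof -
  interpret A: positive_operator H ip "emp_op K N xs" "\<kappa>\<^sup>2" by (rule emp_op_positive[OF N])
  let ?C = "\<lambda>f x. emp_op K N xs f x - L f x"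
  have closed: "?C f \<in> H" if "f \<in> H" for f by (intro diff_closed A.op_closed T.op_closed that)
  \<comment> \<open>The constant 2 \<kappa>^2 / sqrt lam merely adds the norms of the two
    operators.\<close>
  show ?thesis
  proof (rule dual_bound_from_basis[of ?C "2 * \<kappa>\<^sup>2 / sqrt lam", OF closed _ _ _ d(1)
        d(2)[unfolded basis_deviation_def] f])
    fix f g :: "'a \<Rightarrow> real" and s :: real
    assume f: "f \<in> H"
    show "?C (\<lambda>x. s * f x) = (\<lambda>x. s * ?C f x)"
      by (simp add: A.op_scale T.op_scale f right_diff_distrib)
    have "sqrt lam * T.dual.nrm (?C f) \<le> nrm (?C f)" by (rule T.dual_nrm_le[OF closed[OF f]])
    also have "\<dots> \<le> nrm (emp_op K N xs f) + nrm (L f)"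
      by (intro nrm_triangle_diff A.op_closed T.op_closed f)
    also have "\<dots> \<le> 2 * \<kappa>\<^sup>2 * nrm f" using A.op_bound[OF f] T.op_bound[OF f] by simp
    finally show "T.dual.nrm (?C f) \<le> 2 * \<kappa>\<^sup>2 / sqrt lam * nrm f"
      using lam by (simp add: field_simps)
    assume g: "g \<in> H"
    show "?C (\<lambda>x. f x + g x) = (\<lambda>x. ?C f x + ?C g x)"
      by (simp add: A.op_add T.op_add f g fun_eq_iff)
  qed
qed

text \<open>Solves an inequality whose right-hand side contains the unknown u: if v < u, then v^2
  may be replaced by v u, and u cancels.\<close>

lemma quadratic_bound:
  fixes u v q :: real
  assumes "0 \<le> u" "0 \<le> v" "0 \<le> q" "u\<^sup>2 \<le> v\<^sup>2 + q * v * u"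
  shows "u \<le> (1 + q) * v"
proof (rule ccontr)
  assume neg: "\<not> u \<le> (1 + q) * v"
  have "1 * v \<le> (1 + q) * v" using assms by (intro mult_right_mono) auto
  then have "v < u" using neg by linarith
  then have "v * v \<le> v * u" "0 < u" using assms by (auto intro: mult_left_mono)
  then have "u * u \<le> (1 + q) * v * u" using assms(4) by (simp add: power2_eq_square algebra_simps)
  then show False using neg \<open>0 < u\<close> by simp
qed

text \<open>With \<open>A\<close> the empirical operator, \<open>p = 1 + d / sqrt lam\<close> bounds the norm of
  \<open>(L + lam)\<^bsup>1/2\<^esup> (A + lam)\<^bsup>-1/2\<^esup>\<close>.  The estimator applies \<open>g(A) = R + lam R\<^sup>2\<close>,
  \<open>R = (A + lam)\<^bsup>-1\<^esup>\<close>, to the data \<open>b\<close>, and \<open>g(A) b - h = g(A) (b - A h) - lam\<^sup>2 R\<^sup>2 h\<close>.\<close>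

lemma sharp_error_le:
  assumes N: "0 < N" and d: "0 \<le> d"
    and op: "\<And>f. f \<in> H \<Longrightarrow> T.dual.nrm (\<lambda>x. emp_op K N xs f x - L f x) \<le> d * nrm f"
    and b: "b \<in> H" and f: "fs \<in> L2_space \<nu>" and h: "h \<in> H"
    and eta: "T.dual.nrm (\<lambda>x. b x - L fs x) \<le> \<eta>"
    and a: "L2.nrm (\<lambda>x. h x - fs x) \<le> a" and hn: "nrm h \<le> hn"
  defines "R \<equiv> resolvent H (emp_op K N xs) lam" and "p \<equiv> 1 + d / sqrt lam"
  shows "L2.nrm (\<lambda>x. (R b x + lam * R (R b) x) - fs x)
    \<le> 2 * p\<^sup>2 * (\<eta> + a + d * hn) + p * sqrt lam * hn + a"
proof -
  let ?A = "emp_op K N xs"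
  interpret A: positive_operator H ip ?A "\<kappa>\<^sup>2" by (rule emp_op_positive[OF N])
  interpret A: shifted_operator H ip ?A "\<kappa>\<^sup>2" lam by unfold_locales (rule lam)
  have p: "1 \<le> p" using d lam by (simp add: p_def)
  have compare: "T.shift.nrm g \<le> p * A.shift.nrm g" if g: "g \<in> H" for g
    unfolding p_def
  proof (rule quadratic_bound)
    let ?u = "T.shift.nrm g" and ?v = "A.shift.nrm g"
    let ?D = "\<lambda>x. ?A g x - L g x"
    have D: "?D \<in> H" by (intro diff_closed A.op_closed T.op_closed g)
    \<comment> \<open>The two regularized forms differ exactly by the operator deviation. Duality
      bounds that difference by the norm under estimation, which leads to
      \<open>quadratic_bound\<close>.\<close>
    have "?u\<^sup>2 = ?v\<^sup>2 - ip ?D g"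
      by (simp add: T.shift.nrm_sq A.shift.nrm_sq g T.form_shift A.form_shift form_diff_left
          A.op_closed T.op_closed)
    also have "\<dots> \<le> ?v\<^sup>2 + T.dual.nrm ?D * ?u"
      using T.form_le_dual_shift[OF D g] by linarith
    also have "\<dots> \<le> ?v\<^sup>2 + (d / sqrt lam * ?v) * ?u"
    proof (intro add_left_mono mult_right_mono T.shift.nrm_nonneg g)
      have "sqrt lam * nrm g \<le> ?v" by (rule A.shift_nrm_ge[OF g])
      then have "nrm g \<le> ?v / sqrt lam" using lam by (simp add: field_simps)
      then have "d * nrm g \<le> d * (?v / sqrt lam)" using d by (rule mult_left_mono)
      then show "T.dual.nrm ?D \<le> d / sqrt lam * ?v" using op[OF g] by simp
    qed
    finally show "?u\<^sup>2 \<le> ?v\<^sup>2 + d / sqrt lam * ?v * ?u" .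
  qed (use d lam in \<open>auto simp: T.shift.nrm_nonneg A.shift.nrm_nonneg g\<close>)
  \<comment> \<open>One factor p for entering the empirical norm through the resolvent;
    \<open>compare\<close> adds the second one on the way back.\<close>
  have res_le: "A.shift.nrm (R w) \<le> p * T.dual.nrm w" if w: "w \<in> H" for w
  proof (rule A.shift.nrm_le_if_form_le)
    show Rw: "R w \<in> H" unfolding R_def by (rule A.res_closed[OF w])
    have "ip (A.sh (R w)) (R w) = ip w (R w)" by (simp add: R_def A.shift_res w)
    also have "\<dots> \<le> T.dual.nrm w * T.shift.nrm (R w)"
      using T.form_le_dual_shift[OF w Rw] by linarith
    also have "\<dots> \<le> T.dual.nrm w * (p * A.shift.nrm (R w))"
      by (intro mult_left_mono compare Rw T.dual.nrm_nonneg w)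
    finally show "ip (A.sh (R w)) (R w) \<le> p * T.dual.nrm w * A.shift.nrm (R w)"
      by (simp add: mult_ac)
  qed (use p T.dual.nrm_nonneg[OF w] in simp)
  let ?h' = "\<lambda>x. b x - ?A h x"
  have h': "?h' \<in> H" by (intro diff_closed b A.op_closed h)
  have R_closed: "R w \<in> H" if "w \<in> H" for w unfolding R_def by (rule A.res_closed[OF that])
  let ?I = "\<lambda>x. R ?h' x + lam * R (R ?h') x" and ?J = "\<lambda>x. lam * R (\<lambda>x. lam * R h x) x"
  have I: "?I \<in> H" and J: "?J \<in> H"
    by (intro add_closed scale_closed R_closed h' h)+
  have decomp: "(R b x + lam * R (R b) x) - fs x = (?I x - ?J x) + (h x - fs x)" for x
  proof -
    have RA: "R (?A h) = (\<lambda>x. h x - lam * R h x)"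
    proof -
      have "R (?A h) = R (\<lambda>x. A.sh h x - lam * h x)"
        by (rule arg_cong[where f = R]) (rule A.op_eq_shift)
      then show ?thesis
        by (simp add: R_def A.res_diff A.res_scale A.shift_closed scale_closed h A.res_shift)
    qed
    have "R ?h' = (\<lambda>x. R b x - R (?A h) x)"
      unfolding R_def by (intro A.res_diff b A.op_closed h)
    then have 1: "R ?h' = (\<lambda>x. R b x - (h x - lam * R h x))"
      unfolding RA .
    have "R (R ?h') = (\<lambda>x. R (R b) x - (R h x - lam * R (R h) x))"
      unfolding 1 unfolding R_def
      by (simp add: A.res_diff A.res_scale A.res_closed diff_closed scale_closed b h)
    moreover have "?J x = lam * lam * R (R h) x"
      unfolding R_def by (simp add: A.res_scale A.res_closed h)
    ultimately show ?thesis by (simp add: 1 algebra_simps)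
  qed
  have h'_le: "T.dual.nrm ?h' \<le> \<eta> + a + d * hn"
  proof -
    let ?e = "\<lambda>x. b x - L fs x" and ?g = "\<lambda>x. L (\<lambda>x. h x - fs x) x" and ?D = "\<lambda>x. ?A h x - L h x"
    have hf: "(\<lambda>x. h x - fs x) \<in> L2_space \<nu>" by (intro L2.diff_closed member_L2 h f)
    have mem: "?e \<in> H" "L (\<lambda>x. h x - fs x) \<in> H" "?D \<in> H"
      by (intro diff_closed b L_closed f hf A.op_closed T.op_closed h)+
    have "?h' = (\<lambda>x. (?e x - L (\<lambda>x. h x - fs x) x) - ?D x)"
      by (simp add: fun_eq_iff L_diff member_L2 h f)
    then have "T.dual.nrm ?h' = T.dual.nrm (\<lambda>x. (?e x - L (\<lambda>x. h x - fs x) x) - ?D x)" by simp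
    also have "\<dots> \<le> T.dual.nrm (\<lambda>x. ?e x - L (\<lambda>x. h x - fs x) x) + T.dual.nrm ?D"
      by (intro T.dual.nrm_triangle_diff diff_closed mem b L_closed f)
    also have "\<dots> \<le> (T.dual.nrm ?e + T.dual.nrm (L (\<lambda>x. h x - fs x))) + T.dual.nrm ?D"
      by (intro add_right_mono T.dual.nrm_triangle_diff mem)
    also have "\<dots> \<le> (\<eta> + a) + d * hn"
    proof (intro add_mono eta)
      show "T.dual.nrm (L (\<lambda>x. h x - fs x)) \<le> a"
        using dual_norm_L_le[OF hf] a by linarith
      show "T.dual.nrm ?D \<le> d * hn"
        using op[OF h] mult_left_mono[OF hn d] by linarith
    qed
    finally show ?thesis .
  qed
  have I_le: "T.shift.nrm ?I \<le> 2 * p\<^sup>2 * (\<eta> + a + d * hn)"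
  proof -
    have "A.shift.nrm ?I \<le> A.shift.nrm (R ?h') + A.shift.nrm (\<lambda>x. lam * R (R ?h') x)"
      by (intro A.shift.nrm_triangle scale_closed R_closed h')
    also have "A.shift.nrm (\<lambda>x. lam * R (R ?h') x) = lam * A.shift.nrm (R (R ?h'))"
      using lam by (simp add: A.shift.nrm_scale R_closed h')
    also have "\<dots> \<le> A.shift.nrm (R ?h')"
      using A.res_contraction[OF R_closed[OF h']] by (simp add: R_def)
    finally have "A.shift.nrm ?I \<le> 2 * (p * T.dual.nrm ?h')" using res_le[OF h'] by linarith
    then have "p * A.shift.nrm ?I \<le> p * (2 * (p * T.dual.nrm ?h'))"
      using p by (intro mult_left_mono) auto
    also have "\<dots> = 2 * p\<^sup>2 * T.dual.nrm ?h'" by (simp add: power2_eq_square)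
    also have "\<dots> \<le> 2 * p\<^sup>2 * (\<eta> + a + d * hn)" by (intro mult_left_mono h'_le) simp
    finally show ?thesis using compare[OF I] by linarith
  qed
  \<comment> \<open>The bias term is estimated in the empirical norm up to the last step, so it
    costs p only once.\<close>
  have J_le: "T.shift.nrm ?J \<le> p * sqrt lam * hn"
  proof -
    have lR: "(\<lambda>x. lam * R h x) \<in> H" by (intro scale_closed R_closed h)
    have "A.shift.nrm ?J = lam * A.shift.nrm (R (\<lambda>x. lam * R h x))"
      using lam by (simp add: A.shift.nrm_scale R_closed lR)
    also have "\<dots> \<le> A.shift.nrm (\<lambda>x. lam * R h x)"
      using A.res_contraction[OF lR] by (simp add: R_def)
    also have "\<dots> = lam * A.dual.nrm h"
      using lam by (simp add: A.shift.nrm_scale R_closed h) (simp add: R_def A.shift_nrm_res h)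
    also have "\<dots> = sqrt lam * (sqrt lam * A.dual.nrm h)"
      using lam by (simp flip: mult.assoc)
    also have "\<dots> \<le> sqrt lam * nrm h"
      by (intro mult_left_mono A.dual_nrm_le h) (use lam in auto)
    also have "\<dots> \<le> sqrt lam * hn" by (intro mult_left_mono hn) (use lam in auto)
    finally have "p * A.shift.nrm ?J \<le> p * (sqrt lam * hn)" using p by (intro mult_left_mono) auto
    then show ?thesis using compare[OF J] by (simp add: mult.assoc)
  qed
  have "L2.nrm (\<lambda>x. (R b x + lam * R (R b) x) - fs x) = L2.nrm (\<lambda>x. (?I x - ?J x) + (h x - fs x))"
    unfolding decomp ..
  also have "\<dots> \<le> L2.nrm (\<lambda>x. ?I x - ?J x) + L2.nrm (\<lambda>x. h x - fs x)"
    by (intro L2.nrm_triangle L2.diff_closed member_L2 I J h f)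
  also have "L2.nrm (\<lambda>x. ?I x - ?J x) \<le> T.shift.nrm (\<lambda>x. ?I x - ?J x)"
    by (intro L2_norm_le_shift diff_closed I J)
  also have "\<dots> \<le> T.shift.nrm ?I + T.shift.nrm ?J"
    by (intro T.shift.nrm_triangle_diff I J)
  finally show ?thesis using I_le J_le a by linarith
qed

end

section \<open>The source condition\<close>

context regularized
begin

text \<open>The approximant is \<open>L\<^bsup>r\<^esup> u\<close> with the eigenvalues below \<open>lam\<close> cut off, taken over a finite
  set of eigenvalues.\<close>

lemma source_approximation:
  assumes src: "is_power_apply \<nu> L r u fs" and r: "0 < r" "r < 1 / 2" and e: "0 < e"
  obtains h where "h \<in> H"
    "L2.nrm (\<lambda>x. h x - fs x) \<le> lam powr r * L2.nrm u + e"
    "nrm h \<le> lam powr (r - 1 / 2) * L2.nrm u"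
proof -
  let ?ev = "L2_eigenvalues \<nu> L"
  from src obtain P where u: "u \<in> L2_space \<nu>" and fs: "fs \<in> L2_space \<nu>"
    and P: "\<And>m. m \<in> ?ev \<Longrightarrow> is_eigenprojection \<nu> L m u (P m)"
    and lim: "((\<lambda>S. L2_norm \<nu> (\<lambda>x. fs x - (\<Sum>m\<in>S. m powr r * P m x))) \<longlongrightarrow> 0)
      (finite_subsets_at_top ?ev)"
    unfolding is_power_apply_def is_spectral_apply_def by blast
  have "eventually (\<lambda>S. L2_norm \<nu> (\<lambda>x. fs x - (\<Sum>m\<in>S. m powr r * P m x)) < e)
      (finite_subsets_at_top ?ev)"
    using lim e by (rule order_tendstoD)
  then obtain S where S: "finite S" "S \<subseteq> ?ev"
    and Se: "L2.nrm (\<lambda>x. fs x - (\<Sum>m\<in>S. m powr r * P m x)) < e"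
    unfolding eventually_finite_subsets_at_top L2_norm_eq by blast
  have P2: "P m \<in> L2_space \<nu>" and LP: "AE x in \<nu>. L (P m) x = m * P m x" if "m \<in> S" for m
    using P[of m] S that by (auto simp: is_eigenprojection_def L2_eigenspace_def)
  \<comment> \<open>Eigenvalue equations hold only almost everywhere, so equality has to be
    transferred through the L2 form.\<close>
  have form_cong: "L2_inner \<nu> f g = L2_inner \<nu> f g'"
    if "AE x in \<nu>. g x = g' x" "f \<in> L2_space \<nu>" "g \<in> L2_space \<nu>" "g' \<in> L2_space \<nu>" for f g g'
    unfolding L2_inner_def
    by (rule integral_cong_AE)
      (use that in \<open>auto simp: L2_space_def intro!: borel_measurable_times elim: eventually_mono\<close>)
  have eig: "L2_inner \<nu> f (L g) = m * L2_inner \<nu> f g"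
    if "AE x in \<nu>. L g x = m * g x" "f \<in> L2_space \<nu>" "g \<in> L2_space \<nu>" for f g m
    using form_cong[OF that(1,2) member_L2[OF L_closed[OF that(3)]] L2.scale_closed[OF that(3)]]
      L2.form_scale_right[OF that(3,2)] by simp
  have form_LL: "ip (L f) (L g) = L2_inner \<nu> f (L g)" if "f \<in> L2_space \<nu>" "g \<in> L2_space \<nu>" for f g
    by (intro form_L L_closed that)
  have ev_nonneg: "0 \<le> m" if m: "m \<in> S" for m
  proof -
    obtain \<phi> where phi: "\<phi> \<in> L2_space \<nu>" "AE x in \<nu>. L \<phi> x = m * \<phi> x" "L2_norm \<nu> \<phi> \<noteq> 0"
      using m S by (auto simp: L2_eigenvalues_def L2_eigenspace_def)
    have "0 \<le> ip (L \<phi>) (L \<phi>)" by (intro form_nonneg L_closed phi)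
    also have "\<dots> = m * L2_inner \<nu> \<phi> \<phi>" by (simp add: form_LL eig phi)
    finally have "0 \<le> m * L2_inner \<nu> \<phi> \<phi>" .
    moreover have "0 < L2_inner \<nu> \<phi> \<phi>"
      using phi(3) L2.form_nonneg[OF phi(1)] unfolding L2_norm_eq fun_norm_def by simp
    ultimately show ?thesis by (simp add: zero_le_mult_iff)
  qed
  define w where "w m = L2_inner \<nu> (P m) (P m)" for m
  \<comment> \<open>By symmetry of the inner product of L (P m) and L (P m'), the L2 product times
    m' equals the L2 product times m, which makes it vanish for distinct eigenvalues.\<close>
  have orth: "L2_inner \<nu> (P m) (P m') = (if m = m' then w m else 0)" if "m \<in> S" "m' \<in> S" for m m'
  proof (cases "m = m'")
    case False
    have "m' * L2_inner \<nu> (P m) (P m') = ip (L (P m)) (L (P m'))"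
      using that by (simp add: form_LL P2 eig[OF LP[OF that(2)] P2 P2])
    also have "\<dots> = ip (L (P m')) (L (P m))" by (intro form_sym L_closed P2 that)
    also have "\<dots> = m * L2_inner \<nu> (P m) (P m')"
      using that by (simp add: form_LL P2 eig[OF LP[OF that(1)] P2 P2]
          L2.form_sym[OF P2[OF that(1)] P2[OF that(2)]])
    finally show ?thesis using False by simp
  qed (simp add: w_def)
  have w: "0 \<le> w m" if "m \<in> S" for m unfolding w_def by (intro L2.form_nonneg P2 that)
  have uP: "L2_inner \<nu> u (P m) = w m" if m: "m \<in> S" for m
  proof -
    have "is_eigenprojection \<nu> L m u (P m)" using P S m by blast
    then have "L2_inner \<nu> (\<lambda>x. u x - P m x) (P m) = 0" by (simp add: is_eigenprojection_def)
    then show ?thesis by (simp add: L2.form_diff_left u P2 m w_def)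
  qed
  have sq: "L2_inner \<nu> (\<lambda>x. \<Sum>m\<in>S. a m * P m x) (\<lambda>x. \<Sum>m\<in>S. a m * P m x)
    = (\<Sum>m\<in>S. (a m)\<^sup>2 * w m)" for a
  proof -
    have "L2_inner \<nu> (\<lambda>x. \<Sum>m\<in>S. a m * P m x) (\<lambda>x. \<Sum>m\<in>S. a m * P m x)
        = (\<Sum>m\<in>S. \<Sum>m'\<in>S. a m * a m' * L2_inner \<nu> (P m) (P m'))"
      by (intro L2.form_lincomb_lincomb S P2)
    also have "\<dots> = (\<Sum>m\<in>S. \<Sum>m'\<in>S. if m = m' then a m * a m' * w m else 0)"
      by (intro sum.cong refl) (simp add: orth)
    also have "\<dots> = (\<Sum>m\<in>S. (a m)\<^sup>2 * w m)"
      using S by (simp add: power2_eq_square)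
    finally show ?thesis .
  qed
  have wU: "(\<Sum>m\<in>S. w m) \<le> (L2.nrm u)\<^sup>2"
  proof -
    let ?p = "\<lambda>x. \<Sum>m\<in>S. 1 * P m x"
    have p: "?p \<in> L2_space \<nu>" by (intro L2.lincomb_closed S P2)
    have "L2_inner \<nu> u ?p = (\<Sum>m\<in>S. w m)"
      by (subst L2.form_lincomb_right) (auto intro: S P2 u simp: uP)
    moreover have "L2_inner \<nu> ?p ?p = (\<Sum>m\<in>S. w m)" using sq[of "\<lambda>_. 1"] by simp
    ultimately show ?thesis
      using L2.form_nonneg[OF L2.diff_closed[OF u p]]
        by (simp only: L2.form_diff_self u p L2.nrm_sq)
  qed
  define S' where "S' = {m \<in> S. lam \<le> m}"
  have S': "finite S'" "S' \<subseteq> S" using S by (auto simp: S'_def)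
  have powr_minus: "m powr r = m powr (r - 1) * m" if "m \<in> S'" for m
    using that lam by (simp add: S'_def powr_diff)
  \<comment> \<open>P m agrees with an element of H only almost everywhere, whereas L (P m) is one.
    Using L (P m) introduces a factor m, hence the exponent r - 1.\<close>
  let ?h = "\<lambda>x. \<Sum>m\<in>S'. m powr (r - 1) * L (P m) x"
  have h: "?h \<in> H" using S' by (intro lincomb_closed L_closed P2) auto
  have "nrm ?h \<le> lam powr (r - 1 / 2) * L2.nrm u"
  proof (rule power2_le_imp_le)
    have LL: "ip (L (P m)) (L (P m')) = (if m = m' then m * w m else 0)"
      if "m \<in> S'" "m' \<in> S'" for m m'
    proof -
      have "m \<in> S" "m' \<in> S" using that S' by auto
      then show ?thesis by (simp add: form_LL P2 eig[OF LP P2 P2] orth)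
    qed
    have "(nrm ?h)\<^sup>2 = (\<Sum>m\<in>S'. \<Sum>m'\<in>S'. m powr (r - 1) * m' powr (r - 1) * ip (L (P m)) (L (P m')))"
      unfolding nrm_sq[OF h] using S' by (intro form_lincomb_lincomb L_closed P2) auto
    also have "\<dots> = (\<Sum>m\<in>S'. \<Sum>m'\<in>S'. if m
      = m' then m powr (r - 1) * m' powr (r - 1) * (m * w m) else 0)"
      by (intro sum.cong refl) (simp add: LL)
    also have "\<dots> = (\<Sum>m\<in>S'. m powr (2 * r - 1) * w m)"
    proof -
      have "m powr (r - 1) * m powr (r - 1) * (m * w m) = m powr (2 * r - 1) * w m"
        if "m \<in> S'" for m
      proof -
        have "0 < m" using that lam by (simp add: S'_def)
        have "m powr (2 * r - 1) = m powr ((r - 1) + (r - 1) + 1)" by (rule arg_cong) simp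
        also have "\<dots> = m powr (r - 1) * m powr (r - 1) * m"
          using \<open>0 < m\<close> by (simp only: powr_add powr_one less_imp_le)
        finally show ?thesis by simp
      qed
      then have "(\<Sum>m\<in>S'. m powr (r - 1) * m powr (r - 1) * (m * w m))
          = (\<Sum>m\<in>S'. m powr (2 * r - 1) * w m)"
        by (rule sum.cong[OF refl])
      then show ?thesis using S'(1) by simp
    qed
    also have "\<dots> \<le> (\<Sum>m\<in>S'. lam powr (2 * r - 1) * w m)"
    proof (intro sum_mono mult_right_mono)
      fix m assume m: "m \<in> S'"
      \<comment> \<open>Since r < 1/2 the exponent is negative, so the cut-off at lam bounds the
        power from above.\<close>
      then show "m powr (2 * r - 1) \<le> lam powr (2 * r - 1)"
        using lam r by (intro powr_mono2') (auto simp: S'_def)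
      show "0 \<le> w m" using w S' m by blast
    qed
    also have "\<dots> \<le> lam powr (2 * r - 1) * (\<Sum>m\<in>S. w m)"
      unfolding sum_distrib_left[symmetric] using S S' w by (intro mult_left_mono sum_mono2) auto
    also have "\<dots> \<le> lam powr (2 * r - 1) * (L2.nrm u)\<^sup>2" by (intro mult_left_mono wU) simp
    also have "\<dots> = (lam powr (r - 1 / 2) * L2.nrm u)\<^sup>2"
    proof -
      have "(lam powr (r - 1 / 2))\<^sup>2 = lam powr (2 * r - 1)"
        by (simp add: power2_eq_square flip: powr_add)
      then show ?thesis by (simp only: power_mult_distrib)
    qed
    finally show "(nrm ?h)\<^sup>2 \<le> (lam powr (r - 1 / 2) * L2.nrm u)\<^sup>2" .
  qed (simp add: L2.nrm_nonneg u)
  moreover have "L2.nrm (\<lambda>x. ?h x - fs x) \<le> lam powr r * L2.nrm u + e"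
  proof -
    \<comment> \<open>The part that is cut off: there 0 \<le> m < lam, so m^r \<le> lam^r. The
      function \<open>?f\<close> below is the remainder of the spectral series, of norm less than
      e.\<close>
    let ?a = "\<lambda>m. if m \<in> S' then 0 else m powr r"
    let ?g = "\<lambda>x. \<Sum>m\<in>S. ?a m * P m x" and ?f = "\<lambda>x. fs x - (\<Sum>m\<in>S. m powr r * P m x)"
    have g: "?g \<in> L2_space \<nu>" by (intro L2.lincomb_closed S P2)
    have f: "?f \<in> L2_space \<nu>" by (intro L2.diff_closed L2.lincomb_closed S P2 fs)
    have hS: "(\<lambda>x. ?h x - fs x) \<in> L2_space \<nu>" by (intro L2.diff_closed member_L2 h fs)
    have "AE x in \<nu>. \<forall>m\<in>S. L (P m) x = m * P m x"
      using S LP by (simp add: AE_finite_all)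
    then have eq: "AE x in \<nu>. ?h x - fs x = - (?g x + ?f x)"
    proof eventually_elim
      case (elim x)
      have "(\<Sum>m\<in>S. m powr r * P m x)
        = (\<Sum>m\<in>S. (if m \<in> S' then m powr r * P m x else 0) + ?a m * P m x)"
        by (intro sum.cong) auto
      also have "\<dots> = (\<Sum>m\<in>S. if m \<in> S' then m powr r * P m x else 0) + ?g x"
        by (rule sum.distrib)
      also have "(\<Sum>m\<in>S. if m \<in> S' then m powr r * P m x else 0) = (\<Sum>m\<in>S'. m powr r * P m x)"
        using S S' by (subst sum.inter_restrict[symmetric]) (auto simp: Int_absorb1)
      also have "\<dots> = ?h x"
        using elim S' by (intro sum.cong) (auto simp: powr_minus subset_iff)
      finally show ?case by simp
    qed
    have meas: "(\<lambda>x. ?h x - fs x) \<in> borel_measurable \<nu>" "(\<lambda>x. ?g x + ?f x) \<in> borel_measurable \<nu>"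
      using hS L2.add_closed[OF g f] unfolding L2_space_def by blast+
    have "L2_norm \<nu> (\<lambda>x. ?h x - fs x) = L2_norm \<nu> (\<lambda>x. ?g x + ?f x)"
      unfolding L2_norm_def
    proof (rule arg_cong[where f = sqrt], rule integral_cong_AE)
      show "AE x in \<nu>. (?h x - fs x)\<^sup>2 = (?g x + ?f x)\<^sup>2"
        using eq by eventually_elim (simp only: power2_minus)
    qed (intro borel_measurable_power meas)+
    also have "\<dots> \<le> L2.nrm ?g + L2.nrm ?f" unfolding L2_norm_eq by (rule L2.nrm_triangle[OF g f])
    also have "L2.nrm ?g \<le> lam powr r * L2.nrm u"
    proof (rule power2_le_imp_le)
      have "(L2.nrm ?g)\<^sup>2 = (\<Sum>m\<in>S. (?a m)\<^sup>2 * w m)" unfolding L2.nrm_sq[OF g] by (rule sq)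
      also have "\<dots> \<le> (\<Sum>m\<in>S. (lam powr r)\<^sup>2 * w m)"
      proof (intro sum_mono mult_right_mono power_mono w)
        fix m assume "m \<in> S"
        then show "?a m \<le> lam powr r"
          using ev_nonneg r by (auto simp: S'_def intro!: powr_mono2)
      qed auto
      also have "\<dots> \<le> (lam powr r)\<^sup>2 * (L2.nrm u)\<^sup>2"
        unfolding sum_distrib_left[symmetric] by (intro mult_left_mono wU) simp
      finally show "(L2.nrm ?g)\<^sup>2 \<le> (lam powr r * L2.nrm u)\<^sup>2" by (simp add: power_mult_distrib)
    qed (simp add: L2.nrm_nonneg u)
    finally show ?thesis using Se unfolding L2_norm_eq by linarith
  qed
  ultimately show ?thesis using h that by blast
qed

end

section \<open>Measurability of the error\<close>

context compact_rkhs
begin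

lemma joint_kernel_measurable:
  assumes "X \<in> M \<rightarrow>\<^sub>M borel" "Y \<in> M \<rightarrow>\<^sub>M borel"
  shows "(\<lambda>z. K (X z) (Y z)) \<in> borel_measurable M"
  using measurable_compose[OF measurable_Pair[OF assms] kernel_measurable] by simp

text \<open>The resolvent is a pointwise limit of Richardson iterates. The bound \<kappa>^2 of the
  empirical operator is the same for all samples, hence so is the step size.\<close>

lemma emp_resolvent_measurable:
  fixes xs :: "'w \<Rightarrow> nat \<Rightarrow> 'a" and g :: "'w \<Rightarrow> 'a \<Rightarrow> real"
  assumes N: "0 < N" and lam: "0 < lam"
    and xs: "\<And>i. i < N \<Longrightarrow> (\<lambda>w. xs w i) \<in> M \<rightarrow>\<^sub>M borel"
    and g: "\<And>w. g w \<in> H" "(\<lambda>(w, x). g w x) \<in> borel_measurable (M \<Otimes>\<^sub>M borel)"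
  shows "(\<lambda>(w, x). resolvent H (emp_op K N (xs w)) lam (g w) x) \<in> borel_measurable (M \<Otimes>\<^sub>M borel)"
proof -
  define \<tau> where "\<tau> = shifted_operator.step_size (\<kappa>\<^sup>2) lam"
  let ?u = "\<lambda>j w. richardson (emp_op K N (xs w)) lam \<tau> (g w) j"
  have meas: "(\<lambda>p. ?u j (fst p) (snd p)) \<in> borel_measurable (M \<Otimes>\<^sub>M borel)" for j
  proof (induction j)
    case (Suc j)
    have xs': "(\<lambda>p. xs (fst p) i) \<in> M \<Otimes>\<^sub>M borel \<rightarrow>\<^sub>M borel" if "i < N" for i
      using measurable_compose[OF measurable_fst xs[OF that]] .
    \<comment> \<open>The empirical operator evaluates the previous iterate at the random nodes,
      which is why the induction carries joint measurability in sample and point.\<close>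
    have node: "(\<lambda>p. ?u j (fst p) (xs (fst p) i)) \<in> borel_measurable (M \<Otimes>\<^sub>M borel)" if "i < N" for i
      using measurable_compose[OF measurable_Pair[OF measurable_fst xs'[OF that]] Suc] by simp
    have eq: "emp_op K N (xs (fst p)) (?u j (fst p)) (snd p)
        = 1 / real N * (\<Sum>i<N. ?u j (fst p) (xs (fst p) i) * K (xs (fst p) i) (snd p))" for p
      by (rule emp_op_eq[THEN fun_cong])
    have "(\<lambda>p. emp_op K N (xs (fst p)) (?u j (fst p)) (snd p)) \<in> borel_measurable (M \<Otimes>\<^sub>M borel)"
      unfolding eq
      by (intro borel_measurable_times borel_measurable_const borel_measurable_sum node
          joint_kernel_measurable xs' measurable_snd) auto
    then show ?case
      using g(2) Suc
      by (simp add: shift_op_def split_beta' borel_measurable_diff borel_measurable_add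
        borel_measurable_times)
  qed simp
  have "(\<lambda>j. ?u j w x) \<longlonglongrightarrow> resolvent H (emp_op K N (xs w)) lam (g w) x" for w x
  proof -
    interpret A: positive_operator H ip "emp_op K N (xs w)" "\<kappa>\<^sup>2" by (rule emp_op_positive[OF N])
    interpret A: shifted_operator H ip "emp_op K N (xs w)" "\<kappa>\<^sup>2" lam by unfold_locales (rule lam)
    show ?thesis
      unfolding \<tau>_def
      by (rule eval_tendsto[OF A.richardson_closed[OF g(1)] A.res_closed[OF g(1)]
            A.richardson_tendsto[OF g(1)]])
  qed
  then have "(\<lambda>p. resolvent H (emp_op K N (xs (fst p))) lam (g (fst p)) (snd p))
      \<in> borel_measurable (M \<Otimes>\<^sub>M borel)"
    by (intro borel_measurable_LIMSEQ_real[OF _ meas])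
  then show ?thesis by (simp add: split_beta')
qed

end

section \<open>The sample\<close>

locale regression_model = compact_rkhs K H ip + R: prob_space \<rho>
  for K :: "'a::metric_space \<Rightarrow> 'a \<Rightarrow> real" and H ip and \<rho> :: "('a \<times> real) measure" +
  fixes fs :: "'a \<Rightarrow> real" and M :: real
  assumes sets_rho: "sets \<rho> = sets borel"
    and regression: "regression_function \<rho> fs"
    and response_bound: "AE z in \<rho>. \<bar>snd z\<bar> \<le> M"
    and fs_L2: "fs \<in> L2_space (marginal \<rho>)"
begin

lemma input_measurable: "fst \<in> \<rho> \<rightarrow>\<^sub>M borel"
  and response_measurable: "snd \<in> borel_measurable \<rho>"
  unfolding measurable_cong_sets[OF sets_rho refl]
  by (intro borel_measurable_continuous_onI continuous_on_fst continuous_on_snd continuous_on_id)+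

sublocale rkhs_measure K H ip "marginal \<rho>"
proof -
  interpret nu: prob_space "marginal \<rho>"
    unfolding marginal_def by (rule R.prob_space_distr[OF input_measurable])
  show "rkhs_measure K H ip (marginal \<rho>)"
    by unfold_locales (simp add: marginal_def)
qed

lemma int_op_eq: "int_op \<rho> K = L"
  by (simp add: fun_eq_iff int_op_def L_def)

lemma M_nonneg: "0 \<le> M"
proof -
  have "AE z in \<rho>. 0 \<le> M" using response_bound by eventually_elim linarith
  then show ?thesis by simp
qed

text \<open>Conditional expectation enters only here: tested against functions of the input, it
  shows that \<open>L fs\<close> is the mean of the response times the section at the input.\<close>

lemma response_integral:
  assumes g: "g \<in> H"
  shows "(\<integral>z. snd z * g (fst z) \<partial>\<rho>) = L2_inner (marginal \<rho>) fs g"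
proof -
  let ?F = "vimage_algebra (space \<rho>) fst (borel :: 'a measure)"
  have sub: "subalgebra \<rho> ?F"
    unfolding subalgebra_def
    using sets_image_in_sets[OF refl input_measurable] by simp
  interpret F: sigma_finite_subalgebra \<rho> ?F
    by (intro finite_measure_subalgebra_is_sigma_finite) (unfold_locales, rule sub)
  have gm: "(\<lambda>z. g (fst z)) \<in> borel_measurable ?F"
    by (rule measurable_compose[OF measurable_vimage_algebra1 member_measurable[OF g]]) simp
  have gm': "(\<lambda>z. g (fst z)) \<in> borel_measurable \<rho>"
    by (rule measurable_compose[OF input_measurable member_measurable[OF g]])
  have fm: "fs \<in> borel_measurable borel"
    and ce: "AE z in \<rho>. fs (fst z) = real_cond_exp \<rho> ?F snd z"
    using regression by (auto simp: regression_function_def)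
  have "integrable \<rho> (\<lambda>z. g (fst z) * snd z)"
  proof (rule R.integrable_const_bound[where B = "(\<kappa> * nrm g) * M"])
    show "AE z in \<rho>. norm (g (fst z) * snd z) \<le> \<kappa> * nrm g * M"
      using response_bound
    proof eventually_elim
      case (elim z)
      show ?case
        unfolding real_norm_def abs_mult
        by (intro mult_mono eval_le g elim) (use kappa_pos nrm_nonneg[OF g] in auto)
    qed
  qed (intro borel_measurable_times gm' response_measurable)
  then have "(\<integral>z. g (fst z) * snd z \<partial>\<rho>) = (\<integral>z. g (fst z) * real_cond_exp \<rho> ?F snd z \<partial>\<rho>)"
    by (intro F.real_cond_exp_intg(2)[symmetric] gm response_measurable)
  also have "\<dots> = (\<integral>z. g (fst z) * fs (fst z) \<partial>\<rho>)"
    by (rule integral_cong_AE)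
      (use ce in \<open>auto intro!: borel_measurable_times gm' borel_measurable_cond_exp2
        measurable_compose[OF input_measurable fm]\<close>)
  also have "\<dots> = (\<integral>x. g x * fs x \<partial>marginal \<rho>)"
    unfolding marginal_def
    by (rule integral_distr[OF input_measurable, symmetric])
      (intro borel_measurable_times member_measurable g fm)
  finally show ?thesis by (simp add: L2_inner_def mult.commute)
qed

lemma sample_prob_space: "prob_space (sample_measure \<rho> n N)"
proof -
  interpret P1: prob_space "\<Pi>\<^sub>M i\<in>{..<n}. \<rho>" by (rule prob_space_PiM) unfold_locales
  interpret P2: prob_space "\<Pi>\<^sub>M i\<in>{n..<N}. marginal \<rho>" by (rule prob_space_PiM) unfold_locales
  interpret P12: pair_prob_space "\<Pi>\<^sub>M i\<in>{..<n}. \<rho>" "\<Pi>\<^sub>M i\<in>{n..<N}. marginal \<rho>" ..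
  show ?thesis unfolding sample_measure_def by unfold_locales
qed

lemma labelled_law: "distr (sample_measure \<rho> n N) (\<Pi>\<^sub>M i\<in>{..<n}. \<rho>) fst = (\<Pi>\<^sub>M i\<in>{..<n}. \<rho>)"
proof -
  interpret P2: prob_space "\<Pi>\<^sub>M i\<in>{n..<N}. marginal \<rho>" by (rule prob_space_PiM) unfold_locales
  show ?thesis unfolding sample_measure_def by (rule P2.distr_pair_fst)
qed

lemma labelled_measurable:
  "i < n \<Longrightarrow> (\<lambda>\<omega>. fst \<omega> i) \<in> sample_measure \<rho> n N \<rightarrow>\<^sub>M \<rho>"
  unfolding sample_measure_def
  by (rule measurable_compose[OF measurable_fst measurable_component_singleton]) simp

lemma input_nth_measurable:
  assumes "i < N"
  shows "(\<lambda>\<omega>. sample_input n \<omega> i) \<in> sample_measure \<rho> n N \<rightarrow>\<^sub>M borel"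
proof (cases "i < n")
  case True
  then show ?thesis
    using measurable_compose[OF labelled_measurable input_measurable, of i n N]
    by (simp add: sample_input_def)
next
  case False
  have "(\<lambda>\<omega>. snd \<omega> i) \<in> sample_measure \<rho> n N \<rightarrow>\<^sub>M marginal \<rho>"
    unfolding sample_measure_def
    by (rule measurable_compose[OF measurable_snd measurable_component_singleton])
      (use False assms in simp)
  then show ?thesis
    using False measurable_cong_sets[OF refl sets_nu] by (auto simp: sample_input_def)
qed

text \<open>The restriction to indices below N makes the value a point of the product space, whose
  elements are extensional.\<close>

definition inputs :: "nat \<Rightarrow> nat \<Rightarrow> 'a sample \<Rightarrow> nat \<Rightarrow> 'a" where
  "inputs n N \<omega> = (\<lambda>i\<in>{..<N}. sample_input n \<omega> i)"

lemma inputs_measurable: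
  "inputs n N \<in> sample_measure \<rho> n N \<rightarrow>\<^sub>M (\<Pi>\<^sub>M i\<in>{..<N}. marginal \<rho>)"
  unfolding inputs_def[abs_def]
  by (intro measurable_restrict)
    (simp add: measurable_cong_sets[OF refl sets_nu] input_nth_measurable)

text \<open>Labelled and unlabelled inputs together are N independent draws from the marginal, so
  the operator deviation profits from all of them. It suffices to compare boxes, whose preimages are
  again products.\<close>

lemma inputs_law:
  assumes "n \<le> N"
  shows "distr (sample_measure \<rho> n N) (\<Pi>\<^sub>M i\<in>{..<N}. marginal \<rho>) (inputs n N)
    = (\<Pi>\<^sub>M i\<in>{..<N}. marginal \<rho>)"
proof -
  interpret PN: product_sigma_finite "\<lambda>_::nat. marginal \<rho>" by unfold_locales
  interpret PR: product_sigma_finite "\<lambda>_::nat. \<rho>" by unfold_locales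
  interpret P2: prob_space "\<Pi>\<^sub>M i\<in>{n..<N}. marginal \<rho>" by (rule prob_space_PiM) unfold_locales
  let ?D = "distr (sample_measure \<rho> n N) (\<Pi>\<^sub>M i\<in>{..<N}. marginal \<rho>) (inputs n N)"
  show ?thesis
  proof (rule PN.PiM_eqI)
    fix A :: "nat \<Rightarrow> 'a set" assume "\<And>i. i \<in> {..<N} \<Longrightarrow> A i \<in> sets (marginal \<rho>)"
    then have A: "A i \<in> sets (marginal \<rho>)" "A i \<in> sets borel" if "i < N" for i
      using that sets_nu by auto
    let ?V = "\<lambda>i. fst -` A i \<inter> space \<rho>"
    have V: "?V i \<in> sets \<rho>" if "i < N" for i
      using measurable_sets[OF input_measurable A(2)[OF that]] .
    have split: "{..<N} = {..<n} \<union> {n..<N}" using assms by auto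
    have "inputs n N -` Pi\<^sub>E {..<N} A \<inter> space (sample_measure \<rho> n N)
        = Pi\<^sub>E {..<n} ?V \<times> Pi\<^sub>E {n..<N} A"
    proof (intro equalityI subsetI)
      fix \<omega> assume "\<omega> \<in> inputs n N -` Pi\<^sub>E {..<N} A \<inter> space (sample_measure \<rho> n N)"
      then have w: "\<And>i. i < N \<Longrightarrow> sample_input n \<omega> i \<in> A i"
        and s: "fst \<omega> \<in> Pi\<^sub>E {..<n} (\<lambda>_. space \<rho>)" "snd \<omega> \<in> Pi\<^sub>E {n..<N} (\<lambda>_. space (marginal \<rho>))"
        by (auto simp: inputs_def sample_measure_def space_pair_measure space_PiM PiE_iff)
      have "fst \<omega> \<in> Pi\<^sub>E {..<n} ?V" "snd \<omega> \<in> Pi\<^sub>E {n..<N} A"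
        using s w assms by (auto simp: PiE_iff sample_input_def)
          (metis less_le_trans, metis leD)
      then show "\<omega> \<in> Pi\<^sub>E {..<n} ?V \<times> Pi\<^sub>E {n..<N} A" by (simp add: mem_Times_iff)
    next
      fix \<omega> assume "\<omega> \<in> Pi\<^sub>E {..<n} ?V \<times> Pi\<^sub>E {n..<N} A"
      then have w: "fst \<omega> \<in> Pi\<^sub>E {..<n} ?V" "snd \<omega> \<in> Pi\<^sub>E {n..<N} A" by auto
      have "inputs n N \<omega> \<in> Pi\<^sub>E {..<N} A"
        using w by (auto simp: inputs_def sample_input_def PiE_iff)
      moreover have "\<omega> \<in> space (sample_measure \<rho> n N)"
        using w by (auto simp: sample_measure_def space_pair_measure space_PiM PiE_iff space_nu
          mem_Times_iff)
      ultimately show "\<omega> \<in> inputs n N -` Pi\<^sub>E {..<N} A \<inter> space (sample_measure \<rho> n N)" by simp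
    qed
    then have "emeasure ?D (Pi\<^sub>E {..<N} A)
      = emeasure (sample_measure \<rho> n N) (Pi\<^sub>E {..<n} ?V \<times> Pi\<^sub>E {n..<N} A)"
      using A by (subst emeasure_distr[OF inputs_measurable]) (auto intro!: sets_PiM_I_finite)
    also have "\<dots> = emeasure (\<Pi>\<^sub>M i\<in>{..<n}. \<rho>) (Pi\<^sub>E {..<n} ?V)
        * emeasure (\<Pi>\<^sub>M i\<in>{n..<N}. marginal \<rho>) (Pi\<^sub>E {n..<N} A)"
      unfolding sample_measure_def using A V assms
      by (intro P2.emeasure_pair_measure_Times sets_PiM_I_finite) auto
    also have "\<dots> = (\<Prod>i<n. emeasure \<rho> (?V i)) * (\<Prod>i=n..<N. emeasure (marginal \<rho>) (A i))"
      by (intro arg_cong2[where f = "(*)"] PR.emeasure_PiM PN.emeasure_PiM)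
        (use A V assms in auto)
    also have "(\<Prod>i<n. emeasure \<rho> (?V i)) = (\<Prod>i<n. emeasure (marginal \<rho>) (A i))"
      using A assms unfolding marginal_def
        by (intro prod.cong refl) (simp add: emeasure_distr[OF input_measurable])
    also have "(\<Prod>i<n. emeasure (marginal \<rho>) (A i)) * (\<Prod>i=n..<N. emeasure (marginal \<rho>) (A i))
        = (\<Prod>i<N. emeasure (marginal \<rho>) (A i))"
      unfolding split by (rule prod.union_disjoint[symmetric]) auto
    finally show "emeasure ?D (Pi\<^sub>E {..<N} A) = (\<Prod>i<N. emeasure (marginal \<rho>) (A i))" .
  qed auto
qed

end

text \<open>In the application m = M / \<kappa>, q = B_N / sqrt lam, B = B_n, \<Lambda> = lam^r and
  U is the norm of u^*. Everything is measured against P = (q + 1) l, which dominates both p and l: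
  the data term needs p^2 l \<le> P^3, the others 2 p^3 + p + 1 \<le> 4 P^3.\<close>

lemma combine_bounds:
  fixes l q m B U \<Lambda> :: real
  assumes l: "1 \<le> l" and q: "0 \<le> q" and nonneg: "0 \<le> m" "0 \<le> B" "0 \<le> U" "0 \<le> \<Lambda>"
  defines "p \<equiv> 1 + q * l"
  shows "2 * p\<^sup>2 * (m * B * l + \<Lambda> * U + (p - 1) * (\<Lambda> * U)) + p * (\<Lambda> * U) + \<Lambda> * U
    \<le> (2 * m + 4 * U) * (q + 1) ^ 3 * (B + \<Lambda>) * l ^ 3"
proof -
  let ?P = "(q + 1) * l"
  have p1: "1 \<le> p" using l q by (simp add: p_def)
  have pP: "p \<le> ?P" using l by (simp add: p_def algebra_simps)
  have lP: "l \<le> ?P" using l q by (simp add: algebra_simps)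
  have p3: "p ^ 3 \<le> ?P ^ 3" using p1 pP by (intro power_mono) auto
  have "p\<^sup>2 * l \<le> ?P\<^sup>2 * ?P" using p1 pP lP l by (intro mult_mono power_mono) auto
  then have p2: "p\<^sup>2 * l \<le> ?P ^ 3" by (simp add: power2_eq_square power3_eq_cube)
  have "p \<le> p ^ 3" "1 \<le> p ^ 3" using p1 by (auto simp: self_le_power)
  then have small: "2 * p ^ 3 + p + 1 \<le> 4 * ?P ^ 3" using p3 by linarith
  have "2 * p\<^sup>2 * (m * B * l + \<Lambda> * U + (p - 1) * (\<Lambda> * U)) + p * (\<Lambda> * U) + \<Lambda> * U
      = 2 * (m * B) * (p\<^sup>2 * l) + (\<Lambda> * U) * (2 * p ^ 3 + p + 1)"
    by (simp add: power2_eq_square power3_eq_cube algebra_simps)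
  also have "\<dots> \<le> 2 * (m * B) * ?P ^ 3 + (\<Lambda> * U) * (4 * ?P ^ 3)"
    using nonneg by (intro add_mono mult_left_mono p2 small) auto
  \<comment> \<open>The missing products m \<Lambda> and U B are added in order to factor the
    sum.\<close>
  also have "\<dots> \<le> 2 * (m * B) * ?P ^ 3 + (\<Lambda> * U) * (4 * ?P ^ 3) + (2 * (m * \<Lambda>) + 4 * (U * B))
    * ?P ^ 3"
    using nonneg l q by simp
  also have "\<dots> = (2 * m + 4 * U) * (q + 1) ^ 3 * (B + \<Lambda>) * l ^ 3"
    unfolding power_mult_distrib by (simp add: algebra_simps)
  finally show ?thesis .
qed

section \<open>The data term and the measurability of the error\<close>

context regression_model
begin

definition data :: "nat \<Rightarrow> (nat \<Rightarrow> 'a \<times> real) \<Rightarrow> 'a \<Rightarrow> real" where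
  "data n zs = (\<lambda>x. 1 / real n * (\<Sum>i<n. snd (zs i) * K (fst (zs i)) x))"

lemma data_closed: "data n zs \<in> H"
  unfolding data_def
  by (intro scale_closed[of _ "1 / real n"] lincomb_closed section_closed) simp

text \<open>The zero responses and the factor N / n turn the average over all N points into the
  average over the n labelled ones.\<close>

lemma sampling_adj_response:
  assumes "1 \<le> n" "n \<le> N"
  shows "(\<lambda>x. 1 / real N * sampling_adj K N (sample_input n \<omega>) (sample_response n N \<omega>) x)
    = data n (fst \<omega>)"
proof
  fix x
  have "sampling_adj K N (sample_input n \<omega>) (sample_response n N \<omega>) x
      = (\<Sum>i<n. real N / real n * (snd (fst \<omega> i) * K (fst (fst \<omega> i)) x))"
    unfolding sampling_adj_def using assms
    by (intro sum.mono_neutral_cong_right) (auto simp: sample_response_def sample_input_def)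
  also have "\<dots> = real N / real n * (\<Sum>i<n. snd (fst \<omega> i) * K (fst (fst \<omega> i)) x)"
    by (rule sum_distrib_left[symmetric])
  finally show "1 / real N * sampling_adj K N (sample_input n \<omega>) (sample_response n N \<omega>) x
      = data n (fst \<omega>) x"
    using assms by (simp add: data_def)
qed

lemma krr_estimator_eq:
  "1 \<le> n \<Longrightarrow> n \<le> N \<Longrightarrow> krr_estimator K H n N lam \<omega>
    = resolvent H (emp_op K N (sample_input n \<omega>)) lam (data n (fst \<omega>))"
  unfolding krr_estimator_def by (simp only: sampling_adj_response)

text \<open>\<open>measure\<close> is 0 on non-measurable sets, so enlarging the good event to the
  set where the bound holds requires this.\<close>

lemma L2_error_measurable:
  assumes nN: "1 \<le> n" "n \<le> N" and lam: "0 < lam"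
  shows "L2_error \<rho> K H fs n N lam \<in> borel_measurable (sample_measure \<rho> n N)"
proof -
  let ?S = "sample_measure \<rho> n N"
  have N: "0 < N" using nN by simp
  have data: "(\<lambda>(\<omega>, x). data n (fst \<omega>) x) \<in> borel_measurable (?S \<Otimes>\<^sub>M borel)"
  proof -
    have z: "(\<lambda>p. fst (fst p) i) \<in> ?S \<Otimes>\<^sub>M borel \<rightarrow>\<^sub>M \<rho>" if "i < n" for i
      by (rule measurable_compose[OF measurable_fst labelled_measurable[OF that]])
    show ?thesis
      unfolding data_def split_beta'
      by (intro borel_measurable_times borel_measurable_const borel_measurable_sum
          joint_kernel_measurable measurable_snd measurable_compose[OF z response_measurable]
          measurable_compose[OF z input_measurable]) auto
  qed
  have "krr_estimator K H n N lam \<omega> \<in> H" for \<omega>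
  proof -
    interpret A: positive_operator H ip "emp_op K N (sample_input n \<omega>)" "\<kappa>\<^sup>2"
      by (rule emp_op_positive[OF N])
    interpret A: shifted_operator H ip "emp_op K N (sample_input n \<omega>)" "\<kappa>\<^sup>2" lam
      by unfold_locales (rule lam)
    show ?thesis unfolding krr_estimator_eq[OF nN] by (rule A.res_closed[OF data_closed])
  qed
  moreover have krr: "(\<lambda>(\<omega>, x). krr_estimator K H n N lam \<omega> x) \<in> borel_measurable (?S \<Otimes>\<^sub>M borel)"
    unfolding krr_estimator_eq[OF nN]
    by (rule emp_resolvent_measurable[OF N lam input_nth_measurable data_closed data])
  ultimately have krr2: "(\<lambda>(\<omega>, x). resolvent H (emp_op K N (sample_input n \<omega>)) lam
      (krr_estimator K H n N lam \<omega>) x) \<in> borel_measurable (?S \<Otimes>\<^sub>M borel)"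
    by (intro emp_resolvent_measurable[OF N lam input_nth_measurable])
  have fs: "(\<lambda>p. fs (snd p)) \<in> borel_measurable (?S \<Otimes>\<^sub>M borel)"
    using regression by (intro measurable_compose[OF measurable_snd])
      (simp add: regression_function_def)
  have "(\<lambda>(\<omega>, x). (sharp_estimator K H n N lam \<omega> x - fs x)\<^sup>2) \<in> borel_measurable (?S \<Otimes>\<^sub>M borel)"
    using krr krr2 fs unfolding sharp_estimator_def split_beta'
    by (intro borel_measurable_power borel_measurable_diff borel_measurable_add
      borel_measurable_times
        borel_measurable_const)
  then have "(\<lambda>(\<omega>, x). (sharp_estimator K H n N lam \<omega> x - fs x)\<^sup>2) \<in> borel_measurable
    (?S \<Otimes>\<^sub>M marginal \<rho>)"
    using measurable_cong_sets[OF sets_pair_measure_cong[OF refl sets_nu] refl] by blast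
  then have "(\<lambda>\<omega>. \<integral>x. (sharp_estimator K H n N lam \<omega> x - fs x)\<^sup>2 \<partial>marginal \<rho>) \<in> borel_measurable ?S"
    by (rule nu.borel_measurable_lebesgue_integral)
  then show ?thesis
    unfolding L2_error_def[abs_def] L2_norm_def
    by (rule measurable_compose[OF _ borel_measurable_sqrt, unfolded comp_def])
qed

end

section \<open>The error bound\<close>

locale regularized_regression = regression_model K H ip \<rho> fs M
  for K :: "'a::metric_space \<Rightarrow> 'a \<Rightarrow> real" and H ip \<rho> fs M +
  fixes lam :: real
  assumes lam_pos: "0 < lam"
begin

sublocale regularized K H ip "marginal \<rho>" lam
  by unfold_locales (rule lam_pos)

lemma eff_dim_eq: "eff_dim \<rho> K H ip lam = eff"
  unfolding eff_dim_def int_op_eq by (rule trace_eq)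

lemma B_quant_eq: "B_quant \<rho> K H ip n lam = B_eff n"
  by (simp add: B_quant_def B_eff_def eff_dim_eq)

lemma labelled_features:
  assumes "0 < b" "M \<le> b"
  shows "random_features K H ip (marginal \<rho>) lam \<rho> fst (\<lambda>_. snd) (\<lambda>_. L fs) 1 b"
proof unfold_locales
  show "fst \<in> \<rho> \<rightarrow>\<^sub>M borel" by (rule input_measurable)
  show "snd \<in> borel_measurable \<rho>" by (rule response_measurable)
  show "distr \<rho> borel fst = marginal \<rho>" by (simp add: marginal_def)
  show "0 < b" by fact
  show "L fs \<in> H" by (rule L_closed[OF fs_L2])
  show "(\<integral>z. snd z * g (fst z) \<partial>\<rho>) = ip (L fs) g" if "g \<in> H" for g
    using that by (simp add: response_integral form_L fs_L2)
  show "AE z in \<rho>. (\<Sum>k<1::nat. (snd z)\<^sup>2) \<le> b\<^sup>2"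
    using response_bound
  proof eventually_elim
    case (elim z)
    then have "\<bar>snd z\<bar>\<^sup>2 \<le> b\<^sup>2" using assms by (intro power_mono) auto
    then show ?case by simp
  qed
qed

text \<open>The bound b = \<kappa> is uniform in the truncation m: by Bessel for the section at x,
  the squares of the basis functions at x have sum at most \<open>K x x\<close>.\<close>

lemma operator_features:
  "random_features K H ip (marginal \<rho>) lam (marginal \<rho>) (\<lambda>x. x) basis (\<lambda>k. L (basis k)) m \<kappa>"
proof unfold_locales
  show "(\<lambda>x. x) \<in> marginal \<rho> \<rightarrow>\<^sub>M borel"
    by (rule measurable_ident_sets[OF sets_nu])
  show "distr (marginal \<rho>) borel (\<lambda>x. x) = marginal \<rho>"
    by (rule distr_id2) (simp add: sets_nu)
  show "0 < \<kappa>" by (rule kappa_pos)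
  fix k
  show "basis k \<in> borel_measurable (marginal \<rho>)" by (intro member_measurable_nu basis_closed)
  show "L (basis k) \<in> H" by (intro L_closed member_L2 basis_closed)
  show "(\<integral>z. basis k z * g z \<partial>marginal \<rho>) = ip (L (basis k)) g" if "g \<in> H" for g
    using that by (simp add: form_L member_L2 basis_closed L2_inner_def)
next
  have "(\<Sum>k<m. (basis k x)\<^sup>2) \<le> \<kappa>\<^sup>2" for x
  proof -
    have "ip (K x) (basis k) = basis k x" for k
      by (simp add: form_sym[OF section_closed basis_closed] reproducing basis_closed)
    then show ?thesis
      using Bessel_basis[OF section_closed, of x m] diagonal_le[of x] by (simp add: form_section)
  qed
  then show "AE x in marginal \<rho>. (\<Sum>k<m. (basis k x)\<^sup>2) \<le> \<kappa>\<^sup>2" by simp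
qed

text \<open>The concentration inequality needs a positive bound on the features, hence the limit
  \<open>b \<rightarrow> M\<close> in case that \<open>M = 0\<close>.\<close>

lemma labelled_event:
  fixes n l
  assumes n: "0 < n" and l: "1 \<le> l"
  defines "E \<equiv> {zs \<in> space (Pi\<^sub>M {..<n} (\<lambda>_. \<rho>)).
    T.dual.nrm (\<lambda>x. data n zs x - L fs x) \<le> M / \<kappa> * B_eff n * l}"
  shows "E \<in> sets (Pi\<^sub>M {..<n} (\<lambda>_. \<rho>))" "1 - 2 * exp (- l) \<le> measure (Pi\<^sub>M {..<n} (\<lambda>_. \<rho>)) E"
proof -
  let ?M = "Pi\<^sub>M {..<n} (\<lambda>_. \<rho>)"
  interpret Pi: prob_space ?M by (rule prob_space_PiM) unfold_locales
  define q where "q zs = T.dual.nrm (\<lambda>x. data n zs x - L fs x)" for zs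
  define r where "r b = b / \<kappa> * B_eff n * l" for b
  define A where "A j = {zs \<in> space ?M. q zs \<le> r (M + 1 / real (Suc j))}" for j
  have mem: "(\<lambda>x. data n zs x - L fs x) \<in> H" for zs
    by (intro diff_closed data_closed L_closed fs_L2)
  have r_mono: "r b \<le> r b'" if "b \<le> b'" for b b'
    unfolding r_def using that kappa_pos B_eff_nonneg[of n] l
    by (intro mult_right_mono divide_right_mono) auto
  have A: "A j \<in> sets ?M \<and> 1 - 2 * exp (- l) \<le> measure ?M (A j)" for j
  proof -
    let ?b = "M + 1 / real (Suc j)"
    have b: "0 < ?b" "M \<le> ?b" using M_nonneg by (auto simp: add_nonneg_pos)
    interpret F: random_features K H ip "marginal \<rho>" lam \<rho> fst "\<lambda>_. snd" "\<lambda>_. L fs" 1 ?b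
      by (rule labelled_features[OF b])
    have dev: "F.deviation n k zs = (\<lambda>x. data n zs x - L fs x)" for k zs
      by (simp add: F.deviation_def data_def)
    have "0 \<le> r ?b" unfolding r_def using b kappa_pos B_eff_nonneg[of n] l by simp
    then have "q zs \<le> r ?b \<longleftrightarrow> (q zs)\<^sup>2 \<le> (r ?b)\<^sup>2" for zs
      using power_mono_iff[of "q zs" "r ?b" 2] T.dual.nrm_nonneg[OF mem] by (simp add: q_def)
    moreover have "(q zs)\<^sup>2 = (\<Sum>k<1::nat. ip (T.res (F.deviation n k zs))
      (F.deviation n k zs))" for zs
      unfolding q_def dev by (simp add: T.dual.nrm_sq[OF mem])
    ultimately have eq: "A j = {zs \<in> space ?M.
        (\<Sum>k<1::nat. ip (T.res (F.deviation n k zs)) (F.deviation n k zs))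
          \<le> (?b / \<kappa> * B_eff n * l)\<^sup>2}"
      unfolding A_def r_def by presburger
    show ?thesis unfolding eq by (intro conjI F.concentration[OF n l])
  qed
  have dec: "A (Suc j) \<subseteq> A j" for j
  proof -
    have "r (M + 1 / real (Suc (Suc j))) \<le> r (M + 1 / real (Suc j))"
      by (rule r_mono) (simp add: frac_le)
    then show ?thesis unfolding A_def by auto
  qed
  have lim: "(\<lambda>j. r (M + 1 / real (Suc j))) \<longlonglongrightarrow> r M"
  proof -
    have "(\<lambda>j. r (M + 1 / real (Suc j))) \<longlonglongrightarrow> r (M + 0)"
      unfolding r_def using LIMSEQ_inverse_real_of_nat kappa_pos
      by (intro tendsto_intros) (auto simp: inverse_eq_divide)
    then show ?thesis by simp
  qed
  have "E = (\<Inter>j. A j)"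
  proof (intro equalityI subsetI)
    fix zs assume zs: "zs \<in> E"
    have "r M \<le> r (M + 1 / real (Suc j))" for j by (rule r_mono) simp
    then show "zs \<in> (\<Inter>j. A j)"
      using zs unfolding E_def A_def q_def r_def[symmetric] by (auto intro: order_trans)
  next
    fix zs assume "zs \<in> (\<Inter>j. A j)"
    then have zs: "zs \<in> space ?M" "\<And>j. q zs \<le> r (M + 1 / real (Suc j))" by (auto simp: A_def)
    have "q zs \<le> r M" by (rule LIMSEQ_le_const[OF lim]) (use zs in auto)
    then show "zs \<in> E" using zs unfolding E_def q_def r_def by simp
  qed
  then show "E \<in> sets ?M" "1 - 2 * exp (- l) \<le> measure ?M E"
    using A dec Pi.prob_Inter_decreasing[of A] by (auto intro: sets.countable_INT')
qed

text \<open>The Hilbert-Schmidt bound is stated through all finite truncations. The corresponding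
  events decrease in m and satisfy one common probability bound, which their intersection
  inherits.\<close>

lemma operator_event:
  fixes N l
  assumes N: "0 < N" and l: "1 \<le> l"
  defines "E \<equiv> {xs \<in> space (Pi\<^sub>M {..<N} (\<lambda>_. marginal \<rho>)).
    \<forall>m. (\<Sum>k<m. ip (T.res (basis_deviation N xs k)) (basis_deviation N xs k)) \<le> (B_eff N * l)\<^sup>2}"
  shows "E \<in> sets (Pi\<^sub>M {..<N} (\<lambda>_. marginal \<rho>))"
    "1 - 2 * exp (- l) \<le> measure (Pi\<^sub>M {..<N} (\<lambda>_. marginal \<rho>)) E"
proof -
  let ?M = "Pi\<^sub>M {..<N} (\<lambda>_. marginal \<rho>)"
  interpret Pi: prob_space ?M by (rule prob_space_PiM) unfold_locales
  define q where "q k xs = ip (T.res (basis_deviation N xs k)) (basis_deviation N xs k)" for k xs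
  have q_nonneg: "0 \<le> q k xs" for k xs
    unfolding q_def basis_deviation_def
    by (intro T.res_pos diff_closed emp_op_closed L_closed member_L2 basis_closed)
  define A where "A m = {xs \<in> space ?M. (\<Sum>k<m. q k xs) \<le> (B_eff N * l)\<^sup>2}" for m
  have A: "A m \<in> sets ?M \<and> 1 - 2 * exp (- l) \<le> measure ?M (A m)" for m
  proof -
    interpret F: random_features K H ip "marginal \<rho>" lam "marginal \<rho>" "\<lambda>x. x" basis "\<lambda>k. L
      (basis k)" m \<kappa>
      by (rule operator_features)
    have dev: "F.deviation N k xs = basis_deviation N xs k" for k xs
      by (simp add: F.deviation_def basis_deviation_def emp_op_eq)
    show ?thesis
      using F.concentration[OF N l] kappa_pos unfolding dev q_def[symmetric] A_def by simp
  qed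
  have dec: "A (Suc m) \<subseteq> A m" for m
  proof
    fix xs assume "xs \<in> A (Suc m)"
    then show "xs \<in> A m" using q_nonneg[of m xs] by (simp add: A_def)
  qed
  have "E = (\<Inter>m. A m)" by (auto simp: E_def A_def q_def)
  then show "E \<in> sets ?M" "1 - 2 * exp (- l) \<le> measure ?M E"
    using A dec Pi.prob_Inter_decreasing[of A] by (auto intro: sets.countable_INT')
qed

theorem error_bound:
  fixes n N :: nat and \<delta> :: real
  assumes src: "is_power_apply (marginal \<rho>) (int_op \<rho> K) r u fs" and r: "0 < r" "r < 1 / 2"
    and nN: "1 \<le> n" "n \<le> N" and \<delta>: "0 < \<delta>" "\<delta> < 1"
  shows "1 - \<delta> \<le> measure (sample_measure \<rho> n N) {\<omega> \<in> space (sample_measure \<rho> n N).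
    L2_error \<rho> K H fs n N lam \<omega>
      \<le> (2 * M / \<kappa> + 4 * L2_norm (marginal \<rho>) u) * (B_quant \<rho> K H ip N lam / sqrt lam + 1) ^ 3
        * (B_quant \<rho> K H ip n lam + lam powr r) * (ln (4 / \<delta>)) ^ 3}"
    (is "_ \<le> measure ?S ?G")
proof -
  interpret S: prob_space ?S by (rule sample_prob_space)
  \<comment> \<open>With this l each event fails with probability at most 2 exp (-l) = \<delta> / 2.
    As \<delta> < 1 and e < 4, it satisfies l \<ge> 1, as the tail bound requires.\<close>
  define l where "l = ln (4 / \<delta>)"
  have l: "1 \<le> l"
  proof -
    have "exp 1 \<le> (4::real)" using exp_le by simp
    also have "4 \<le> 4 / \<delta>" using \<delta> by (simp add: field_simps)
    finally show ?thesis unfolding l_def using \<delta> by (subst ln_ge_iff) auto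
  qed
  have exp_l: "2 * exp (- l) = \<delta> / 2" using \<delta> by (simp add: l_def exp_minus)
  define U where "U = L2.nrm u"
  have u: "u \<in> L2_space (marginal \<rho>)"
    using src by (simp add: is_power_apply_def is_spectral_apply_def)
  have U: "0 \<le> U" unfolding U_def by (rule L2.nrm_nonneg[OF u])
  define E1 where "E1 = {zs \<in> space (Pi\<^sub>M {..<n} (\<lambda>_. \<rho>)).
    T.dual.nrm (\<lambda>x. data n zs x - L fs x) \<le> M / \<kappa> * B_eff n * l}"
  define E2 where "E2 = {xs \<in> space (Pi\<^sub>M {..<N} (\<lambda>_. marginal \<rho>)).
    \<forall>m. (\<Sum>k<m. ip (T.res (basis_deviation N xs k)) (basis_deviation N xs k)) \<le> (B_eff N * l)\<^sup>2}"
  have n0: "0 < n" "0 < N" using nN by auto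
  note E1 = labelled_event[OF n0(1) l, folded E1_def]
    and E2 = operator_event[OF n0(2) l, folded E2_def]
  have fst_meas: "fst \<in> ?S \<rightarrow>\<^sub>M Pi\<^sub>M {..<n} (\<lambda>_. \<rho>)"
    unfolding sample_measure_def by (rule measurable_fst)
  let ?A1 = "fst -` E1 \<inter> space ?S" and ?A2 = "inputs n N -` E2 \<inter> space ?S"
  have A1: "?A1 \<in> sets ?S" "1 - \<delta> / 2 \<le> measure ?S ?A1"
    using measurable_sets[OF fst_meas E1(1)]
      measure_distr[OF fst_meas E1(1), unfolded labelled_law] E1(2) exp_l by simp_all
  have A2: "?A2 \<in> sets ?S" "1 - \<delta> / 2 \<le> measure ?S ?A2"
    using measurable_sets[OF inputs_measurable[of n N] E2(1)]
      measure_distr[OF inputs_measurable[of n N] E2(1), unfolded inputs_law[OF nN(2)]] E2(2) exp_l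
    by simp_all
  have "measure ?S (space ?S - (?A1 \<inter> ?A2))
    \<le> measure ?S (space ?S - ?A1) + measure ?S (space ?S - ?A2)"
  proof -
    have "space ?S - (?A1 \<inter> ?A2) = (space ?S - ?A1) \<union> (space ?S - ?A2)" by blast
    then show ?thesis
      using measure_Un_le[OF sets.compl_sets[OF A1(1)] sets.compl_sets[OF A2(1)]] by simp
  qed
  then have good: "1 - \<delta> \<le> measure ?S (?A1 \<inter> ?A2)"
    using S.prob_compl[OF A1(1)] S.prob_compl[OF A2(1)] S.prob_compl[OF sets.Int[OF A1(1) A2(1)]]
      A1(2) A2(2)
    by linarith
  have "?A1 \<inter> ?A2 \<subseteq> ?G"
  proof
    fix \<omega> assume w: "\<omega> \<in> ?A1 \<inter> ?A2"
    let ?xs = "sample_input n \<omega>"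
    define d where "d = B_eff N * l"
    define p where "p = 1 + B_eff N / sqrt lam * l"
    define \<Lambda> where "\<Lambda> = lam powr r"
    have d: "0 \<le> d" using l B_eff_nonneg[of N] by (simp add: d_def)
    have p: "p = 1 + d / sqrt lam" by (simp add: p_def d_def)
    \<comment> \<open>\<open>inputs\<close> agrees with \<open>sample_input\<close> below N, and the
      empirical operator reads no other index.\<close>
    have emp: "basis_deviation N (inputs n N \<omega>) = basis_deviation N ?xs"
      by (intro ext) (simp add: basis_deviation_def emp_op_eq inputs_def)
    have op: "T.dual.nrm (\<lambda>x. emp_op K N ?xs f x - L f x) \<le> d * nrm f" if "f \<in> H" for f
      using w by (intro emp_dual_bound[OF n0(2) d _ that]) (simp add: emp d_def E2_def)
    have eta: "T.dual.nrm (\<lambda>x. data n (fst \<omega>) x - L fs x) \<le> M / \<kappa> * B_eff n * l"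
      using w by (simp add: E1_def)
    let ?rhs = "2 * p\<^sup>2 * (M / \<kappa> * B_eff n * l + \<Lambda> * U + (p - 1) * (\<Lambda> * U)) + p * (\<Lambda> * U) + \<Lambda> * U"
    \<comment> \<open>The approximant h depends on e, but the two events do not; hence e can tend to
      0 for a fixed sample.\<close>
    have le: "L2_error \<rho> K H fs n N lam \<omega> \<le> ?rhs + (2 * p\<^sup>2 + 1) * e" if e: "0 < e" for e
    proof -
      obtain h where h: "h \<in> H" "L2.nrm (\<lambda>x. h x - fs x) \<le> lam powr r * L2.nrm u + e"
        "nrm h \<le> lam powr (r - 1 / 2) * L2.nrm u"
        using source_approximation[OF src[unfolded int_op_eq] r e] by blast
      \<comment> \<open>Absorbs the growth of the norm of h, since d = (p - 1) sqrt lam.\<close>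
      have root: "sqrt lam * lam powr (r - 1 / 2) = \<Lambda>"
        using lam_pos by (simp add: \<Lambda>_def powr_half_sqrt[symmetric] flip: powr_add)
      have "L2_error \<rho> K H fs n N lam \<omega>
          \<le> 2 * p\<^sup>2 * (M / \<kappa> * B_eff n * l + (\<Lambda> * U + e) + d * (lam powr (r - 1 / 2) * U))
            + p * sqrt lam * (lam powr (r - 1 / 2) * U) + (\<Lambda> * U + e)"
        using sharp_error_le[OF n0(2) d op data_closed fs_L2 h(1) eta h(2,3)]
        unfolding L2_error_def sharp_estimator_def krr_estimator_eq[OF nN] L2_norm_eq p \<Lambda>_def
          U_def .
      also have "d * (lam powr (r - 1 / 2) * U) = (p - 1) * (\<Lambda> * U)"
        using lam_pos by (simp add: p flip: root)
      also have "p * sqrt lam * (lam powr (r - 1 / 2) * U) = p * (\<Lambda> * U)"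
        by (simp add: mult.assoc flip: root)
      finally show ?thesis by (simp add: algebra_simps)
    qed
    have "L2_error \<rho> K H fs n N lam \<omega> \<le> ?rhs"
    proof (rule field_le_epsilon)
      fix e :: real assume e: "0 < e"
      have pos: "0 < 2 * p\<^sup>2 + 1" by (simp add: add_nonneg_pos)
      show "L2_error \<rho> K H fs n N lam \<omega> \<le> ?rhs + e"
        using le[of "e / (2 * p\<^sup>2 + 1)"] e pos by simp
    qed
    also have "?rhs \<le> (2 * (M / \<kappa>) + 4 * U) * (B_eff N / sqrt lam + 1) ^ 3 * (B_eff n + \<Lambda>) * l ^ 3"
      unfolding p_def
      using M_nonneg kappa_pos B_eff_nonneg U lam_pos
      by (intro combine_bounds l) (auto simp: \<Lambda>_def)
    finally have "L2_error \<rho> K H fs n N lam \<omega>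
        \<le> (2 * (M / \<kappa>) + 4 * U) * (B_eff N / sqrt lam + 1) ^ 3 * (B_eff n + \<Lambda>) * l ^ 3" .
    then show "\<omega> \<in> ?G"
      using w by (simp add: B_quant_eq L2_norm_eq U_def l_def \<Lambda>_def)
  qed
  moreover have "?G \<in> sets ?S"
    using L2_error_measurable[OF nN lam_pos] by measurable
  ultimately have "measure ?S (?A1 \<inter> ?A2) \<le> measure ?S ?G"
    by (rule S.finite_measure_mono)
  then show ?thesis using good by linarith
qed

end

text \<open>The choice of lam equates the variance term sqrt (lam^(-\<beta>) / n) with the bias
  lam^r. With s = 2 r + \<beta>, the condition on N amounts to n^(\<beta> / s) \<le> N lam, which
  bounds both parts of B_N / sqrt lam. The condition r + \<beta> \<ge> 1/2 says r + 1/2 \<le> s and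
  makes 1 / (n sqrt lam) at most lam^r.\<close>

lemma rate_bounds:
  fixes n N :: nat and C0 \<beta> r k e lam :: real
  assumes n: "1 \<le> n" and C0: "0 < C0" and \<beta>: "0 < \<beta>" and r: "0 < r" and r\<beta>: "1 / 2 \<le> r + \<beta>"
    and k: "0 < k" and lam: "lam = real n powr (- (1 / (2 * r + \<beta>)))"
    and N: "real n powr ((1 + \<beta>) / (2 * r + \<beta>)) \<le> real N"
    and e: "0 \<le> e" "e \<le> C0 * lam powr (- \<beta>)"
  defines "B \<equiv> \<lambda>m. 2 * k / sqrt (real m) * (k / sqrt (real m * lam) + sqrt e)"
    and "c \<equiv> 2 * k\<^sup>2 + 2 * k * sqrt C0"
  shows "B N / sqrt lam \<le> c" and "B n \<le> c * real n powr (- (r / (2 * r + \<beta>)))"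
    and "lam powr r = real n powr (- (r / (2 * r + \<beta>)))"
proof -
  define s where "s = 2 * r + \<beta>"
  have s: "0 < s" using r \<beta> by (simp add: s_def)
  have n1: "1 \<le> real n" using n by simp
  have lam_pos: "0 < lam" using n by (simp add: lam)
  show "lam powr r = real n powr (- (r / (2 * r + \<beta>)))"
    by (simp add: lam powr_powr)
  have e_le: "e \<le> C0 * real n powr (\<beta> / s)"
    using e(2) by (simp add: lam powr_powr s_def)
  have B_eq: "B m = 2 * k\<^sup>2 * (1 / (real m * sqrt lam)) + 2 * k * sqrt (e / real m)"
    if "0 < m" for m :: nat
  proof -
    have "sqrt (real m) * sqrt (real m) = real m" by simp
    then show ?thesis
      using that lam_pos by (simp add: B_def real_sqrt_mult real_sqrt_divide power2_eq_square
        field_simps)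
  qed
  have N_lam: "real n powr (\<beta> / s) \<le> real N * lam"
  proof -
    have "real n powr (\<beta> / s) = real n powr ((1 + \<beta>) / s) * lam"
      unfolding lam s_def[symmetric] powr_add[symmetric]
        by (simp add: diff_divide_distrib[symmetric])
    also have "\<dots> \<le> real N * lam"
      using N lam_pos unfolding s_def by (intro mult_right_mono) auto
    finally show ?thesis .
  qed
  have pow1: "1 \<le> real n powr (\<beta> / s)" using n1 \<beta> s by (intro ge_one_powr_ge_zero) auto
  have NL: "1 \<le> real N * lam" using pow1 N_lam by linarith
  have N0: "0 < N" using NL by (cases N) auto
  have "B N / sqrt lam = 2 * k\<^sup>2 * (1 / (real N * lam)) + 2 * k * sqrt (e / (real N * lam))"
  proof -
    have "sqrt lam * sqrt lam = lam" using lam_pos by simp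
    then show ?thesis
      using N0 lam_pos by (simp add: B_eq real_sqrt_divide real_sqrt_mult field_simps)
  qed
  also have "\<dots> \<le> 2 * k\<^sup>2 * 1 + 2 * k * sqrt C0"
  proof (intro add_mono mult_left_mono real_sqrt_le_mono)
    show "1 / (real N * lam) \<le> 1" using NL by simp
    have "e \<le> C0 * (real N * lam)"
      using e_le N_lam C0 by (meson mult_left_mono less_imp_le order_trans)
    then show "e / (real N * lam) \<le> C0" using NL by (simp add: field_simps)
  qed (use k in auto)
  finally show "B N / sqrt lam \<le> c" by (simp add: c_def)
  let ?X = "real n powr (- (r / s))"
  have "1 / (real n * sqrt lam) \<le> ?X"
  proof -
    have "sqrt lam = real n powr (- (1 / (2 * s)))"
      unfolding lam s_def[symmetric]
      using n by (simp add: powr_half_sqrt[symmetric] powr_powr mult.commute)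
    then have "real n * sqrt lam = real n powr 1 * real n powr (- (1 / (2 * s)))"
      using n by simp
    also have "\<dots> = real n powr (1 - 1 / (2 * s))" by (simp only: powr_add[symmetric]) simp
    finally have "1 / (real n * sqrt lam) = real n powr (- (1 - 1 / (2 * s)))"
      by (simp only: powr_minus_divide)
    also have "\<dots> \<le> ?X"
    proof (rule powr_mono[OF _ n1])
      have "r / s + 1 / (2 * s) = (r + 1 / 2) / s" using s by (simp add: field_simps)
      also have "\<dots> \<le> 1" using s r\<beta> by (simp add: s_def)
      finally show "- (1 - 1 / (2 * s)) \<le> - (r / s)" by simp
    qed
    finally show ?thesis .
  qed
  then have "2 * k\<^sup>2 * (1 / (real n * sqrt lam)) \<le> 2 * k\<^sup>2 * ?X"
    by (rule mult_left_mono) simp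
  moreover have "sqrt (e / real n) \<le> sqrt C0 * ?X"
  proof -
    have "e / real n \<le> C0 * real n powr (\<beta> / s) / real n"
      using e_le n1 by (intro divide_right_mono) auto
    also have "\<dots> = C0 * real n powr (\<beta> / s - 1)"
      using n by (simp add: powr_diff)
    also have "\<beta> / s - 1 = - (r / s) + - (r / s)"
    proof -
      have "\<beta> = s - 2 * r" by (simp add: s_def)
      then have "\<beta> / s = 1 - 2 * r / s" using s by (simp add: diff_divide_distrib)
      then show ?thesis by simp
    qed
    also have "C0 * real n powr (- (r / s) + - (r / s)) = C0 * ?X\<^sup>2"
      unfolding powr_add power2_eq_square ..
    finally have "sqrt (e / real n) \<le> sqrt (C0 * ?X\<^sup>2)" by (rule real_sqrt_le_mono)
    then show ?thesis by (simp add: real_sqrt_mult)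
  qed
  then have "2 * k * sqrt (e / real n) \<le> 2 * k * (sqrt C0 * ?X)"
    by (rule mult_left_mono) (use k in simp)
  ultimately have "B n \<le> 2 * k\<^sup>2 * ?X + 2 * k * (sqrt C0 * ?X)"
    using n B_eq[of n] by linarith
  then show "B n \<le> c * real n powr (- (r / (2 * r + \<beta>)))"
    by (simp add: c_def s_def algebra_simps)
qed

theorem theorem2p4:
  fixes \<rho> :: "('a::metric_space \<times> real) measure"
    and K :: "'a \<Rightarrow> 'a \<Rightarrow> real"
    and H :: "('a \<Rightarrow> real) set"
    and ip :: "('a \<Rightarrow> real) \<Rightarrow> ('a \<Rightarrow> real) \<Rightarrow> real"
    and fstar ustar :: "'a \<Rightarrow> real"
    and M r :: real
  assumes "compact (UNIV :: 'a set)"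
    and "prob_space \<rho>" and "sets \<rho> = sets borel"
    and "mercer_kernel K"
    and "is_rkhs K H ip"
    and "regression_function \<rho> fstar"
    and "AE z in \<rho>. \<bar>snd z\<bar> \<le> M"
    and "0 < r" and "r < 1 / 2"
    and "ustar \<in> L2_space (marginal \<rho>)"
    and "is_power_apply (marginal \<rho>) (int_op \<rho> K) r ustar fstar"
  shows
    "(\<forall>(n::nat) (N::nat) (lam::real) (\<delta>::real).
        1 \<le> n \<and> n \<le> N \<and> 0 < lam \<and> lam \<le> 1 \<and> 0 < \<delta> \<and> \<delta> < 1 \<longrightarrow>
        measure (sample_measure \<rho> n N)
          {\<omega> \<in> space (sample_measure \<rho> n N).
             L2_error \<rho> K H fstar n N lam \<omega>
               \<le> (2 * M / kappa K + 4 * L2_norm (marginal \<rho>) ustar)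
                 * (B_quant \<rho> K H ip N lam / sqrt lam + 1) ^ 3
                 * (B_quant \<rho> K H ip n lam + lam powr r)
                 * (ln (4 / \<delta>)) ^ 3} \<ge> 1 - \<delta>)
     \<and>
     (\<forall>(C0::real) (\<beta>::real).
        0 < C0 \<and> 0 < \<beta> \<and> \<beta> \<le> 1 \<and>
        (\<forall>lam>0. eff_dim \<rho> K H ip lam \<le> C0 * lam powr (- \<beta>)) \<and>
        r + \<beta> \<ge> 1 / 2 \<longrightarrow>
        (\<exists>C'::real. \<forall>(n::nat) (N::nat) (lam::real) (\<delta>::real).
           1 \<le> n \<and> n \<le> N \<and>
           lam = real n powr (- (1 / (2 * r + \<beta>))) \<and>
           real N \<ge> real n powr ((1 + \<beta>) / (2 * r + \<beta>)) \<and>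
           0 < \<delta> \<and> \<delta> < 1 \<longrightarrow>
           measure (sample_measure \<rho> n N)
             {\<omega> \<in> space (sample_measure \<rho> n N).
                L2_error \<rho> K H fstar n N lam \<omega>
                  \<le> C' * real n powr (- (r / (2 * r + \<beta>))) * (ln (4 / \<delta>)) ^ 3} \<ge> 1 - \<delta>))"
proof -
  interpret R: prob_space \<rho> by fact
  have fs: "fstar \<in> L2_space (marginal \<rho>)"
    using assms(11) by (simp add: is_power_apply_def is_spectral_apply_def)
  interpret regression_model K H ip \<rho> fstar M
    by unfold_locales (fact assms fs)+
  let ?U = "L2_norm (marginal \<rho>) ustar"
  let ?bound = "\<lambda>n N lam \<delta>. (2 * M / \<kappa> + 4 * ?U)
    * (B_quant \<rho> K H ip N lam / sqrt lam + 1) ^ 3 * (B_quant \<rho> K H ip n lam + lam powr r)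
      * (ln (4 / \<delta>)) ^ 3"
  let ?S = "sample_measure \<rho>" and ?err = "L2_error \<rho> K H fstar"
  have model: "regularized_regression K H ip \<rho> fstar M lam" if "0 < lam" for lam
    by unfold_locales (rule that)
  have bound: "1 - \<delta> \<le> measure (?S n N) {\<omega> \<in> space (?S n N). ?err n N lam \<omega> \<le> ?bound n N lam \<delta>}"
    if "1 \<le> n" "n \<le> N" "0 < lam" "0 < \<delta>" "\<delta> < 1" for n N lam \<delta>
    using regularized_regression.error_bound[OF model[OF that(3)] assms(11,8,9) that(1,2,4,5)] .
  have ex_const: "\<exists>C'. \<forall>(n::nat) (N::nat) (lam::real) (\<delta>::real).
           1 \<le> n \<and> n \<le> N \<and> lam = real n powr (- (1 / (2 * r + \<beta>))) \<and>
           real N \<ge> real n powr ((1 + \<beta>) / (2 * r + \<beta>)) \<and> 0 < \<delta> \<and> \<delta> < 1 \<longrightarrow>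
           1 - \<delta> \<le> measure (?S n N) {\<omega> \<in> space (?S n N). ?err n N lam \<omega>
             \<le> C' * real n powr (- (r / (2 * r + \<beta>))) * (ln (4 / \<delta>)) ^ 3}"
    if C0: "0 < C0" and \<beta>: "0 < \<beta>" "\<beta> \<le> 1" and r\<beta>: "1 / 2 \<le> r + \<beta>"
      and dim: "\<And>lam. 0 < lam \<Longrightarrow> eff_dim \<rho> K H ip lam \<le> C0 * lam powr (- \<beta>)" for C0 \<beta>
  proof -
    define c where "c = 2 * \<kappa>\<^sup>2 + 2 * \<kappa> * sqrt C0"
    \<comment> \<open>The cube comes from B_N / sqrt lam \<le> c; the last factor c + 1 collects B_n
      and lam^r, bounded by c and 1 times the rate.\<close>
    define C' where "C' = (2 * M / \<kappa> + 4 * ?U) * (c + 1) ^ 3 * (c + 1)"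
    have "1 - \<delta> \<le> measure (?S n N) {\<omega> \<in> space (?S n N). ?err n N lam \<omega>
        \<le> C' * real n powr (- (r / (2 * r + \<beta>))) * (ln (4 / \<delta>)) ^ 3}"
      if n: "1 \<le> n" "n \<le> N" and lam: "lam = real n powr (- (1 / (2 * r + \<beta>)))"
        and N: "real n powr ((1 + \<beta>) / (2 * r + \<beta>)) \<le> real N" and \<delta>: "0 < \<delta>" "\<delta> < 1"
      for n N :: nat and lam \<delta> :: real
    proof -
      have lam0: "0 < lam" using n by (simp add: lam)
      interpret reg: regularized_regression K H ip \<rho> fstar M lam by (rule model[OF lam0])
      interpret S: prob_space "?S n N" by (rule sample_prob_space)
      let ?X = "real n powr (- (r / (2 * r + \<beta>)))"
      have e: "0 \<le> eff_dim \<rho> K H ip lam" by (simp add: reg.eff_dim_eq reg.eff_nonneg)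
      note rates = rate_bounds[OF n(1) C0 \<beta>(1) assms(8) r\<beta> kappa_pos lam N e dim[OF lam0],
          folded B_quant_def c_def]
      have c: "0 \<le> c" using kappa_pos C0 by (simp add: c_def)
      have B: "0 \<le> B_quant \<rho> K H ip m lam" for m by (simp add: reg.B_quant_eq reg.B_eff_nonneg)
      have ln: "0 \<le> ln (4 / \<delta>)" using \<delta> by (intro ln_ge_zero) (simp add: field_simps)
      have pre: "0 \<le> 2 * M / \<kappa> + 4 * ?U"
        using M_nonneg kappa_pos by (simp add: L2_norm_def)
      have "?bound n N lam \<delta> \<le> (2 * M / \<kappa> + 4 * ?U) * (c + 1) ^ 3 * (c * ?X + ?X)
        * (ln (4 / \<delta>)) ^ 3"
        using rates pre c B lam0 ln by
          (intro mult_right_mono mult_mono power_mono add_mono mult_left_mono) auto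
      also have "\<dots> = C' * ?X * (ln (4 / \<delta>)) ^ 3"
      proof -
        have "c * ?X + ?X = (c + 1) * ?X" by (simp add: distrib_right)
        then show ?thesis by (simp only: C'_def mult_ac)
      qed
      finally have le: "?bound n N lam \<delta> \<le> C' * ?X * (ln (4 / \<delta>)) ^ 3" .
      note [measurable] = L2_error_measurable[OF n lam0]
      have "measure (?S n N) {\<omega> \<in> space (?S n N). ?err n N lam \<omega> \<le> ?bound n N lam \<delta>}
          \<le> measure (?S n N) {\<omega> \<in> space (?S n N). ?err n N lam \<omega> \<le> C' * ?X * (ln (4 / \<delta>)) ^ 3}"
        using le by (intro S.finite_measure_mono) auto
      then show ?thesis using bound[OF n lam0 \<delta>] by linarith
    qed
    then show ?thesis by blast
  qed
  show ?thesis
  proof (intro conjI allI impI, goal_cases)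
    case (1 n N lam \<delta>)
    then show ?case using bound[of n N lam \<delta>] by simp
  next
    case (2 C0 \<beta>)
    then show ?case using ex_const[of C0 \<beta>] by simp
  qed
qed

end
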